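(* Let $\mathcal{C}$ be a $\mathbb{C}$-linear abelian rigid monoidal category in which the unit object $\mathbf{1}$ is simple, and let $X$ be a Frobenius algebra of finite length in $\mathcal{C}$ that is semisimple as an object. Then for every basis $\mathcal{B}$ of $X$, the Frobenius $\mathcal{B}$-subalgebra lattice forms a coherent sublattice of the Frobenius subalgebra poset of $X$.
   Context: Monoidal categories are taken strict. A left dual of $X$ is $(X^*,\mathrm{ev}_X:X^*\otimes X\to\mathbf 1,\mathrm{coev}_X:\mathbf 1\to X\otimes X^* )$ satisfying the zigzag identities; $f^*:Y^*\to X^*$ is the dual of $f:X\to Y$. A Frobenius algebra is $(X,m,\delta,e,\epsilon)$ with $(X,m,e)$ a unital algebra, $(X,\delta,\epsilon)$ a counital coalgebra and $(\mathrm{id}_X\otimes m)\circ(\delta\otimes \mathrm{id}_X)=\delta\circ m=(m\otimes \mathrm{id}_X)\circ(\mathrm{id}_X\otimes\delta)$. It is always regarded as selfdual, $X^*=X$, with $\mathrm{ev}_X=\epsilon\circ m$, $\mathrm{coev}_X=\delta\circ e$. A Frobenius algebra $X'$ is a Frobenius subalgebra of $X$ if there is a unital algebra monomorphism $i:X'\to X$ with $i^{**}=i$, $i^*\circ i=\mathrm{id}_{X'}$; put $b_{X'}:=i\circ i^*$. Two Frobenius subalgebras are equivalent iff their idempotents $b$ coincide; classes are denoted $[X']$; the Frobenius subalgebra poset of $X$ is the set of classes with $[X_1]\le[X_2]$ iff $b_{X_1}\circ b_{X_2}=b_{X_1}=b_{X_2}\circ b_{X_1}$. Rigidity invariance. Let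 $C$ be a semisimple object of finite length. A basis $\mathcal{B}$ of $C$ is a family $(\mathcal{B}_S)_S$, $S$ over representatives of isomorphism classes of simple objects, with $\mathcal{B}_S$ a basis of $\mathrm{Hom}(C,S)$. For each simple $S$ (with $\mathrm{End}(S)=\mathbb{C}$ by Schur's lemma), define $\kappa'_{C,S}:\mathrm{Hom}(C,S)\times\mathrm{Hom}(C^*,S^* )\to\mathbb{C}$ by $(f\otimes g)\circ\mathrm{coev}_C=\kappa'_{C,S}(f,g)\,\mathrm{coev}_S$. Let $\langle\cdot,\cdot\rangle$ be the Hermitian form on $\mathrm{Hom}(C,S)$, conjugate-linear in the second argument, for which $\mathcal{B}_S$ is orthonormal, and $M'_{C,S}:\mathrm{Hom}(C^*,S^* )\to\mathrm{Hom}(C,S)$ the conjugate-linear map with $\langle f,M'_{C,S}g\rangle=\kappa'_{C,S}(f,g)$. A split subobject $(A,i,p)$ of $C$ is $\mathcal{B}$-rigid invariant if $M'_{C,S}(\mathrm{Hom}(A^*,S^* )\circ i^* )=\mathrm{Hom}(A,S)\circ p$ for all simple $S$. A Frobenius $\mathcal{B}$-subalgebra of $X$ is a Frobenius subalgebra $A$ such that $(A,i,i^* )$ is $\mathcal{B}$-rigid invariant; the Frobenius $\mathcal{B}$-subalgebra lattice is the subposet of their classes (it is a lattice with $[A]\wedge[B]=[A\cap B]$). Ambient selfduality: let $C=C^*$ be selfdual and $(B,i,p)$ a split subobject ($p\circ i=\mathrm{id}_B$), $b=i\circ p$. Split $b^*=i'\circ p'$, $p'\circ i'=\mathrm{id}_{B'}$;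 the ambient dual of $B$ is $(B',\mathrm{ev}_C\circ(i'\otimes i),(p\otimes p')\circ\mathrm{coev}_C)$ (then $i^*=p'$, $p^*=i'$). $B$ is ambiently selfdual if it coincides with its ambient dual, i.e. one may take $B'=B$, $i'=i$, $p'=p$ (so $i^*=p$, $i^{**}=p^*=i$). A pair $(A,B)$ of subobjects of $X$ is coherent if $A$, $B$, $A\cap B$ (pullback) and $A+B$ (the join in the lattice of subobjects of $X$) are all ambiently selfdual. A sublattice $L$ of the Frobenius subalgebra poset is coherent if it has a bottom element and for all $[A],[B]\in L$ the pair $(A,B)$ is coherent and $[A]\wedge[B]=[A\cap B]$. *)

theory Defs
  imports Complex_Main "HOL-Algebra.Module" "HOL-Algebra.Lattice"
begin

definition complex_ring :: "complex ring" where
  "complex_ring = \<lparr>carrier = UNIV, mult = (*), one = 1, zero = 0, add = (+)\<rparr>"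

text \<open>
  \<open>Hom A B\<close> is a module over the field of complex numbers; its \<open>mult\<close> and \<open>one\<close> fields, which
  the type \<^typ>\<open>(complex, 'm) module\<close> inherits from rings, play no role.
\<close>

record ('o, 'm) moncat =
  Ob :: "'o set"
  Hom :: "'o \<Rightarrow> 'o \<Rightarrow> (complex, 'm) module"
  src :: "'m \<Rightarrow> 'o"
  tgt :: "'m \<Rightarrow> 'o"
  id_mor :: "'o \<Rightarrow> 'm"
  comp_mor :: "'m \<Rightarrow> 'm \<Rightarrow> 'm" (infixr "\<cdot>\<index>" 65)
  unit_ob :: "'o" ("\<^bold>1\<index>")
  tensor_ob :: "'o \<Rightarrow> 'o \<Rightarrow> 'o" (infixr "\<otimes>\<^sub>o\<index>" 70)
  tensor_mor :: "'m \<Rightarrow> 'm \<Rightarrow> 'm" (infixr "\<otimes>\<^sub>m\<index>" 70)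

definition mor :: "('o, 'm) moncat \<Rightarrow> 'o \<Rightarrow> 'o \<Rightarrow> 'm set" where
  "mor C A B = {f. A \<in> Ob C \<and> B \<in> Ob C \<and> f \<in> carrier (Hom C A B)}"


section \<open>Complex-linear abelian categories\<close>

locale linear_category =
  fixes C :: "('o, 'm) moncat" (structure)
  assumes src_mor: "f \<in> mor C A B \<Longrightarrow> src C f = A"
    and tgt_mor: "f \<in> mor C A B \<Longrightarrow> tgt C f = B"
    and id_mor_closed: "A \<in> Ob C \<Longrightarrow> id_mor C A \<in> mor C A A"
    and comp_closed: "\<lbrakk>f \<in> mor C A B; g \<in> mor C B D\<rbrakk> \<Longrightarrow> g \<cdot> f \<in> mor C A D"
    and comp_id_right: "f \<in> mor C A B \<Longrightarrow> f \<cdot> id_mor C A = f"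
    and comp_id_left: "f \<in> mor C A B \<Longrightarrow> id_mor C B \<cdot> f = f"
    and comp_assoc:
      "\<lbrakk>f \<in> mor C A B; g \<in> mor C B D; h \<in> mor C D E\<rbrakk> \<Longrightarrow> (h \<cdot> g) \<cdot> f = h \<cdot> (g \<cdot> f)"
    and Hom_module: "\<lbrakk>A \<in> Ob C; B \<in> Ob C\<rbrakk> \<Longrightarrow> module complex_ring (Hom C A B)"
    and comp_add_right:
      "\<lbrakk>f \<in> mor C A B; f' \<in> mor C A B; g \<in> mor C B D\<rbrakk>
        \<Longrightarrow> g \<cdot> (f \<oplus>\<^bsub>Hom C A B\<^esub> f') = (g \<cdot> f) \<oplus>\<^bsub>Hom C A D\<^esub> (g \<cdot> f')"
    and comp_add_left:
      "\<lbrakk>f \<in> mor C A B; g \<in> mor C B D; g' \<in> mor C B D\<rbrakk>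
        \<Longrightarrow> (g \<oplus>\<^bsub>Hom C B D\<^esub> g') \<cdot> f = (g \<cdot> f) \<oplus>\<^bsub>Hom C A D\<^esub> (g' \<cdot> f)"
    and comp_smult_right:
      "\<lbrakk>f \<in> mor C A B; g \<in> mor C B D\<rbrakk>
        \<Longrightarrow> g \<cdot> (z \<odot>\<^bsub>Hom C A B\<^esub> f) = z \<odot>\<^bsub>Hom C A D\<^esub> (g \<cdot> f)"
    and comp_smult_left:
      "\<lbrakk>f \<in> mor C A B; g \<in> mor C B D\<rbrakk>
        \<Longrightarrow> (z \<odot>\<^bsub>Hom C B D\<^esub> g) \<cdot> f = z \<odot>\<^bsub>Hom C A D\<^esub> (g \<cdot> f)"
begin

abbreviation idm :: "'o \<Rightarrow> 'm" where
  "idm A \<equiv> id_mor C A"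

abbreviation zero_mor :: "'o \<Rightarrow> 'o \<Rightarrow> 'm" where
  "zero_mor A B \<equiv> \<zero>\<^bsub>Hom C A B\<^esub>"

definition is_mono :: "'m \<Rightarrow> bool" where
  "is_mono f \<longleftrightarrow> f \<in> mor C (src C f) (tgt C f) \<and>
    (\<forall>Z. \<forall>g\<in>mor C Z (src C f). \<forall>h\<in>mor C Z (src C f). f \<cdot> g = f \<cdot> h \<longrightarrow> g = h)"

definition is_epi :: "'m \<Rightarrow> bool" where
  "is_epi f \<longleftrightarrow> f \<in> mor C (src C f) (tgt C f) \<and>
    (\<forall>Z. \<forall>g\<in>mor C (tgt C f) Z. \<forall>h\<in>mor C (tgt C f) Z. g \<cdot> f = h \<cdot> f \<longrightarrow> g = h)"

definition is_iso :: "'m \<Rightarrow> bool" where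
  "is_iso f \<longleftrightarrow> f \<in> mor C (src C f) (tgt C f) \<and>
    (\<exists>g\<in>mor C (tgt C f) (src C f). g \<cdot> f = idm (src C f) \<and> f \<cdot> g = idm (tgt C f))"

definition isomorphic :: "'o \<Rightarrow> 'o \<Rightarrow> bool" where
  "isomorphic A B \<longleftrightarrow> (\<exists>f\<in>mor C A B. is_iso f)"

definition is_zero_ob :: "'o \<Rightarrow> bool" where
  "is_zero_ob Z \<longleftrightarrow> Z \<in> Ob C \<and> (\<forall>A\<in>Ob C. (\<exists>!f. f \<in> mor C A Z) \<and> (\<exists>!f. f \<in> mor C Z A))"

definition is_kernel :: "'m \<Rightarrow> 'm \<Rightarrow> bool" where
  "is_kernel k f \<longleftrightarrow> f \<in> mor C (src C f) (tgt C f) \<and> k \<in> mor C (src C k) (src C f) \<and>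
    f \<cdot> k = zero_mor (src C k) (tgt C f) \<and>
    (\<forall>Z. \<forall>g\<in>mor C Z (src C f). f \<cdot> g = zero_mor Z (tgt C f) \<longrightarrow>
      (\<exists>!h. h \<in> mor C Z (src C k) \<and> k \<cdot> h = g))"

definition is_cokernel :: "'m \<Rightarrow> 'm \<Rightarrow> bool" where
  "is_cokernel q f \<longleftrightarrow> f \<in> mor C (src C f) (tgt C f) \<and> q \<in> mor C (tgt C f) (tgt C q) \<and>
    q \<cdot> f = zero_mor (src C f) (tgt C q) \<and>
    (\<forall>Z. \<forall>g\<in>mor C (tgt C f) Z. g \<cdot> f = zero_mor (src C f) Z \<longrightarrow>
      (\<exists>!h. h \<in> mor C (tgt C q) Z \<and> h \<cdot> q = g))"

text \<open>
  \<open>direct_sum P n A i p\<close>: the \<open>i k : A k \<rightarrow> P\<close> and \<open>p k : P \<rightarrow> A k\<close>, \<open>k < n\<close>, exhibit \<open>P\<close> as the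
  biproduct of \<open>A 0, \<dots>, A (n - 1)\<close>.
\<close>

definition direct_sum ::
  "'o \<Rightarrow> nat \<Rightarrow> (nat \<Rightarrow> 'o) \<Rightarrow> (nat \<Rightarrow> 'm) \<Rightarrow> (nat \<Rightarrow> 'm) \<Rightarrow> bool" where
  "direct_sum P n A i p \<longleftrightarrow> P \<in> Ob C \<and>
    (\<forall>k<n. i k \<in> mor C (A k) P \<and> p k \<in> mor C P (A k)) \<and>
    (\<forall>k<n. \<forall>l<n. p k \<cdot> i l = (if k = l then idm (A k) else zero_mor (A l) (A k))) \<and>
    (\<Oplus>\<^bsub>Hom C P P\<^esub>k\<in>{..<n}. i k \<cdot> p k) = idm P"

definition simple :: "'o \<Rightarrow> bool" where
  "simple S \<longleftrightarrow> S \<in> Ob C \<and> \<not> is_zero_ob S \<and>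
    (\<forall>f. is_mono f \<and> tgt C f = S \<longrightarrow> is_zero_ob (src C f) \<or> is_iso f)"

text \<open>Only finite direct sums are available in an abelian category.\<close>

definition semisimple :: "'o \<Rightarrow> bool" where
  "semisimple P \<longleftrightarrow> (\<exists>n S i p. direct_sum P n S i p \<and> (\<forall>k<n. simple (S k)))"

text \<open>There is a composition series \<open>0 = Y 0 \<subseteq> Y 1 \<subseteq> \<dots> \<subseteq> Y n = P\<close> with simple quotients.\<close>

definition finite_length :: "'o \<Rightarrow> bool" where
  "finite_length P \<longleftrightarrow> (\<exists>n Y f. is_zero_ob (Y 0) \<and> Y n = P \<and>
    (\<forall>k<n. f k \<in> mor C (Y k) (Y (Suc k)) \<and> is_mono (f k) \<and>
      (\<exists>q. is_cokernel q (f k) \<and> simple (tgt C q))))"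

definition simple_representatives :: "'o set \<Rightarrow> bool" where
  "simple_representatives R \<longleftrightarrow> (\<forall>S\<in>R. simple S) \<and>
    (\<forall>T. simple T \<longrightarrow> (\<exists>!S. S \<in> R \<and> isomorphic S T))"

text \<open>\<open>coords P S U f c\<close>: \<open>f = (\<Sum>u\<in>U. c u \<cdot> u)\<close> in \<open>Hom P S\<close>, with \<open>c\<close> of finite support.\<close>

definition coords :: "'o \<Rightarrow> 'o \<Rightarrow> 'm set \<Rightarrow> 'm \<Rightarrow> ('m \<Rightarrow> complex) \<Rightarrow> bool" where
  "coords P S U f c \<longleftrightarrow> finite {u. c u \<noteq> 0} \<and> {u. c u \<noteq> 0} \<subseteq> U \<and>
    f = (\<Oplus>\<^bsub>Hom C P S\<^esub>u\<in>{u. c u \<noteq> 0}. c u \<odot>\<^bsub>Hom C P S\<^esub> u)"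

definition hom_basis :: "'o \<Rightarrow> 'o \<Rightarrow> 'm set \<Rightarrow> bool" where
  "hom_basis P S U \<longleftrightarrow> U \<subseteq> mor C P S \<and> (\<forall>f\<in>mor C P S. \<exists>!c. coords P S U f c)"

definition basis_of_object :: "'o \<Rightarrow> 'o set \<Rightarrow> ('o \<Rightarrow> 'm set) \<Rightarrow> bool" where
  "basis_of_object P R \<B> \<longleftrightarrow> simple_representatives R \<and> (\<forall>S\<in>R. hom_basis P S (\<B> S))"

definition basis_coeff :: "'o \<Rightarrow> 'o \<Rightarrow> 'm set \<Rightarrow> 'm \<Rightarrow> 'm \<Rightarrow> complex" where
  "basis_coeff P S U f = (THE c. coords P S U f c)"

text \<open>
  The Hermitian form, linear in the first and conjugate-linear in the second argument, for which
  the basis \<open>U\<close> of \<open>Hom P S\<close> is orthonormal.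
\<close>

definition basis_form :: "'o \<Rightarrow> 'o \<Rightarrow> 'm set \<Rightarrow> 'm \<Rightarrow> 'm \<Rightarrow> complex" where
  "basis_form P S U f g = (\<Sum>u\<in>U. basis_coeff P S U f u * cnj (basis_coeff P S U g u))"

text \<open>A subobject of \<open>P\<close> is represented by a monomorphism with target \<open>P\<close>.\<close>

definition subobject :: "'o \<Rightarrow> 'm \<Rightarrow> bool" where
  "subobject P i \<longleftrightarrow> is_mono i \<and> tgt C i = P"

definition sub_le :: "'m \<Rightarrow> 'm \<Rightarrow> bool" where
  "sub_le i j \<longleftrightarrow> (\<exists>u\<in>mor C (src C i) (src C j). j \<cdot> u = i)"

definition is_pullback :: "'m \<Rightarrow> 'm \<Rightarrow> 'm \<Rightarrow> 'm \<Rightarrow> bool" where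
  "is_pullback u v i j \<longleftrightarrow>
    u \<in> mor C (src C u) (src C i) \<and> v \<in> mor C (src C u) (src C j) \<and> i \<cdot> u = j \<cdot> v \<and>
    (\<forall>Z. \<forall>g\<in>mor C Z (src C i). \<forall>h\<in>mor C Z (src C j). i \<cdot> g = j \<cdot> h \<longrightarrow>
      (\<exists>!w. w \<in> mor C Z (src C u) \<and> u \<cdot> w = g \<and> v \<cdot> w = h))"

definition sub_intersection :: "'m \<Rightarrow> 'm \<Rightarrow> 'm \<Rightarrow> bool" where
  "sub_intersection k i j \<longleftrightarrow> (\<exists>u v. is_pullback u v i j \<and> k = i \<cdot> u)"

definition sub_join :: "'o \<Rightarrow> 'm \<Rightarrow> 'm \<Rightarrow> 'm \<Rightarrow> bool" where
  "sub_join P k i j \<longleftrightarrow> subobject P k \<and> sub_le i k \<and> sub_le j k \<and>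
    (\<forall>l. subobject P l \<and> sub_le i l \<and> sub_le j l \<longrightarrow> sub_le k l)"

definition splits :: "'o \<Rightarrow> 'm \<Rightarrow> 'm \<Rightarrow> 'm \<Rightarrow> bool" where
  "splits P b i p \<longleftrightarrow> i \<in> mor C (src C i) P \<and> p \<in> mor C P (src C i) \<and>
    p \<cdot> i = idm (src C i) \<and> i \<cdot> p = b"

end

locale abelian_category = linear_category C for C :: "('o, 'm) moncat" (structure) +
  assumes ex_zero_ob: "\<exists>Z. is_zero_ob Z"
    and ex_biproduct: "\<lbrakk>A \<in> Ob C; B \<in> Ob C\<rbrakk> \<Longrightarrow>
      \<exists>P i p. direct_sum P 2 (\<lambda>k. if k = 0 then A else B) i p"
    and ex_kernel: "f \<in> mor C A B \<Longrightarrow> \<exists>k. is_kernel k f"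
    and ex_cokernel: "f \<in> mor C A B \<Longrightarrow> \<exists>q. is_cokernel q f"
    and mono_normal: "is_mono f \<Longrightarrow> \<exists>g. is_kernel f g"
    and epi_normal: "is_epi f \<Longrightarrow> \<exists>g. is_cokernel f g"


section \<open>Strict monoidal categories and duals\<close>

record ('o, 'm) dual_datum =
  dual_ob :: "'o"
  ev :: "'m"
  coev :: "'m"

locale linear_monoidal_category = linear_category C for C :: "('o, 'm) moncat" (structure) +
  assumes unit_closed: "\<^bold>1 \<in> Ob C"
    and tensor_ob_closed: "\<lbrakk>A \<in> Ob C; B \<in> Ob C\<rbrakk> \<Longrightarrow> A \<otimes>\<^sub>o B \<in> Ob C"
    and tensor_mor_closed: "\<lbrakk>f \<in> mor C A B; f' \<in> mor C A' B'\<rbrakk>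
      \<Longrightarrow> f \<otimes>\<^sub>m f' \<in> mor C (A \<otimes>\<^sub>o A') (B \<otimes>\<^sub>o B')"
    and tensor_id: "\<lbrakk>A \<in> Ob C; B \<in> Ob C\<rbrakk> \<Longrightarrow> idm A \<otimes>\<^sub>m idm B = idm (A \<otimes>\<^sub>o B)"
    and tensor_comp:
      "\<lbrakk>f \<in> mor C A B; g \<in> mor C B D; f' \<in> mor C A' B'; g' \<in> mor C B' D'\<rbrakk>
        \<Longrightarrow> (g \<cdot> f) \<otimes>\<^sub>m (g' \<cdot> f') = (g \<otimes>\<^sub>m g') \<cdot> (f \<otimes>\<^sub>m f')"
    and tensor_ob_assoc: "\<lbrakk>A \<in> Ob C; B \<in> Ob C; D \<in> Ob C\<rbrakk>
      \<Longrightarrow> (A \<otimes>\<^sub>o B) \<otimes>\<^sub>o D = A \<otimes>\<^sub>o (B \<otimes>\<^sub>o D)"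
    and tensor_mor_assoc: "\<lbrakk>f \<in> mor C A A'; g \<in> mor C B B'; h \<in> mor C D D'\<rbrakk>
      \<Longrightarrow> (f \<otimes>\<^sub>m g) \<otimes>\<^sub>m h = f \<otimes>\<^sub>m (g \<otimes>\<^sub>m h)"
    and unit_ob_left: "A \<in> Ob C \<Longrightarrow> \<^bold>1 \<otimes>\<^sub>o A = A"
    and unit_ob_right: "A \<in> Ob C \<Longrightarrow> A \<otimes>\<^sub>o \<^bold>1 = A"
    and unit_mor_left: "f \<in> mor C A B \<Longrightarrow> idm \<^bold>1 \<otimes>\<^sub>m f = f"
    and unit_mor_right: "f \<in> mor C A B \<Longrightarrow> f \<otimes>\<^sub>m idm \<^bold>1 = f"
    and tensor_add_left: "\<lbrakk>f \<in> mor C A B; f' \<in> mor C A B; g \<in> mor C D E\<rbrakk>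
      \<Longrightarrow> (f \<oplus>\<^bsub>Hom C A B\<^esub> f') \<otimes>\<^sub>m g
        = (f \<otimes>\<^sub>m g) \<oplus>\<^bsub>Hom C (A \<otimes>\<^sub>o D) (B \<otimes>\<^sub>o E)\<^esub> (f' \<otimes>\<^sub>m g)"
    and tensor_add_right: "\<lbrakk>f \<in> mor C A B; g \<in> mor C D E; g' \<in> mor C D E\<rbrakk>
      \<Longrightarrow> f \<otimes>\<^sub>m (g \<oplus>\<^bsub>Hom C D E\<^esub> g')
        = (f \<otimes>\<^sub>m g) \<oplus>\<^bsub>Hom C (A \<otimes>\<^sub>o D) (B \<otimes>\<^sub>o E)\<^esub> (f \<otimes>\<^sub>m g')"
    and tensor_smult_left: "\<lbrakk>f \<in> mor C A B; g \<in> mor C D E\<rbrakk>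
      \<Longrightarrow> (z \<odot>\<^bsub>Hom C A B\<^esub> f) \<otimes>\<^sub>m g = z \<odot>\<^bsub>Hom C (A \<otimes>\<^sub>o D) (B \<otimes>\<^sub>o E)\<^esub> (f \<otimes>\<^sub>m g)"
    and tensor_smult_right: "\<lbrakk>f \<in> mor C A B; g \<in> mor C D E\<rbrakk>
      \<Longrightarrow> f \<otimes>\<^sub>m (z \<odot>\<^bsub>Hom C D E\<^esub> g) = z \<odot>\<^bsub>Hom C (A \<otimes>\<^sub>o D) (B \<otimes>\<^sub>o E)\<^esub> (f \<otimes>\<^sub>m g)"
begin

definition left_dual :: "'o \<Rightarrow> ('o, 'm) dual_datum \<Rightarrow> bool" where
  "left_dual P D \<longleftrightarrow> P \<in> Ob C \<and> dual_ob D \<in> Ob C \<and>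
    ev D \<in> mor C (dual_ob D \<otimes>\<^sub>o P) \<^bold>1 \<and> coev D \<in> mor C \<^bold>1 (P \<otimes>\<^sub>o dual_ob D) \<and>
    (idm P \<otimes>\<^sub>m ev D) \<cdot> (coev D \<otimes>\<^sub>m idm P) = idm P \<and>
    (ev D \<otimes>\<^sub>m idm (dual_ob D)) \<cdot> (idm (dual_ob D) \<otimes>\<^sub>m coev D) = idm (dual_ob D)"

text \<open>
  The dual \<open>Y\<^sup>* \<rightarrow> X\<^sup>*\<close> of \<open>f : X \<rightarrow> Y\<close> with respect to left duals \<open>DX\<close> of \<open>X\<close> and \<open>DY\<close> of \<open>Y\<close>.
\<close>

definition dual_mor ::
  "('o, 'm) dual_datum \<Rightarrow> ('o, 'm) dual_datum \<Rightarrow> 'm \<Rightarrow> 'm" where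
  "dual_mor DX DY f =
    (ev DY \<otimes>\<^sub>m idm (dual_ob DX)) \<cdot>
    (idm (dual_ob DY) \<otimes>\<^sub>m f \<otimes>\<^sub>m idm (dual_ob DX)) \<cdot>
    (idm (dual_ob DY) \<otimes>\<^sub>m coev DX)"

end

locale rigid_abelian_monoidal_category =
  abelian_category C + linear_monoidal_category C for C :: "('o, 'm) moncat" (structure) +
  assumes ex_left_dual: "P \<in> Ob C \<Longrightarrow> \<exists>D. left_dual P D"
    and ex_right_dual: "P \<in> Ob C \<Longrightarrow> \<exists>Q D. left_dual Q D \<and> dual_ob D = P"


section \<open>Frobenius algebras and Frobenius subalgebras\<close>

record ('o, 'm) frob_alg =
  alg_ob :: "'o"
  alg_mult :: "'m"
  alg_comult :: "'m"
  alg_unit :: "'m"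
  alg_counit :: "'m"

record ('o, 'm) frob_subalg = "('o, 'm) frob_alg" +
  incl :: "'m"

context linear_monoidal_category
begin

definition unital_algebra :: "'o \<Rightarrow> 'm \<Rightarrow> 'm \<Rightarrow> bool" where
  "unital_algebra A m e \<longleftrightarrow> m \<in> mor C (A \<otimes>\<^sub>o A) A \<and> e \<in> mor C \<^bold>1 A \<and>
    m \<cdot> (m \<otimes>\<^sub>m idm A) = m \<cdot> (idm A \<otimes>\<^sub>m m) \<and>
    m \<cdot> (e \<otimes>\<^sub>m idm A) = idm A \<and> m \<cdot> (idm A \<otimes>\<^sub>m e) = idm A"

definition counital_coalgebra :: "'o \<Rightarrow> 'm \<Rightarrow> 'm \<Rightarrow> bool" where
  "counital_coalgebra A d \<epsilon> \<longleftrightarrow> d \<in> mor C A (A \<otimes>\<^sub>o A) \<and> \<epsilon> \<in> mor C A \<^bold>1 \<and>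
    (d \<otimes>\<^sub>m idm A) \<cdot> d = (idm A \<otimes>\<^sub>m d) \<cdot> d \<and>
    (\<epsilon> \<otimes>\<^sub>m idm A) \<cdot> d = idm A \<and> (idm A \<otimes>\<^sub>m \<epsilon>) \<cdot> d = idm A"

definition frobenius_algebra :: "('o, 'm, 'z) frob_alg_scheme \<Rightarrow> bool" where
  "frobenius_algebra X \<longleftrightarrow> alg_ob X \<in> Ob C \<and>
    unital_algebra (alg_ob X) (alg_mult X) (alg_unit X) \<and>
    counital_coalgebra (alg_ob X) (alg_comult X) (alg_counit X) \<and>
    (idm (alg_ob X) \<otimes>\<^sub>m alg_mult X) \<cdot> (alg_comult X \<otimes>\<^sub>m idm (alg_ob X))
      = alg_comult X \<cdot> alg_mult X \<and>
    (alg_mult X \<otimes>\<^sub>m idm (alg_ob X)) \<cdot> (idm (alg_ob X) \<otimes>\<^sub>m alg_comult X)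
      = alg_comult X \<cdot> alg_mult X"

definition frob_dual :: "('o, 'm, 'z) frob_alg_scheme \<Rightarrow> ('o, 'm) dual_datum" where
  "frob_dual X = \<lparr>dual_ob = alg_ob X, ev = alg_counit X \<cdot> alg_mult X,
    coev = alg_comult X \<cdot> alg_unit X\<rparr>"

definition incl_dual :: "('o, 'm) frob_alg \<Rightarrow> ('o, 'm) frob_subalg \<Rightarrow> 'm" where
  "incl_dual X A = dual_mor (frob_dual A) (frob_dual X) (incl A)"

definition incl_bidual :: "('o, 'm) frob_alg \<Rightarrow> ('o, 'm) frob_subalg \<Rightarrow> 'm" where
  "incl_bidual X A = dual_mor (frob_dual X) (frob_dual A) (incl_dual X A)"

definition frobenius_subalgebra :: "('o, 'm) frob_alg \<Rightarrow> ('o, 'm) frob_subalg \<Rightarrow> bool" where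
  "frobenius_subalgebra X A \<longleftrightarrow> frobenius_algebra A \<and>
    incl A \<in> mor C (alg_ob A) (alg_ob X) \<and> is_mono (incl A) \<and>
    incl A \<cdot> alg_mult A = alg_mult X \<cdot> (incl A \<otimes>\<^sub>m incl A) \<and>
    incl A \<cdot> alg_unit A = alg_unit X \<and>
    incl_bidual X A = incl A \<and> incl_dual X A \<cdot> incl A = idm (alg_ob A)"

definition subalg_idem :: "('o, 'm) frob_alg \<Rightarrow> ('o, 'm) frob_subalg \<Rightarrow> 'm" where
  "subalg_idem X A = incl A \<cdot> incl_dual X A"

definition subalg_equiv ::
  "('o, 'm) frob_alg \<Rightarrow> (('o, 'm) frob_subalg \<times> ('o, 'm) frob_subalg) set" where
  "subalg_equiv X = {(A, B). frobenius_subalgebra X A \<and> frobenius_subalgebra X B \<and>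
    subalg_idem X A = subalg_idem X B}"

definition subalg_class ::
  "('o, 'm) frob_alg \<Rightarrow> ('o, 'm) frob_subalg \<Rightarrow> ('o, 'm) frob_subalg set" where
  "subalg_class X A = subalg_equiv X `` {A}"

definition subalg_le ::
  "('o, 'm) frob_alg \<Rightarrow> ('o, 'm) frob_subalg set \<Rightarrow> ('o, 'm) frob_subalg set \<Rightarrow> bool" where
  "subalg_le X c d \<longleftrightarrow> (\<exists>A\<in>c. \<exists>B\<in>d.
    subalg_idem X A \<cdot> subalg_idem X B = subalg_idem X A \<and>
    subalg_idem X B \<cdot> subalg_idem X A = subalg_idem X A)"

definition subalg_poset :: "('o, 'm) frob_alg \<Rightarrow> ('o, 'm) frob_subalg set gorder" where
  "subalg_poset X = \<lparr>carrier = {A. frobenius_subalgebra X A} // subalg_equiv X,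
    eq = (=), le = subalg_le X\<rparr>"


section \<open>Rigidity invariance\<close>

text \<open>
  In the next three definitions \<open>DP\<close> and \<open>DS\<close> are left duals of the object \<open>P\<close> and of the simple
  object \<open>S\<close>; \<open>\<kappa>'\<close> is well defined when \<open>End(S) = \<complex>\<close>, since then \<open>Hom(1, S \<otimes> S\<^sup>*) = \<complex> coev\<^sub>S\<close>.
\<close>

definition rig_kappa ::
  "('o, 'm) dual_datum \<Rightarrow> 'o \<Rightarrow> ('o, 'm) dual_datum \<Rightarrow> 'm \<Rightarrow> 'm \<Rightarrow> complex" where
  "rig_kappa DP S DS f g =
    (THE z. (f \<otimes>\<^sub>m g) \<cdot> coev DP = z \<odot>\<^bsub>Hom C \<^bold>1 (S \<otimes>\<^sub>o dual_ob DS)\<^esub> coev DS)"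

definition rig_map ::
  "'o \<Rightarrow> ('o, 'm) dual_datum \<Rightarrow> 'o \<Rightarrow> ('o, 'm) dual_datum \<Rightarrow> 'm set \<Rightarrow> 'm \<Rightarrow> 'm" where
  "rig_map P DP S DS U g =
    (THE h. h \<in> mor C P S \<and> (\<forall>f\<in>mor C P S. basis_form P S U f h = rig_kappa DP S DS f g))"

text \<open>
  \<open>DA\<close> is a left dual of the split subobject \<open>(A, i, p)\<close>, \<open>A = src i\<close>. The condition does not
  depend on the left dual of \<open>S\<close>, as any two are related by a canonical isomorphism.
\<close>

definition rigid_invariant ::
  "'o \<Rightarrow> ('o, 'm) dual_datum \<Rightarrow> 'o set \<Rightarrow> ('o \<Rightarrow> 'm set) \<Rightarrow> ('o, 'm) dual_datum \<Rightarrow> 'm \<Rightarrow> 'm \<Rightarrow> bool"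
  where
  "rigid_invariant P DP R \<B> DA i p \<longleftrightarrow> (\<forall>S\<in>R. \<forall>DS. left_dual S DS \<longrightarrow>
    rig_map P DP S DS (\<B> S) ` {g \<cdot> dual_mor DA DP i | g. g \<in> mor C (dual_ob DA) (dual_ob DS)}
      = {f \<cdot> p | f. f \<in> mor C (src C i) S})"

definition frobenius_basis_subalgebra ::
  "('o, 'm) frob_alg \<Rightarrow> 'o set \<Rightarrow> ('o \<Rightarrow> 'm set) \<Rightarrow> ('o, 'm) frob_subalg \<Rightarrow> bool" where
  "frobenius_basis_subalgebra X R \<B> A \<longleftrightarrow> frobenius_subalgebra X A \<and>
    rigid_invariant (alg_ob X) (frob_dual X) R \<B> (frob_dual A) (incl A) (incl_dual X A)"

definition basis_subalg_classes ::
  "('o, 'm) frob_alg \<Rightarrow> 'o set \<Rightarrow> ('o \<Rightarrow> 'm set) \<Rightarrow> ('o, 'm) frob_subalg set set" where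
  "basis_subalg_classes X R \<B> = subalg_class X ` {A. frobenius_basis_subalgebra X R \<B> A}"


section \<open>Ambient selfduality and coherence\<close>

text \<open>
  \<open>D\<close> is a selfduality of \<open>P\<close>, i.e. \<open>left_dual P D\<close> with \<open>dual_ob D = P\<close>.
  \<open>E\<close> is the ambient dual of the split subobject \<open>(src i, i, p)\<close> of \<open>P\<close> obtained from a splitting
  \<open>(src i', i', p')\<close> of the dual \<open>b\<^sup>*\<close> of \<open>b = i \<cdot> p\<close>.
\<close>

definition ambient_dual ::
  "'o \<Rightarrow> ('o, 'm) dual_datum \<Rightarrow> 'm \<Rightarrow> 'm \<Rightarrow> 'm \<Rightarrow> 'm \<Rightarrow> ('o, 'm) dual_datum \<Rightarrow> bool" where
  "ambient_dual P D i p i' p' E \<longleftrightarrow> splits P (i \<cdot> p) i p \<and>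
    splits P (dual_mor D D (i \<cdot> p)) i' p' \<and>
    E = \<lparr>dual_ob = src C i', ev = ev D \<cdot> (i' \<otimes>\<^sub>m i), coev = (p \<otimes>\<^sub>m p') \<cdot> coev D\<rparr>"

text \<open>
  For a subobject \<open>i\<close>, the retraction \<open>p\<close> is unique if it exists: two idempotents of \<open>P\<close> with the
  same image that are fixed by \<open>b \<mapsto> b\<^sup>*\<close> are equal.
\<close>

definition ambiently_selfdual :: "'o \<Rightarrow> ('o, 'm) dual_datum \<Rightarrow> 'm \<Rightarrow> bool" where
  "ambiently_selfdual P D i \<longleftrightarrow> (\<exists>p E. ambient_dual P D i p i p E)"

definition coherent_pair :: "'o \<Rightarrow> ('o, 'm) dual_datum \<Rightarrow> 'm \<Rightarrow> 'm \<Rightarrow> bool" where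
  "coherent_pair P D i j \<longleftrightarrow> subobject P i \<and> subobject P j \<and>
    ambiently_selfdual P D i \<and> ambiently_selfdual P D j \<and>
    (\<exists>k. sub_intersection k i j \<and> ambiently_selfdual P D k) \<and>
    (\<exists>k. sub_join P k i j \<and> ambiently_selfdual P D k)"

text \<open>The meet is the one of the lattice \<open>L\<close> in the order induced from the poset.\<close>

definition coherent_sublattice ::
  "('o, 'm) frob_alg \<Rightarrow> ('o, 'm) frob_subalg set set \<Rightarrow> bool" where
  "coherent_sublattice X L \<longleftrightarrow> L \<subseteq> carrier (subalg_poset X) \<and>
    lattice (subalg_poset X\<lparr>carrier := L\<rparr>) \<and>
    (\<exists>c. least (subalg_poset X\<lparr>carrier := L\<rparr>) c L) \<and>
    (\<forall>A B. frobenius_subalgebra X A \<and> frobenius_subalgebra X B \<and>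
        subalg_class X A \<in> L \<and> subalg_class X B \<in> L \<longrightarrow>
      coherent_pair (alg_ob X) (frob_dual X) (incl A) (incl B) \<and>
      (\<exists>D. frobenius_subalgebra X D \<and> sub_intersection (incl D) (incl A) (incl B) \<and>
        subalg_class X A \<sqinter>\<^bsub>subalg_poset X\<lparr>carrier := L\<rparr>\<^esub> subalg_class X B = subalg_class X D))"

end

end

theory Submission
  imports Defs
begin

text \<open>
  Equip \<open>Hom(X,S)\<close>, for simple \<open>S\<close>, with its Hermitian form, and let \<open>a = i \<circ> i\<^sup>*\<close> be the idempotent of
  a Frobenius subalgebra; then \<open>a\<^sup>* = a\<close>. The pairing \<open>\<kappa>'\<close> satisfies
  \<open>\<kappa>'(f \<circ> a, g) = \<kappa>'(f, g \<circ> a)\<close>, and from this rigid invariance of the subalgebra turns out to be the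
  condition that \<open>f \<mapsto> f \<circ> a\<close> is a self-adjoint operator on every \<open>Hom(X,S)\<close>
  (\<open>rigid_invariant_iff_self_adjoint\<close>). Conversely every idempotent with \<open>a\<^sup>* = a\<close> whose image contains
  the unit and is closed under multiplication comes from a Frobenius subalgebra
  (\<open>ex_frobenius_subalgebra\<close>). So the classes in question are certain orthogonal projections, and
  the order is the order of projections.

  Let \<open>a\<close> and \<open>b\<close> be two of them. The operator \<open>N = (1 - a) + (1 - b)\<close> is positive, so \<open>N\<close> kills exactly
  what is fixed by both \<open>a\<close> and \<open>b\<close>, and it is invertible on its image. As \<open>End(X)\<close> is
  finite-dimensional, the inverse is a polynomial in \<open>N\<close> (\<open>poly_group_inverse\<close>), and hence so is the
  projection \<open>c\<close> onto the kernel (\<open>ex_intersection_projection\<close>). Polynomials in \<open>N\<close> inherit \<open>N\<^sup>* = N\<close>;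
  therefore \<open>c\<^sup>* = c\<close>. The image of \<open>c\<close> is the intersection of the images of \<open>a\<close> and \<open>b\<close>, it is again a
  unital subalgebra, and \<open>c\<close> is the meet of \<open>a\<close> and \<open>b\<close>. Applied to \<open>1 - a\<close> and \<open>1 - b\<close> the same
  construction gives a projection whose complement projects onto the sum of the two images. This
  settles ambient selfduality of all four objects.

  In the lattice, the join of \<open>a\<close> and \<open>b\<close> is the intersection of all upper bounds, which include
  \<open>1\<close>, and the bottom element is the intersection of all members. Both intersections are
  attained by finitely many members because decreasing sequences of idempotents in \<open>End(X)\<close> become
  constant (\<open>decreasing_idempotents_stabilize\<close>).
\<close>

section \<open>Linear dependence\<close>

text \<open>
  Gaussian elimination: a vector with nonzero last coordinate is used to clear that coordinate in
  all others, which leaves fewer coordinates and one vector less.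
\<close>

lemma ex_linear_dependence:
  fixes v :: "'j \<Rightarrow> nat \<Rightarrow> complex"
  assumes "finite J" and "d < card J"
  shows "\<exists>c. (\<exists>j\<in>J. c j \<noteq> 0) \<and> (\<forall>i<d. (\<Sum>j\<in>J. c j * v j i) = 0)"
  using assms
proof (induction d arbitrary: J v)
  case 0
  then obtain j where "j \<in> J" by fastforce
  then show ?case by (intro exI[of _ "\<lambda>_. 1"]) auto
next
  case (Suc d)
  show ?case
  proof (cases "\<exists>m\<in>J. v m d \<noteq> 0")
    case False
    then have "(\<Sum>j\<in>J. c j * v j d) = 0" for c
      by (intro sum.neutral) auto
    moreover obtain c where "\<exists>j\<in>J. c j \<noteq> 0" "\<forall>i<d. (\<Sum>j\<in>J. c j * v j i) = 0"
      using Suc.IH[of J v] Suc.prems by auto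
    ultimately show ?thesis
      by (intro exI[of _ c]) (simp add: less_Suc_eq)
  next
    case True
    then obtain m where m: "m \<in> J" "v m d \<noteq> 0" by blast
    define w where "w j i = v j i - v j d / v m d * v m i" for j i
    have "finite (J - {m})" "d < card (J - {m})"
      using Suc.prems m by (auto simp: card_Diff_singleton)
    from Suc.IH[OF this, of w] obtain c where
      c: "\<exists>j\<in>J - {m}. c j \<noteq> 0" "\<And>i. i < d \<Longrightarrow> (\<Sum>j\<in>J - {m}. c j * w j i) = 0"
      by blast
    define c' where "c' = c(m := - (\<Sum>j\<in>J - {m}. c j * (v j d / v m d)))"
    have eq: "(\<Sum>j\<in>J. c' j * v j i) = (\<Sum>j\<in>J - {m}. c j * w j i)" for i
    proof -
      have "(\<Sum>j\<in>J. c' j * v j i) = c' m * v m i + (\<Sum>j\<in>J - {m}. c' j * v j i)"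
        using Suc.prems(1) m(1) by (rule sum.remove)
      also have "(\<Sum>j\<in>J - {m}. c' j * v j i) = (\<Sum>j\<in>J - {m}. c j * v j i)"
        by (rule sum.cong) (auto simp: c'_def)
      also have "c' m * v m i + \<dots> = (\<Sum>j\<in>J - {m}. c j * w j i)"
        by (simp add: c'_def w_def right_diff_distrib sum_subtractf sum_distrib_right mult.assoc)
      finally show ?thesis .
    qed
    have "w j d = 0" for j
      using m by (simp add: w_def)
    then have "(\<Sum>j\<in>J. c' j * v j i) = 0" if "i < Suc d" for i
      using that c(2) by (auto simp: eq less_Suc_eq)
    moreover have "\<exists>j\<in>J. c' j \<noteq> 0"
      using c(1) by (auto simp: c'_def)
    ultimately show ?thesis by blast
  qed
qed

section \<open>Linear categories\<close>

lemma complex_ring_simps [simp]: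
  "carrier complex_ring = UNIV" "mult complex_ring = (*)" "one complex_ring = 1"
  "zero complex_ring = 0" "add complex_ring = (+)"
  by (simp_all add: complex_ring_def)

context linear_category
begin

lemma mor_obD: "f \<in> mor C A B \<Longrightarrow> A \<in> Ob C" "f \<in> mor C A B \<Longrightarrow> B \<in> Ob C"
  by (auto simp: mor_def)

lemma carrier_Hom: "\<lbrakk>A \<in> Ob C; B \<in> Ob C\<rbrakk> \<Longrightarrow> carrier (Hom C A B) = mor C A B"
  by (auto simp: mor_def)

lemma Hom_abelian_group: "\<lbrakk>A \<in> Ob C; B \<in> Ob C\<rbrakk> \<Longrightarrow> abelian_group (Hom C A B)"
  using Hom_module module.axioms(2) by blast

lemma zero_mor_closed: "\<lbrakk>A \<in> Ob C; B \<in> Ob C\<rbrakk> \<Longrightarrow> zero_mor A B \<in> mor C A B"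
  using Hom_abelian_group carrier_Hom abelian_monoid.zero_closed abelian_group.axioms(1) by metis

lemma add_mor_closed:
  "\<lbrakk>f \<in> mor C A B; g \<in> mor C A B\<rbrakk> \<Longrightarrow> f \<oplus>\<^bsub>Hom C A B\<^esub> g \<in> mor C A B"
  by (metis Hom_abelian_group carrier_Hom abelian_group.axioms(1) abelian_monoid.a_closed mor_obD)

lemma smult_mor_closed: "f \<in> mor C A B \<Longrightarrow> z \<odot>\<^bsub>Hom C A B\<^esub> f \<in> mor C A B"
  using module.smult_closed[OF Hom_module, of A B z f] by (auto simp: mor_def)

lemma diff_mor_closed:
  "\<lbrakk>f \<in> mor C A B; g \<in> mor C A B\<rbrakk> \<Longrightarrow> f \<ominus>\<^bsub>Hom C A B\<^esub> g \<in> mor C A B"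
  by (metis Hom_abelian_group carrier_Hom abelian_group.minus_closed mor_obD)

lemma smult_mor:
  assumes "f \<in> mor C A B"
  shows smult_one: "1 \<odot>\<^bsub>Hom C A B\<^esub> f = f"
    and smult_zero: "0 \<odot>\<^bsub>Hom C A B\<^esub> f = zero_mor A B"
    and smult_assoc: "x \<odot>\<^bsub>Hom C A B\<^esub> (y \<odot>\<^bsub>Hom C A B\<^esub> f) = (x * y) \<odot>\<^bsub>Hom C A B\<^esub> f"
    and smult_add: "(x + y) \<odot>\<^bsub>Hom C A B\<^esub> f
      = (x \<odot>\<^bsub>Hom C A B\<^esub> f) \<oplus>\<^bsub>Hom C A B\<^esub> (y \<odot>\<^bsub>Hom C A B\<^esub> f)"
proof -
  interpret module complex_ring "Hom C A B"
    using assms by (intro Hom_module mor_obD)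
  have f: "f \<in> carrier (Hom C A B)"
    using assms by (simp add: mor_def)
  show "1 \<odot>\<^bsub>Hom C A B\<^esub> f = f" "0 \<odot>\<^bsub>Hom C A B\<^esub> f = zero_mor A B"
    using smult_one[OF f] smult_l_null[OF f] by simp_all
  show "x \<odot>\<^bsub>Hom C A B\<^esub> (y \<odot>\<^bsub>Hom C A B\<^esub> f) = (x * y) \<odot>\<^bsub>Hom C A B\<^esub> f"
    using smult_assoc1[OF _ _ f, of x y] by simp
  show "(x + y) \<odot>\<^bsub>Hom C A B\<^esub> f
      = (x \<odot>\<^bsub>Hom C A B\<^esub> f) \<oplus>\<^bsub>Hom C A B\<^esub> (y \<odot>\<^bsub>Hom C A B\<^esub> f)"
    using smult_l_distr[OF _ _ f, of x y] by simp
qed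

lemma smult_0_mor: "\<lbrakk>A \<in> Ob C; B \<in> Ob C\<rbrakk> \<Longrightarrow> z \<odot>\<^bsub>Hom C A B\<^esub> zero_mor A B = zero_mor A B"
  using module.smult_r_null[OF Hom_module, of A B z] by simp

lemma smult_cancel:
  assumes "f \<in> mor C A B" and "f \<noteq> zero_mor A B" and "x \<odot>\<^bsub>Hom C A B\<^esub> f = y \<odot>\<^bsub>Hom C A B\<^esub> f"
  shows "x = y"
proof (rule ccontr)
  assume ne: "x \<noteq> y"
  interpret abelian_group "Hom C A B"
    using assms(1) by (intro Hom_abelian_group mor_obD)
  have c: "carrier (Hom C A B) = mor C A B"
    using assms(1) by (intro carrier_Hom mor_obD)
  have "(x - y) \<odot>\<^bsub>Hom C A B\<^esub> f \<oplus>\<^bsub>Hom C A B\<^esub> y \<odot>\<^bsub>Hom C A B\<^esub> f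
      = zero_mor A B \<oplus>\<^bsub>Hom C A B\<^esub> y \<odot>\<^bsub>Hom C A B\<^esub> f"
    using smult_add[OF assms(1), of "x - y" y] assms
    by (simp add: c smult_mor_closed)
  then have "(x - y) \<odot>\<^bsub>Hom C A B\<^esub> f = zero_mor A B"
    using assms(1) by (subst (asm) add.right_cancel) (auto simp: c smult_mor_closed[OF assms(1)] zero_mor_closed mor_obD[OF assms(1)])
  then have "inverse (x - y) \<odot>\<^bsub>Hom C A B\<^esub> ((x - y) \<odot>\<^bsub>Hom C A B\<^esub> f) = zero_mor A B"
    using assms(1) by (simp add: smult_0_mor mor_obD[OF assms(1)])
  then show False
    using ne assms by (simp add: smult_assoc smult_one)
qed

lemma diff_zero_mor:
  assumes "f \<in> mor C A B"
  shows "f \<ominus>\<^bsub>Hom C A B\<^esub> zero_mor A B = f"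
proof -
  interpret abelian_group "Hom C A B"
    using assms(1) by (intro Hom_abelian_group mor_obD)
  show ?thesis
    using assms by (auto simp: mor_def minus_eq)
qed

lemma eq_diffI:
  assumes "f \<in> mor C A B" "g \<in> mor C A B" "h \<in> mor C A B" and "f \<oplus>\<^bsub>Hom C A B\<^esub> g = h"
  shows "f = h \<ominus>\<^bsub>Hom C A B\<^esub> g"
proof -
  interpret abelian_group "Hom C A B"
    using assms(1) by (intro Hom_abelian_group mor_obD)
  show ?thesis
    using assms by (auto simp: mor_def minus_eq a_assoc r_neg)
qed

lemma diff_add_cancel:
  assumes "f \<in> mor C A B" "g \<in> mor C A B"
  shows "(f \<ominus>\<^bsub>Hom C A B\<^esub> g) \<oplus>\<^bsub>Hom C A B\<^esub> g = f"
proof -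
  interpret abelian_group "Hom C A B"
    using assms(1) by (intro Hom_abelian_group mor_obD)
  show ?thesis
    using assms by (auto simp: mor_def minus_eq a_assoc l_neg)
qed

lemma diff_eq_0_iff:
  assumes "f \<in> mor C A B" and "g \<in> mor C A B"
  shows "f \<ominus>\<^bsub>Hom C A B\<^esub> g = zero_mor A B \<longleftrightarrow> f = g"
proof -
  interpret abelian_group "Hom C A B"
    using assms(1) by (intro Hom_abelian_group mor_obD)
  have "g \<in> carrier (Hom C A B)"
    using assms by (simp add: mor_def)
  then show ?thesis
    using diff_add_cancel[OF assms] by (auto simp: r_neg minus_eq)
qed

lemma diff_self: "f \<in> mor C A B \<Longrightarrow> f \<ominus>\<^bsub>Hom C A B\<^esub> f = zero_mor A B"
  by (simp add: diff_eq_0_iff)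

lemma add_self_eq_zero:
  assumes "f \<in> mor C A B" and "f \<oplus>\<^bsub>Hom C A B\<^esub> f = f"
  shows "f = zero_mor A B"
  using eq_diffI[OF assms(1,1,1,2)] assms(1) by (simp add: diff_self)

lemma comp_zero_right:
  assumes "g \<in> mor C B D" and "A \<in> Ob C"
  shows "g \<cdot> zero_mor A B = zero_mor A D"
proof -
  have z: "zero_mor A B \<in> mor C A B"
    using assms mor_obD zero_mor_closed by blast
  interpret abelian_group "Hom C A B"
    using assms mor_obD by (intro Hom_abelian_group) auto
  have "zero_mor A B \<oplus>\<^bsub>Hom C A B\<^esub> zero_mor A B = zero_mor A B"
    by simp
  then show ?thesis
    using comp_add_right[OF z z assms(1)] comp_closed[OF z assms(1)] by (intro add_self_eq_zero) auto
qed

lemma comp_zero_left: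
  assumes "f \<in> mor C A B" and "D \<in> Ob C"
  shows "zero_mor B D \<cdot> f = zero_mor A D"
proof -
  have z: "zero_mor B D \<in> mor C B D"
    using assms mor_obD zero_mor_closed by blast
  interpret abelian_group "Hom C B D"
    using assms mor_obD by (intro Hom_abelian_group) auto
  have "zero_mor B D \<oplus>\<^bsub>Hom C B D\<^esub> zero_mor B D = zero_mor B D"
    by simp
  then show ?thesis
    using comp_add_left[OF assms(1) z z] comp_closed[OF assms(1) z] by (intro add_self_eq_zero) auto
qed

lemma comp_diff_right:
  assumes "f \<in> mor C A B" "f' \<in> mor C A B" "g \<in> mor C B D"
  shows "g \<cdot> (f \<ominus>\<^bsub>Hom C A B\<^esub> f') = (g \<cdot> f) \<ominus>\<^bsub>Hom C A D\<^esub> (g \<cdot> f')"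
proof (rule eq_diffI)
  show "(g \<cdot> (f \<ominus>\<^bsub>Hom C A B\<^esub> f')) \<oplus>\<^bsub>Hom C A D\<^esub> (g \<cdot> f') = g \<cdot> f"
    using assms comp_add_right[OF diff_mor_closed[OF assms(1,2)] assms(2,3)] by (simp add: diff_add_cancel)
qed (use assms comp_closed diff_mor_closed in blast)+

lemma comp_diff_left:
  assumes "f \<in> mor C A B" "g \<in> mor C B D" "g' \<in> mor C B D"
  shows "(g \<ominus>\<^bsub>Hom C B D\<^esub> g') \<cdot> f = (g \<cdot> f) \<ominus>\<^bsub>Hom C A D\<^esub> (g' \<cdot> f)"
proof (rule eq_diffI)
  show "((g \<ominus>\<^bsub>Hom C B D\<^esub> g') \<cdot> f) \<oplus>\<^bsub>Hom C A D\<^esub> (g' \<cdot> f) = g \<cdot> f"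
    using assms comp_add_left[OF assms(1) diff_mor_closed[OF assms(2,3)] assms(3)] by (simp add: diff_add_cancel)
qed (use assms comp_closed diff_mor_closed in blast)+

lemma finsum_mor_closed:
  assumes "A \<in> Ob C" "B \<in> Ob C" and "\<And>j. j \<in> J \<Longrightarrow> v j \<in> mor C A B"
  shows "(\<Oplus>\<^bsub>Hom C A B\<^esub>j\<in>J. v j) \<in> mor C A B"
proof -
  interpret abelian_group "Hom C A B"
    using assms by (intro Hom_abelian_group)
  show ?thesis
    using finsum_closed[of v J] assms by (auto simp: mor_def)
qed

lemma finsum_mor_insert:
  assumes "A \<in> Ob C" "B \<in> Ob C" "finite J" "k \<notin> J" and "v k \<in> mor C A B" "\<And>j. j \<in> J \<Longrightarrow> v j \<in> mor C A B"
  shows "(\<Oplus>\<^bsub>Hom C A B\<^esub>j\<in>insert k J. v j) = v k \<oplus>\<^bsub>Hom C A B\<^esub> (\<Oplus>\<^bsub>Hom C A B\<^esub>j\<in>J. v j)"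
proof -
  interpret abelian_group "Hom C A B"
    using assms by (intro Hom_abelian_group)
  show ?thesis
    using finsum_insert[of J k v] assms by (auto simp: mor_def)
qed

lemma finsum_mor_cong:
  assumes "A \<in> Ob C" "B \<in> Ob C" "J = K" and "\<And>j. j \<in> K \<Longrightarrow> v j = w j" "\<And>j. j \<in> K \<Longrightarrow> w j \<in> mor C A B"
  shows "(\<Oplus>\<^bsub>Hom C A B\<^esub>j\<in>J. v j) = (\<Oplus>\<^bsub>Hom C A B\<^esub>j\<in>K. w j)"
proof -
  interpret abelian_group "Hom C A B"
    using assms by (intro Hom_abelian_group)
  show ?thesis
    using assms by (intro finsum_cong') (auto simp: mor_def)
qed

lemma finsum_mor_empty:
  assumes "A \<in> Ob C" "B \<in> Ob C"
  shows "(\<Oplus>\<^bsub>Hom C A B\<^esub>j\<in>{}. v j) = zero_mor A B"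
proof -
  interpret abelian_group "Hom C A B"
    using assms by (intro Hom_abelian_group)
  show ?thesis by simp
qed

text \<open>
  Linearity of composition, of coordinates and of the forms below is carried over to finite sums by
  this lemma and its analogue for complex-valued maps.
\<close>

lemma additive_finsum:
  assumes "A \<in> Ob C" "B \<in> Ob C" "A' \<in> Ob C" "B' \<in> Ob C" and "finite J"
    and v: "\<And>j. j \<in> J \<Longrightarrow> v j \<in> mor C A B"
    and F: "\<And>f. f \<in> mor C A B \<Longrightarrow> F f \<in> mor C A' B'"
    and zero: "F (zero_mor A B) = zero_mor A' B'"
    and add: "\<And>f g. \<lbrakk>f \<in> mor C A B; g \<in> mor C A B\<rbrakk> \<Longrightarrow> F (f \<oplus>\<^bsub>Hom C A B\<^esub> g) = F f \<oplus>\<^bsub>Hom C A' B'\<^esub> F g"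
  shows "F (\<Oplus>\<^bsub>Hom C A B\<^esub>j\<in>J. v j) = (\<Oplus>\<^bsub>Hom C A' B'\<^esub>j\<in>J. F (v j))"
  using \<open>finite J\<close> v
proof (induction J)
  case empty
  then show ?case using assms by (simp add: finsum_mor_empty)
next
  case (insert k J)
  have "(\<Oplus>\<^bsub>Hom C A B\<^esub>j\<in>J. v j) \<in> mor C A B"
    using insert assms(1,2) by (intro finsum_mor_closed) auto
  moreover have "v k \<in> mor C A B" "\<And>j. j \<in> J \<Longrightarrow> v j \<in> mor C A B"
    using insert by auto
  ultimately show ?case
    using insert.IH insert.hyps assms(1-4) F add by (simp add: finsum_mor_insert)
qed

lemma additive_finsum_complex:
  assumes "A \<in> Ob C" "B \<in> Ob C" and "finite J"
    and v: "\<And>j. j \<in> J \<Longrightarrow> v j \<in> mor C A B"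
    and zero: "F (zero_mor A B) = (0::complex)"
    and add: "\<And>f g. \<lbrakk>f \<in> mor C A B; g \<in> mor C A B\<rbrakk> \<Longrightarrow> F (f \<oplus>\<^bsub>Hom C A B\<^esub> g) = F f + F g"
  shows "F (\<Oplus>\<^bsub>Hom C A B\<^esub>j\<in>J. v j) = (\<Sum>j\<in>J. F (v j))"
  using \<open>finite J\<close> v
proof (induction J)
  case empty
  then show ?case using assms by (simp add: finsum_mor_empty)
next
  case (insert k J)
  have "(\<Oplus>\<^bsub>Hom C A B\<^esub>j\<in>J. v j) \<in> mor C A B"
    using insert assms(1,2) by (intro finsum_mor_closed) auto
  moreover have "v k \<in> mor C A B" "\<And>j. j \<in> J \<Longrightarrow> v j \<in> mor C A B"
    using insert by auto
  ultimately show ?case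
    using insert.IH insert.hyps assms(1,2) add by (simp add: finsum_mor_insert)
qed

lemma comp_finsum_right:
  assumes "A \<in> Ob C" "g \<in> mor C B D" "finite J" and "\<And>j. j \<in> J \<Longrightarrow> v j \<in> mor C A B"
  shows "g \<cdot> (\<Oplus>\<^bsub>Hom C A B\<^esub>j\<in>J. v j) = (\<Oplus>\<^bsub>Hom C A D\<^esub>j\<in>J. g \<cdot> v j)"
  using assms mor_obD[OF assms(2)] comp_closed
  by (intro additive_finsum) (auto simp: comp_zero_right comp_add_right)

lemma comp_finsum_left:
  assumes "f \<in> mor C A B" "D \<in> Ob C" "finite J" and "\<And>j. j \<in> J \<Longrightarrow> v j \<in> mor C B D"
  shows "(\<Oplus>\<^bsub>Hom C B D\<^esub>j\<in>J. v j) \<cdot> f = (\<Oplus>\<^bsub>Hom C A D\<^esub>j\<in>J. v j \<cdot> f)"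
  using assms mor_obD[OF assms(1)] comp_closed
  by (intro additive_finsum[where F = "\<lambda>h. h \<cdot> f"]) (auto simp: comp_zero_left comp_add_left)

lemma finsum_mor_single:
  assumes "A \<in> Ob C" "B \<in> Ob C" "finite J" "k \<in> J" and "w \<in> mor C A B"
    and "v k = w" and "\<And>j. j \<in> J \<Longrightarrow> j \<noteq> k \<Longrightarrow> v j = zero_mor A B"
  shows "(\<Oplus>\<^bsub>Hom C A B\<^esub>j\<in>J. v j) = w"
proof -
  interpret abelian_group "Hom C A B"
    using assms by (intro Hom_abelian_group)
  have "(\<Oplus>\<^bsub>Hom C A B\<^esub>j\<in>J. v j) = (\<Oplus>\<^bsub>Hom C A B\<^esub>j\<in>J. if k = j then w else zero_mor A B)"
    using assms by (intro finsum_mor_cong) (auto simp: zero_mor_closed)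
  also have "\<dots> = w"
    using finsum_singleton[of k J "\<lambda>_. w"] assms by (auto simp: mor_def)
  finally show ?thesis .
qed

lemma finsum_mor_zero:
  assumes "A \<in> Ob C" "B \<in> Ob C" and "\<And>j. j \<in> J \<Longrightarrow> v j = zero_mor A B"
  shows "(\<Oplus>\<^bsub>Hom C A B\<^esub>j\<in>J. v j) = zero_mor A B"
proof -
  interpret abelian_group "Hom C A B"
    using assms by (intro Hom_abelian_group)
  have "(\<Oplus>\<^bsub>Hom C A B\<^esub>j\<in>J. v j) = (\<Oplus>\<^bsub>Hom C A B\<^esub>j\<in>J. zero_mor A B)"
    using assms by (intro finsum_mor_cong) (auto simp: zero_mor_closed)
  then show ?thesis
    using finsum_zero by simp
qed

section \<open>Finite-dimensional hom-spaces\<close>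

text \<open>
  Bounded size of linearly independent families is the form in which finite dimension is used.
  The families are indexed, so that repetitions count as dependencies.
\<close>

definition fin_dim :: "'o \<Rightarrow> 'o \<Rightarrow> bool" where
  "fin_dim A B \<longleftrightarrow> (\<exists>d::nat. \<forall>v. (\<forall>j\<le>d. v j \<in> mor C A B) \<longrightarrow>
    (\<exists>c. (\<exists>j\<le>d. c j \<noteq> 0) \<and> (\<Oplus>\<^bsub>Hom C A B\<^esub>j\<in>{..d}. c j \<odot>\<^bsub>Hom C A B\<^esub> v j) = zero_mor A B))"

lemma fin_dimI:
  assumes A: "A \<in> Ob C" and B: "B \<in> Ob C"
    and add: "\<And>i f g. \<lbrakk>i < (d::nat); f \<in> mor C A B; g \<in> mor C A B\<rbrakk> \<Longrightarrow> \<Phi> i (f \<oplus>\<^bsub>Hom C A B\<^esub> g) = \<Phi> i f + \<Phi> i g"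
    and smult: "\<And>i z f. \<lbrakk>i < d; f \<in> mor C A B\<rbrakk> \<Longrightarrow> \<Phi> i (z \<odot>\<^bsub>Hom C A B\<^esub> f) = z * (\<Phi> i f :: complex)"
    and sep: "\<And>f. \<lbrakk>f \<in> mor C A B; \<And>i. i < d \<Longrightarrow> \<Phi> i f = 0\<rbrakk> \<Longrightarrow> f = zero_mor A B"
  shows "fin_dim A B"
  unfolding fin_dim_def
proof (rule exI[of _ d], intro allI impI)
  fix v :: "nat \<Rightarrow> 'm"
  assume v: "\<forall>j\<le>d. v j \<in> mor C A B"
  obtain c where c: "\<exists>j\<le>d. c j \<noteq> 0" and c0: "\<And>i. i < d \<Longrightarrow> (\<Sum>j\<le>d. c j * \<Phi> i (v j)) = 0"
    using ex_linear_dependence[of "{..d}" d "\<lambda>j i. \<Phi> i (v j)"] by auto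
  have "(\<Oplus>\<^bsub>Hom C A B\<^esub>j\<in>{..d}. c j \<odot>\<^bsub>Hom C A B\<^esub> v j) = zero_mor A B"
  proof (rule sep)
    show "(\<Oplus>\<^bsub>Hom C A B\<^esub>j\<in>{..d}. c j \<odot>\<^bsub>Hom C A B\<^esub> v j) \<in> mor C A B"
      using A B v by (intro finsum_mor_closed) (auto intro: smult_mor_closed)
    fix i assume i: "i < d"
    have "\<Phi> i (zero_mor A B) = 0"
      using smult[OF i zero_mor_closed[OF A B], of 0] A B by (simp add: smult_zero zero_mor_closed)
    then have "\<Phi> i (\<Oplus>\<^bsub>Hom C A B\<^esub>j\<in>{..d}. c j \<odot>\<^bsub>Hom C A B\<^esub> v j)
        = (\<Sum>j\<le>d. \<Phi> i (c j \<odot>\<^bsub>Hom C A B\<^esub> v j))"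
      using A B v i by (intro additive_finsum_complex) (auto intro: smult_mor_closed add)
    also have "\<dots> = (\<Sum>j\<le>d. c j * \<Phi> i (v j))"
      using v i by (intro sum.cong) (auto simp: smult)
    finally show "\<Phi> i (\<Oplus>\<^bsub>Hom C A B\<^esub>j\<in>{..d}. c j \<odot>\<^bsub>Hom C A B\<^esub> v j) = 0"
      using c0 i by simp
  qed
  with c show "\<exists>c. (\<exists>j\<le>d. c j \<noteq> 0) \<and> (\<Oplus>\<^bsub>Hom C A B\<^esub>j\<in>{..d}. c j \<odot>\<^bsub>Hom C A B\<^esub> v j) = zero_mor A B"
    by blast
qed

lemma hom_dependency:
  assumes "fin_dim A B" and "\<And>k. v k \<in> mor C A B"
  obtains d c k where "(k::nat) \<le> d" "c k \<noteq> 0"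
    and "(\<Oplus>\<^bsub>Hom C A B\<^esub>k\<in>{..d}. c k \<odot>\<^bsub>Hom C A B\<^esub> v k) = zero_mor A B"
  using assms unfolding fin_dim_def by metis

end

section \<open>Computing with tensor products\<close>

context linear_category
begin

text \<open>
  The objects \<open>A\<close> and \<open>B\<close> in \<open>f \<in> mor C A B\<close> would have to be guessed by the simplifier when it types a
  composite; sources and targets it can compute.
\<close>

definition arr :: "'m \<Rightarrow> bool" where
  "arr f \<longleftrightarrow> f \<in> mor C (src C f) (tgt C f)"

lemma mor_iff: "f \<in> mor C A B \<longleftrightarrow> arr f \<and> src C f = A \<and> tgt C f = B"
  using src_mor tgt_mor arr_def by blast

lemma arr_ob: "arr f \<Longrightarrow> src C f \<in> Ob C" "arr f \<Longrightarrow> tgt C f \<in> Ob C"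
  by (auto simp: arr_def mor_def)

lemma arr_comp:
  assumes "arr f" "arr g" "src C g = tgt C f"
  shows "arr (g \<cdot> f)" "src C (g \<cdot> f) = src C f" "tgt C (g \<cdot> f) = tgt C g"
  using comp_closed[of f "src C f" "tgt C f" g "tgt C g"] assms by (auto simp: mor_iff)

lemma arr_id:
  assumes "A \<in> Ob C"
  shows "arr (idm A)" "src C (idm A) = A" "tgt C (idm A) = A"
  using id_mor_closed[OF assms] by (auto simp: mor_iff)

lemma arr_comp_id:
  "arr f \<Longrightarrow> src C f = A \<Longrightarrow> f \<cdot> idm A = f"
  "arr f \<Longrightarrow> tgt C f = A \<Longrightarrow> idm A \<cdot> f = f"
  using comp_id_left comp_id_right by (auto simp: mor_iff)

lemma arr_assoc:
  "\<lbrakk>arr f; arr g; arr h; src C g = tgt C f; src C h = tgt C g\<rbrakk> \<Longrightarrow> (h \<cdot> g) \<cdot> f = h \<cdot> (g \<cdot> f)"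
  using comp_assoc by (auto simp: mor_iff)

end

context linear_monoidal_category
begin

abbreviation whisker_l :: "'o \<Rightarrow> 'm \<Rightarrow> 'm" (infixr "\<ltimes>" 70) where
  "A \<ltimes> f \<equiv> idm A \<otimes>\<^sub>m f"

abbreviation whisker_r :: "'m \<Rightarrow> 'o \<Rightarrow> 'm" (infixl "\<rtimes>" 75) where
  "f \<rtimes> A \<equiv> f \<otimes>\<^sub>m idm A"

lemma arr_tensor:
  assumes "arr f" "arr g"
  shows "arr (f \<otimes>\<^sub>m g)" "src C (f \<otimes>\<^sub>m g) = src C f \<otimes>\<^sub>o src C g"
    "tgt C (f \<otimes>\<^sub>m g) = tgt C f \<otimes>\<^sub>o tgt C g"
  using tensor_mor_closed[of f "src C f" "tgt C f" g "src C g" "tgt C g"] assms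
  by (auto simp: mor_iff)

lemma arr_tensor_assoc: "\<lbrakk>arr f; arr g; arr h\<rbrakk> \<Longrightarrow> (f \<otimes>\<^sub>m g) \<otimes>\<^sub>m h = f \<otimes>\<^sub>m (g \<otimes>\<^sub>m h)"
  using tensor_mor_assoc by (auto simp: mor_iff)

lemma interchange:
  "\<lbrakk>arr f; arr g; arr f'; arr g'; src C g = tgt C f; src C g' = tgt C f'\<rbrakk>
    \<Longrightarrow> (g \<otimes>\<^sub>m g') \<cdot> (f \<otimes>\<^sub>m f') = (g \<cdot> f) \<otimes>\<^sub>m (g' \<cdot> f')"
  using tensor_comp by (auto simp: mor_iff)

lemma arr_unit_tensor: "arr f \<Longrightarrow> idm \<^bold>1 \<otimes>\<^sub>m f = f" "arr f \<Longrightarrow> f \<otimes>\<^sub>m idm \<^bold>1 = f"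
  using unit_mor_left unit_mor_right by (auto simp: mor_iff)

lemmas typing = arr_ob arr_comp arr_id arr_tensor unit_closed tensor_ob_closed tensor_ob_assoc
  unit_ob_left unit_ob_right arr_unit_tensor

text \<open>
  Composites of tensor products are computed as string diagrams: each is a sequence of layers in
  which one morphism acts on some of the strands, and layers acting on disjoint strands may be
  exchanged by \<open>slide\<close>.
\<close>

lemma tensor_left_right:
  assumes "arr f" "arr g" "src C f = A" "tgt C g = B"
  shows "(f \<rtimes> B) \<cdot> (A \<ltimes> g) = f \<otimes>\<^sub>m g"
  using assms by (subst interchange) (auto simp: typing arr_comp_id)

lemma tensor_right_left:
  assumes "arr f" "arr g" "tgt C f = A" "src C g = B"
  shows "(A \<ltimes> g) \<cdot> (f \<rtimes> B) = f \<otimes>\<^sub>m g"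
  using assms by (subst interchange) (auto simp: typing arr_comp_id)

lemma slide:
  assumes "arr f" "arr g" "src C f = A" "tgt C f = A'" "src C g = B" "tgt C g = B'"
  shows "(f \<rtimes> B') \<cdot> (A \<ltimes> g) = (A' \<ltimes> g) \<cdot> (f \<rtimes> B)"
  using assms by (simp add: tensor_left_right tensor_right_left)

lemma whisker_left:
  assumes "arr f" "arr g" "src C g = tgt C f" "A \<in> Ob C"
  shows "A \<ltimes> (g \<cdot> f) = (A \<ltimes> g) \<cdot> (A \<ltimes> f)"
  using assms by (subst interchange) (auto simp: typing arr_comp_id)

lemma whisker_right:
  assumes "arr f" "arr g" "src C g = tgt C f" "A \<in> Ob C"
  shows "(g \<cdot> f) \<rtimes> A = (g \<rtimes> A) \<cdot> (f \<rtimes> A)"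
  using assms by (subst interchange) (auto simp: typing arr_comp_id)

lemma id_tensor_id_tensor:
  "\<lbrakk>A \<in> Ob C; B \<in> Ob C; arr f\<rbrakk> \<Longrightarrow> A \<ltimes> (B \<ltimes> f) = (A \<otimes>\<^sub>o B) \<ltimes> f"
  by (simp add: arr_tensor_assoc[symmetric] arr_id tensor_id)

section \<open>Duality\<close>

lemma left_dual_arr:
  assumes "left_dual P D"
  shows "P \<in> Ob C" "dual_ob D \<in> Ob C" "arr (ev D)" "src C (ev D) = dual_ob D \<otimes>\<^sub>o P" "tgt C (ev D) = \<^bold>1"
    "arr (coev D)" "src C (coev D) = \<^bold>1" "tgt C (coev D) = P \<otimes>\<^sub>o dual_ob D"
  using assms by (auto simp: left_dual_def mor_iff)

lemma zigzag:
  assumes "left_dual P D"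
  shows "(P \<ltimes> ev D) \<cdot> (coev D \<rtimes> P) = idm P"
    and "(ev D \<rtimes> dual_ob D) \<cdot> (dual_ob D \<ltimes> coev D) = idm (dual_ob D)"
  using assms by (auto simp: left_dual_def)

text \<open>
  The zigzag identities allow a strand to be bent: composition with the coevaluation identifies
  morphisms \<open>P\<^sup>* \<rightarrow> Z\<close> with morphisms \<open>1 \<rightarrow> P \<otimes> Z\<close>, and morphisms \<open>P \<rightarrow> Z\<close> with morphisms
  \<open>1 \<rightarrow> Z \<otimes> P\<^sup>*\<close>. Equations between dual morphisms thereby become equations about coevaluations.
\<close>

lemma bend_dual:
  assumes D: "left_dual P D" and u: "arr u" "src C u = \<^bold>1" "tgt C u = P \<otimes>\<^sub>o Z" and Z: "Z \<in> Ob C"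
  defines "g \<equiv> (ev D \<rtimes> Z) \<cdot> (dual_ob D \<ltimes> u)"
  shows "g \<in> mor C (dual_ob D) Z" and "(P \<ltimes> g) \<cdot> coev D = u"
proof -
  note t = left_dual_arr[OF D] u Z typing
  let ?Q = "dual_ob D"
  show "g \<in> mor C ?Q Z"
    by (simp add: g_def mor_iff t)
  have slide: "((P \<otimes>\<^sub>o ?Q) \<ltimes> u) \<cdot> (coev D \<rtimes> \<^bold>1) = (coev D \<rtimes> (P \<otimes>\<^sub>o Z)) \<cdot> u"
    using slide[of "coev D" u "\<^bold>1" "P \<otimes>\<^sub>o ?Q" "\<^bold>1" "P \<otimes>\<^sub>o Z"] by (simp add: t)
  have "(P \<ltimes> g) \<cdot> coev D
      = (P \<ltimes> ev D \<rtimes> Z) \<cdot> (((P \<otimes>\<^sub>o ?Q) \<ltimes> u) \<cdot> (coev D \<rtimes> \<^bold>1))"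
    by (simp add: g_def whisker_left t id_tensor_id_tensor arr_assoc)
  also have "\<dots> = (((P \<ltimes> ev D) \<cdot> (coev D \<rtimes> P)) \<rtimes> Z) \<cdot> u"
    unfolding slide by (simp add: whisker_right t arr_tensor_assoc tensor_id arr_assoc)
  also have "\<dots> = u"
    by (simp add: zigzag[OF D] t tensor_id arr_comp_id)
  finally show "(P \<ltimes> g) \<cdot> coev D = u" .
qed

lemma unbend_dual:
  assumes D: "left_dual P D" and g: "g \<in> mor C (dual_ob D) Z"
  shows "(ev D \<rtimes> Z) \<cdot> (dual_ob D \<ltimes> ((P \<ltimes> g) \<cdot> coev D)) = g"
proof -
  have g': "arr g" "src C g = dual_ob D" "tgt C g = Z" "Z \<in> Ob C"
    using g by (auto simp: mor_iff arr_ob)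
  note t = left_dual_arr[OF D] g' typing
  let ?Q = "dual_ob D"
  have slide: "(ev D \<rtimes> Z) \<cdot> ((?Q \<otimes>\<^sub>o P) \<ltimes> g) = g \<cdot> (ev D \<rtimes> ?Q)"
    using slide[of "ev D" g "?Q \<otimes>\<^sub>o P" "\<^bold>1" ?Q Z] by (simp add: t)
  have "(ev D \<rtimes> Z) \<cdot> (?Q \<ltimes> ((P \<ltimes> g) \<cdot> coev D))
      = ((ev D \<rtimes> Z) \<cdot> ((?Q \<otimes>\<^sub>o P) \<ltimes> g)) \<cdot> (?Q \<ltimes> coev D)"
    by (simp add: whisker_left t id_tensor_id_tensor arr_assoc)
  also have "\<dots> = g"
    unfolding slide by (simp add: arr_assoc t zigzag[OF D] arr_comp_id)
  finally show ?thesis .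
qed

lemma dual_bend_cancel:
  assumes "left_dual P D" "g \<in> mor C (dual_ob D) Z" "h \<in> mor C (dual_ob D) Z"
    and "(P \<ltimes> g) \<cdot> coev D = (P \<ltimes> h) \<cdot> coev D"
  shows "g = h"
  unfolding unbend_dual[OF assms(1,2), unfolded assms(4), symmetric]
  by (rule unbend_dual[OF assms(1,3)])

lemma bend:
  assumes D: "left_dual P D" and v: "arr v" "src C v = \<^bold>1" "tgt C v = Z \<otimes>\<^sub>o dual_ob D" and Z: "Z \<in> Ob C"
  defines "f \<equiv> (Z \<ltimes> ev D) \<cdot> (v \<rtimes> P)"
  shows "f \<in> mor C P Z" and "(f \<rtimes> dual_ob D) \<cdot> coev D = v"
proof -
  note t = left_dual_arr[OF D] v Z typing
  let ?Q = "dual_ob D"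
  show "f \<in> mor C P Z"
    by (simp add: f_def mor_iff t)
  have slide: "(v \<rtimes> (P \<otimes>\<^sub>o ?Q)) \<cdot> (\<^bold>1 \<ltimes> coev D) = ((Z \<otimes>\<^sub>o ?Q) \<ltimes> coev D) \<cdot> v"
    using slide[of v "coev D" "\<^bold>1" "Z \<otimes>\<^sub>o ?Q" "\<^bold>1" "P \<otimes>\<^sub>o ?Q"] by (simp add: t)
  have "(f \<rtimes> ?Q) \<cdot> coev D
      = (Z \<ltimes> ev D \<rtimes> ?Q) \<cdot> ((v \<rtimes> (P \<otimes>\<^sub>o ?Q)) \<cdot> (\<^bold>1 \<ltimes> coev D))"
    by (simp add: f_def whisker_right t arr_tensor_assoc tensor_id arr_assoc)
  also have "\<dots> = (Z \<ltimes> ((ev D \<rtimes> ?Q) \<cdot> (?Q \<ltimes> coev D))) \<cdot> v"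
    unfolding slide by (simp add: whisker_left t id_tensor_id_tensor arr_assoc)
  also have "\<dots> = v"
    by (simp add: zigzag[OF D] t tensor_id arr_comp_id)
  finally show "(f \<rtimes> ?Q) \<cdot> coev D = v" .
qed

lemma unbend:
  assumes D: "left_dual P D" and f: "f \<in> mor C P Z"
  shows "(Z \<ltimes> ev D) \<cdot> (((f \<rtimes> dual_ob D) \<cdot> coev D) \<rtimes> P) = f"
proof -
  have f': "arr f" "src C f = P" "tgt C f = Z" "Z \<in> Ob C"
    using f by (auto simp: mor_iff arr_ob)
  note t = left_dual_arr[OF D] f' typing
  let ?Q = "dual_ob D"
  have slide: "(Z \<ltimes> ev D) \<cdot> (f \<rtimes> (?Q \<otimes>\<^sub>o P)) = f \<cdot> (P \<ltimes> ev D)"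
    using slide[of f "ev D" P Z "?Q \<otimes>\<^sub>o P" "\<^bold>1"] by (simp add: t)
  have "(Z \<ltimes> ev D) \<cdot> (((f \<rtimes> ?Q) \<cdot> coev D) \<rtimes> P)
      = ((Z \<ltimes> ev D) \<cdot> (f \<rtimes> (?Q \<otimes>\<^sub>o P))) \<cdot> (coev D \<rtimes> P)"
    by (simp add: whisker_right t arr_tensor_assoc tensor_id arr_assoc)
  also have "\<dots> = f"
    unfolding slide by (simp add: arr_assoc t zigzag[OF D] arr_comp_id)
  finally show ?thesis .
qed

lemma bend_cancel:
  assumes "left_dual P D" "f \<in> mor C P Z" "h \<in> mor C P Z"
    and "(f \<rtimes> dual_ob D) \<cdot> coev D = (h \<rtimes> dual_ob D) \<cdot> coev D"
  shows "f = h"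
  unfolding unbend[OF assms(1,2), unfolded assms(4), symmetric]
  by (rule unbend[OF assms(1,3)])

text \<open>
  By the cancellation law \<open>dual_bend_cancel\<close> this equation characterizes \<open>f\<^sup>*\<close>. Everything about duals,
  such as contravariance, is derived from it.
\<close>

lemma dual_mor_coev:
  assumes A: "left_dual A DA" and B: "left_dual B DB" and f: "f \<in> mor C A B"
  shows "dual_mor DA DB f \<in> mor C (dual_ob DB) (dual_ob DA)"
    and "(B \<ltimes> dual_mor DA DB f) \<cdot> coev DB = (f \<rtimes> dual_ob DA) \<cdot> coev DA"
proof -
  have f': "arr f" "src C f = A" "tgt C f = B"
    using f by (auto simp: mor_iff)
  note t = left_dual_arr[OF A] left_dual_arr[OF B] f' typing
  have *: "dual_mor DA DB f = (ev DB \<rtimes> dual_ob DA) \<cdot>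
      (dual_ob DB \<ltimes> ((f \<rtimes> dual_ob DA) \<cdot> coev DA))"
    by (simp add: dual_mor_def whisker_left t)
  show "dual_mor DA DB f \<in> mor C (dual_ob DB) (dual_ob DA)"
    unfolding * by (rule bend_dual[OF B]) (simp_all add: t)
  show "(B \<ltimes> dual_mor DA DB f) \<cdot> coev DB = (f \<rtimes> dual_ob DA) \<cdot> coev DA"
    unfolding * by (rule bend_dual[OF B]) (simp_all add: t)
qed

lemma dual_mor_eqI:
  assumes A: "left_dual A DA" and B: "left_dual B DB" and f: "f \<in> mor C A B"
    and g: "g \<in> mor C (dual_ob DB) (dual_ob DA)"
    and eq: "(B \<ltimes> g) \<cdot> coev DB = (f \<rtimes> dual_ob DA) \<cdot> coev DA"
  shows "dual_mor DA DB f = g"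
  by (rule dual_bend_cancel[OF B dual_mor_coev(1)[OF A B f] g]) (simp add: dual_mor_coev(2)[OF A B f] eq)

lemma dual_mor_comp:
  assumes A: "left_dual A DA" and B: "left_dual B DB" and E: "left_dual E DE"
    and f: "f \<in> mor C A B" and g: "g \<in> mor C B E"
  shows "dual_mor DA DE (g \<cdot> f) = dual_mor DA DB f \<cdot> dual_mor DB DE g"
proof (rule dual_mor_eqI[OF A E])
  let ?f = "dual_mor DA DB f" and ?g = "dual_mor DB DE g"
  have fg: "arr f" "src C f = A" "tgt C f = B" "arr g" "src C g = B" "tgt C g = E"
    using f g by (auto simp: mor_iff)
  have f': "arr ?f" "src C ?f = dual_ob DB" "tgt C ?f = dual_ob DA"
    using dual_mor_coev(1)[OF A B f] by (auto simp: mor_iff)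
  have g': "arr ?g" "src C ?g = dual_ob DE" "tgt C ?g = dual_ob DB"
    using dual_mor_coev(1)[OF B E g] by (auto simp: mor_iff)
  note t = left_dual_arr[OF A] left_dual_arr[OF B] left_dual_arr[OF E] fg f' g' typing
  show "g \<cdot> f \<in> mor C A E" "?f \<cdot> ?g \<in> mor C (dual_ob DE) (dual_ob DA)"
    by (simp_all add: mor_iff t)
  have slide: "(E \<ltimes> ?f) \<cdot> (g \<rtimes> dual_ob DB) = (g \<rtimes> dual_ob DA) \<cdot> (B \<ltimes> ?f)"
    by (simp add: tensor_left_right tensor_right_left t)
  have "(E \<ltimes> (?f \<cdot> ?g)) \<cdot> coev DE = (E \<ltimes> ?f) \<cdot> (E \<ltimes> ?g) \<cdot> coev DE"
    by (simp add: whisker_left t arr_assoc)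
  also have "\<dots> = ((E \<ltimes> ?f) \<cdot> (g \<rtimes> dual_ob DB)) \<cdot> coev DB"
    by (simp add: dual_mor_coev(2)[OF B E g] arr_assoc t)
  also have "\<dots> = ((g \<cdot> f) \<rtimes> dual_ob DA) \<cdot> coev DA"
    unfolding slide by (simp add: dual_mor_coev(2)[OF A B f] whisker_right arr_assoc t)
  finally show "(E \<ltimes> (?f \<cdot> ?g)) \<cdot> coev DE = ((g \<cdot> f) \<rtimes> dual_ob DA) \<cdot> coev DA" .
qed

end

section \<open>Frobenius algebras\<close>

context linear_monoidal_category
begin

text \<open>Rewriting with these rules brings a composite into a sequence of layers, nested to the right.\<close>

lemmas layers = whisker_left whisker_right tensor_id id_tensor_id_tensor arr_tensor_assoc
  arr_assoc arr_comp_id typing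

lemma comp_reassoc:
  "\<lbrakk>arr f; arr g; arr h; src C g = tgt C f; src C h = tgt C g; h \<cdot> g = k\<rbrakk> \<Longrightarrow> h \<cdot> g \<cdot> f = k \<cdot> f"
  using arr_assoc by metis

lemma unital_algebra_arr:
  assumes "unital_algebra A m e"
  shows "arr m" "src C m = A \<otimes>\<^sub>o A" "tgt C m = A" "arr e" "src C e = \<^bold>1" "tgt C e = A" "A \<in> Ob C"
  using assms arr_ob by (auto simp: unital_algebra_def mor_iff)

text \<open>
  An algebra with a nondegenerate pairing of the form \<open>\<epsilon> \<circ> m\<close> is a Frobenius algebra: the
  comultiplication is the multiplication with one leg bent by the copairing \<open>k\<close>. As it does not matter
  which leg is bent, both Frobenius relations reduce to associativity, and coassociativity to the fact
  that \<open>(d \<otimes> 1) \<circ> k\<close> and \<open>(1 \<otimes> d) \<circ> k\<close> are both \<open>k \<otimes> k\<close> with its two middle strands multiplied.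
\<close>

lemma frobenius_from_copairing:
  fixes X :: "('o, 'm, 'z) frob_alg_scheme"
  defines "A \<equiv> alg_ob X" and "m \<equiv> alg_mult X" and "d \<equiv> alg_comult X" and "e \<equiv> alg_unit X"
    and "\<epsilon> \<equiv> alg_counit X"
  assumes alg: "unital_algebra A m e"
    and eps: "\<epsilon> \<in> mor C A \<^bold>1" and k: "k \<in> mor C \<^bold>1 (A \<otimes>\<^sub>o A)"
    and d1: "d = (m \<rtimes> A) \<cdot> (A \<ltimes> k)" and d2: "d = (A \<ltimes> m) \<cdot> (k \<rtimes> A)"
    and zigzag1: "((\<epsilon> \<cdot> m) \<rtimes> A) \<cdot> (A \<ltimes> k) = idm A"
    and zigzag2: "(A \<ltimes> (\<epsilon> \<cdot> m)) \<cdot> (k \<rtimes> A) = idm A"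
  shows "frobenius_algebra X" and "d \<cdot> e = k"
proof -
  have k': "arr k" "src C k = \<^bold>1" "tgt C k = A \<otimes>\<^sub>o A" and eps': "arr \<epsilon>" "src C \<epsilon> = A" "tgt C \<epsilon> = \<^bold>1"
    using k eps by (auto simp: mor_iff)
  have d': "arr d" "src C d = A" "tgt C d = A \<otimes>\<^sub>o A"
    using k' unital_algebra_arr[OF alg] by (simp_all add: d1 typing)
  note a = unital_algebra_arr[OF alg] k' eps' d'
  have assoc: "m \<cdot> (m \<rtimes> A) = m \<cdot> (A \<ltimes> m)"
    and unit: "m \<cdot> (e \<rtimes> A) = idm A" "m \<cdot> (A \<ltimes> e) = idm A"
    using alg by (auto simp: unital_algebra_def)
  have assoc1: "(A \<ltimes> m) \<cdot> (A \<ltimes> m \<rtimes> A) = (A \<ltimes> m) \<cdot> ((A \<otimes>\<^sub>o A) \<ltimes> m)"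
    using arg_cong[OF assoc, of "\<lambda>x. A \<ltimes> x"] by (simp add: layers a)
  have assoc2: "(m \<rtimes> A) \<cdot> (m \<rtimes> (A \<otimes>\<^sub>o A)) = (m \<rtimes> A) \<cdot> (A \<ltimes> m \<rtimes> A)"
    using arg_cong[OF assoc, of "\<lambda>x. x \<rtimes> A"] by (simp add: layers a)

  have frob1: "(A \<ltimes> m) \<cdot> (d \<rtimes> A) = d \<cdot> m"
  proof -
    have slide: "(k \<rtimes> A) \<cdot> m = ((A \<otimes>\<^sub>o A) \<ltimes> m) \<cdot> (k \<rtimes> (A \<otimes>\<^sub>o A))"
      using slide[of k m "\<^bold>1" "A \<otimes>\<^sub>o A" "A \<otimes>\<^sub>o A" A] by (simp add: layers a)
    have "(A \<ltimes> m) \<cdot> (d \<rtimes> A)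
        = (A \<ltimes> m) \<cdot> (A \<ltimes> m \<rtimes> A) \<cdot> (k \<rtimes> (A \<otimes>\<^sub>o A))"
      by (simp add: d2 layers a)
    also have "\<dots> = (A \<ltimes> m) \<cdot> (k \<rtimes> A) \<cdot> m"
      by (simp add: slide comp_reassoc[OF _ _ _ _ _ assoc1] layers a)
    also have "\<dots> = d \<cdot> m"
      by (simp add: d2 layers a)
    finally show ?thesis .
  qed
  have frob2: "(m \<rtimes> A) \<cdot> (A \<ltimes> d) = d \<cdot> m"
  proof -
    have slide: "(A \<ltimes> k) \<cdot> m = (m \<rtimes> (A \<otimes>\<^sub>o A)) \<cdot> ((A \<otimes>\<^sub>o A) \<ltimes> k)"
      using slide[of m k "A \<otimes>\<^sub>o A" A "\<^bold>1" "A \<otimes>\<^sub>o A"] by (simp add: layers a)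
    have "(m \<rtimes> A) \<cdot> (A \<ltimes> d)
        = (m \<rtimes> A) \<cdot> (A \<ltimes> m \<rtimes> A) \<cdot> ((A \<otimes>\<^sub>o A) \<ltimes> k)"
      by (simp add: d1 layers a)
    also have "\<dots> = (m \<rtimes> A) \<cdot> (A \<ltimes> k) \<cdot> m"
      by (simp add: slide comp_reassoc[OF _ _ _ _ _ assoc2[symmetric]] layers a)
    also have "\<dots> = d \<cdot> m"
      by (simp add: d1 layers a)
    finally show ?thesis .
  qed
  have coassoc: "(d \<rtimes> A) \<cdot> d = (A \<ltimes> d) \<cdot> d"
  proof -
    have "(d \<rtimes> A) \<cdot> k = (A \<ltimes> m \<rtimes> A) \<cdot> (k \<rtimes> (A \<otimes>\<^sub>o A)) \<cdot> k"
      by (simp add: d2 layers a)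
    moreover have "(A \<ltimes> d) \<cdot> k = (A \<ltimes> m \<rtimes> A) \<cdot> ((A \<otimes>\<^sub>o A) \<ltimes> k) \<cdot> k"
      by (simp add: d1 layers a)
    moreover have "(k \<rtimes> (A \<otimes>\<^sub>o A)) \<cdot> k = ((A \<otimes>\<^sub>o A) \<ltimes> k) \<cdot> k"
      using slide[of k k "\<^bold>1" "A \<otimes>\<^sub>o A" "\<^bold>1" "A \<otimes>\<^sub>o A"] by (simp add: layers a)
    ultimately have dk: "(d \<rtimes> A) \<cdot> k = (A \<ltimes> d) \<cdot> k"
      by simp
    have slide: "(d \<rtimes> A) \<cdot> (A \<ltimes> m) = ((A \<otimes>\<^sub>o A) \<ltimes> m) \<cdot> (d \<rtimes> (A \<otimes>\<^sub>o A))"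
      by (rule slide) (simp_all add: a)
    have "(d \<rtimes> A) \<cdot> d = ((d \<rtimes> A) \<cdot> (A \<ltimes> m)) \<cdot> (k \<rtimes> A)"
      by (subst (2) d2) (simp add: layers a)
    also have "\<dots> = ((A \<otimes>\<^sub>o A) \<ltimes> m) \<cdot> (((d \<rtimes> A) \<cdot> k) \<rtimes> A)"
      unfolding slide by (simp add: layers a)
    also have "\<dots> = (A \<ltimes> ((A \<ltimes> m) \<cdot> (d \<rtimes> A))) \<cdot> (k \<rtimes> A)"
      unfolding dk by (simp add: layers a)
    also have "\<dots> = (A \<ltimes> d) \<cdot> ((A \<ltimes> m) \<cdot> (k \<rtimes> A))"
      unfolding frob1 by (simp add: layers a)
    finally show ?thesis
      unfolding d2[symmetric] .
  qed
  have counit: "(\<epsilon> \<rtimes> A) \<cdot> d = idm A" "(A \<ltimes> \<epsilon>) \<cdot> d = idm A"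
  proof -
    have "(\<epsilon> \<rtimes> A) \<cdot> d = ((\<epsilon> \<cdot> m) \<rtimes> A) \<cdot> (A \<ltimes> k)"
      by (simp add: d1 layers a)
    with zigzag1 show "(\<epsilon> \<rtimes> A) \<cdot> d = idm A" by simp
    have "(A \<ltimes> \<epsilon>) \<cdot> d = (A \<ltimes> (\<epsilon> \<cdot> m)) \<cdot> (k \<rtimes> A)"
      by (simp add: d2 layers a)
    with zigzag2 show "(A \<ltimes> \<epsilon>) \<cdot> d = idm A" by simp
  qed
  have "counital_coalgebra A d \<epsilon>"
    using coassoc counit a by (simp add: counital_coalgebra_def mor_iff)
  with alg frob1 frob2 a show "frobenius_algebra X"
    by (simp add: frobenius_algebra_def A_def m_def d_def e_def \<epsilon>_def)
  have "d \<cdot> e = (m \<rtimes> A) \<cdot> ((A \<ltimes> k) \<cdot> e)"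
    by (simp add: d1 layers a)
  also have "(A \<ltimes> k) \<cdot> e = (e \<rtimes> (A \<otimes>\<^sub>o A)) \<cdot> k"
    using slide[of e k "\<^bold>1" A "\<^bold>1" "A \<otimes>\<^sub>o A"] by (simp add: layers a)
  also have "(m \<rtimes> A) \<cdot> (e \<rtimes> (A \<otimes>\<^sub>o A)) \<cdot> k = ((m \<cdot> (e \<rtimes> A)) \<rtimes> A) \<cdot> k"
    by (simp add: layers a)
  also have "\<dots> = k"
    unfolding unit by (simp add: layers a)
  finally show "d \<cdot> e = k" .
qed

lemma frobenius_arr:
  assumes "frobenius_algebra X"
  shows "alg_ob X \<in> Ob C" "arr (alg_mult X)" "src C (alg_mult X) = alg_ob X \<otimes>\<^sub>o alg_ob X"
    "tgt C (alg_mult X) = alg_ob X" "arr (alg_unit X)" "src C (alg_unit X) = \<^bold>1"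
    "tgt C (alg_unit X) = alg_ob X" "arr (alg_comult X)" "src C (alg_comult X) = alg_ob X"
    "tgt C (alg_comult X) = alg_ob X \<otimes>\<^sub>o alg_ob X" "arr (alg_counit X)"
    "src C (alg_counit X) = alg_ob X" "tgt C (alg_counit X) = \<^bold>1"
  using assms by (auto simp: frobenius_algebra_def unital_algebra_def counital_coalgebra_def mor_iff)

text \<open>
  Composing the Frobenius relations with the unit recovers \<open>\<delta>\<close> from \<open>m\<close> and \<open>\<delta> \<circ> e\<close>; then the zigzag
  identities for \<open>\<epsilon> \<circ> m\<close> and \<open>\<delta> \<circ> e\<close> are the counit laws.
\<close>

lemma frobenius_duality:
  assumes X: "frobenius_algebra X"
  defines "A \<equiv> alg_ob X"
  shows "left_dual A (frob_dual X)"
    and "alg_comult X = (alg_mult X \<rtimes> A) \<cdot> (A \<ltimes> coev (frob_dual X))"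
    and "alg_comult X = (A \<ltimes> alg_mult X) \<cdot> (coev (frob_dual X) \<rtimes> A)"
proof -
  let ?m = "alg_mult X" and ?d = "alg_comult X" and ?e = "alg_unit X" and ?eps = "alg_counit X"
  note a = frobenius_arr[OF X, folded A_def]
  have frob1: "(A \<ltimes> ?m) \<cdot> (?d \<rtimes> A) = ?d \<cdot> ?m"
    and frob2: "(?m \<rtimes> A) \<cdot> (A \<ltimes> ?d) = ?d \<cdot> ?m"
    and unit: "?m \<cdot> (?e \<rtimes> A) = idm A" "?m \<cdot> (A \<ltimes> ?e) = idm A"
    and counit: "(?eps \<rtimes> A) \<cdot> ?d = idm A" "(A \<ltimes> ?eps) \<cdot> ?d = idm A"
    using X by (auto simp: frobenius_algebra_def unital_algebra_def counital_coalgebra_def A_def)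
  have d1: "(A \<ltimes> ?m) \<cdot> ((?d \<cdot> ?e) \<rtimes> A) = ?d"
  proof -
    have "(A \<ltimes> ?m) \<cdot> ((?d \<cdot> ?e) \<rtimes> A) = ((A \<ltimes> ?m) \<cdot> (?d \<rtimes> A)) \<cdot> (?e \<rtimes> A)"
      by (simp add: layers a)
    also have "\<dots> = ?d \<cdot> (?m \<cdot> (?e \<rtimes> A))"
      unfolding frob1 by (simp add: layers a)
    finally show ?thesis
      unfolding unit by (simp add: layers a)
  qed
  have d2: "(?m \<rtimes> A) \<cdot> (A \<ltimes> (?d \<cdot> ?e)) = ?d"
  proof -
    have "(?m \<rtimes> A) \<cdot> (A \<ltimes> (?d \<cdot> ?e)) = ((?m \<rtimes> A) \<cdot> (A \<ltimes> ?d)) \<cdot> (A \<ltimes> ?e)"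
      by (simp add: layers a)
    also have "\<dots> = ?d \<cdot> (?m \<cdot> (A \<ltimes> ?e))"
      unfolding frob2 by (simp add: layers a)
    finally show ?thesis
      unfolding unit by (simp add: layers a)
  qed
  show "?d = (?m \<rtimes> A) \<cdot> (A \<ltimes> coev (frob_dual X))"
    "?d = (A \<ltimes> ?m) \<cdot> (coev (frob_dual X) \<rtimes> A)"
    using d1 d2 by (simp_all add: frob_dual_def)
  have "(A \<ltimes> (?eps \<cdot> ?m)) \<cdot> ((?d \<cdot> ?e) \<rtimes> A)
      = (A \<ltimes> ?eps) \<cdot> ((A \<ltimes> ?m) \<cdot> ((?d \<cdot> ?e) \<rtimes> A))"
    by (simp add: layers a)
  moreover have "((?eps \<cdot> ?m) \<rtimes> A) \<cdot> (A \<ltimes> (?d \<cdot> ?e))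
      = (?eps \<rtimes> A) \<cdot> ((?m \<rtimes> A) \<cdot> (A \<ltimes> (?d \<cdot> ?e)))"
    by (simp add: layers a)
  ultimately show "left_dual A (frob_dual X)"
    unfolding d1 d2 counit by (simp add: left_dual_def frob_dual_def mor_iff typing a A_def[symmetric])
qed

end

section \<open>Frobenius subalgebras as idempotents\<close>

context linear_category
begin

lemma split_monoI:
  assumes "i \<in> mor C A P" and "p \<in> mor C P A" and "p \<cdot> i = idm A"
  shows "is_mono i"
proof -
  have "g = h" if "g \<in> mor C Z A" "h \<in> mor C Z A" "i \<cdot> g = i \<cdot> h" for Z g h
    using that assms comp_assoc[of g Z A i P p A] comp_assoc[of h Z A i P p A]
    by (simp add: comp_id_left)
  moreover have "src C i = A" "tgt C i = P"
    using assms(1) by (auto simp: mor_iff)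
  ultimately show ?thesis
    using assms(1) by (auto simp: is_mono_def)
qed

end

context linear_monoidal_category
begin

text \<open>
  For a selfduality this says \<open>b\<^sup>* = b\<close>; in this form it is visibly stable under sums, and under
  products of commuting morphisms.
\<close>

definition self_dual :: "('o, 'm, 'z) frob_alg_scheme \<Rightarrow> 'm \<Rightarrow> bool" where
  "self_dual X b \<longleftrightarrow> b \<in> mor C (alg_ob X) (alg_ob X) \<and>
    (b \<rtimes> alg_ob X) \<cdot> coev (frob_dual X) = (alg_ob X \<ltimes> b) \<cdot> coev (frob_dual X)"

lemma self_dual_iff:
  assumes X: "frobenius_algebra X" and b: "b \<in> mor C (alg_ob X) (alg_ob X)"
  shows "self_dual X b \<longleftrightarrow> dual_mor (frob_dual X) (frob_dual X) b = b"
proof -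
  note D = frobenius_duality(1)[OF X]
  have [simp]: "dual_ob (frob_dual X) = alg_ob X"
    by (simp add: frob_dual_def)
  show ?thesis
    using dual_mor_coev(2)[OF D D b] dual_mor_eqI[OF D D b] b by (auto simp: self_dual_def)
qed

text \<open>
  These conditions characterize the idempotents \<open>i \<circ> i\<^sup>*\<close> of Frobenius subalgebras. The last one says that
  the image of \<open>b\<close> is closed under multiplication.
\<close>

definition subalgebra_idem :: "('o, 'm, 'z) frob_alg_scheme \<Rightarrow> 'm \<Rightarrow> bool" where
  "subalgebra_idem X b \<longleftrightarrow> self_dual X b \<and> b \<cdot> b = b \<and> b \<cdot> alg_unit X = alg_unit X \<and>
    b \<cdot> alg_mult X \<cdot> (b \<otimes>\<^sub>m b) = alg_mult X \<cdot> (b \<otimes>\<^sub>m b)"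

lemma subalgebra_split:
  assumes X: "frobenius_algebra X" and A: "frobenius_subalgebra X A"
  shows "incl A \<in> mor C (alg_ob A) (alg_ob X)" "incl_dual X A \<in> mor C (alg_ob X) (alg_ob A)"
    "incl_dual X A \<cdot> incl A = idm (alg_ob A)"
proof -
  have frob: "frobenius_algebra A" and i: "incl A \<in> mor C (alg_ob A) (alg_ob X)"
    and pi: "incl_dual X A \<cdot> incl A = idm (alg_ob A)"
    using A by (auto simp: frobenius_subalgebra_def)
  show "incl A \<in> mor C (alg_ob A) (alg_ob X)" "incl_dual X A \<cdot> incl A = idm (alg_ob A)"
    by fact+
  show "incl_dual X A \<in> mor C (alg_ob X) (alg_ob A)"
    using dual_mor_coev(1)[OF frobenius_duality(1)[OF frob] frobenius_duality(1)[OF X] i]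
    by (simp add: incl_dual_def frob_dual_def)
qed

text \<open>
  As \<open>i\<^sup>*\<^sup>* = i\<close>, contravariance of duality gives \<open>(i \<circ> i\<^sup>*)\<^sup>* = i\<^sup>*\<^sup>* \<circ> i\<^sup>* = i \<circ> i\<^sup>*\<close>.
\<close>

lemma subalg_idem_subalgebra:
  assumes X: "frobenius_algebra X" and A: "frobenius_subalgebra X A"
  shows "subalgebra_idem X (subalg_idem X A)"
proof -
  let ?i = "incl A" and ?p = "incl_dual X A" and ?b = "subalg_idem X A"
  have frob: "frobenius_algebra A" and bidual: "incl_bidual X A = ?i"
    and mult: "?i \<cdot> alg_mult A = alg_mult X \<cdot> (?i \<otimes>\<^sub>m ?i)" and unit: "?i \<cdot> alg_unit A = alg_unit X"
    using A by (auto simp: frobenius_subalgebra_def)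
  note split = subalgebra_split[OF X A]
  have ip: "arr ?i" "src C ?i = alg_ob A" "tgt C ?i = alg_ob X"
    "arr ?p" "src C ?p = alg_ob X" "tgt C ?p = alg_ob A"
    using split by (auto simp: mor_iff)
  note a = ip frobenius_arr[OF X] frobenius_arr[OF frob]
  have pi: "?p \<cdot> ?i \<cdot> h = h" if "arr h" "tgt C h = alg_ob A" for h
    using split(3) that a by (simp add: arr_assoc[symmetric] arr_comp_id)
  have b: "?b \<in> mor C (alg_ob X) (alg_ob X)"
    by (simp add: subalg_idem_def mor_iff typing a)
  have "dual_mor (frob_dual X) (frob_dual X) ?b
      = dual_mor (frob_dual X) (frob_dual A) ?p \<cdot> dual_mor (frob_dual A) (frob_dual X) ?i"
    unfolding subalg_idem_def
    by (rule dual_mor_comp[OF frobenius_duality(1)[OF X] frobenius_duality(1)[OF frob]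
        frobenius_duality(1)[OF X] split(2,1)])
  also have "\<dots> = ?b"
    using bidual by (simp add: incl_bidual_def incl_dual_def subalg_idem_def)
  finally have "self_dual X ?b"
    using self_dual_iff[OF X b] by simp
  moreover have "?b \<cdot> ?b = ?b"
    by (simp add: subalg_idem_def layers a pi)
  moreover have "?b \<cdot> alg_unit X = alg_unit X"
    by (simp add: subalg_idem_def unit[symmetric] layers a pi)
  moreover have "?b \<cdot> alg_mult X \<cdot> (?b \<otimes>\<^sub>m ?b) = alg_mult X \<cdot> (?b \<otimes>\<^sub>m ?b)"
  proof -
    have "?b \<otimes>\<^sub>m ?b = (?i \<otimes>\<^sub>m ?i) \<cdot> (?p \<otimes>\<^sub>m ?p)"
      by (simp add: subalg_idem_def interchange a)
    then have "alg_mult X \<cdot> (?b \<otimes>\<^sub>m ?b) = (alg_mult X \<cdot> (?i \<otimes>\<^sub>m ?i)) \<cdot> (?p \<otimes>\<^sub>m ?p)"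
      by (simp add: arr_assoc typing a)
    also have "\<dots> = ?i \<cdot> alg_mult A \<cdot> (?p \<otimes>\<^sub>m ?p)"
      by (simp add: mult[symmetric] arr_assoc typing a)
    finally show ?thesis
      by (simp add: subalg_idem_def arr_assoc typing a pi)
  qed
  ultimately show ?thesis
    by (simp add: subalgebra_idem_def)
qed

text \<open>
  The structure of \<open>X\<close> is compressed to the image by \<open>i\<close> and \<open>p\<close>. The unit and multiplication restrict
  because the image is a unital subalgebra. Since \<open>b\<close> is its own dual, \<open>(p \<otimes> p) \<circ> coev\<close> is a copairing
  for the restricted pairing, and the compressed comultiplication is the one that it determines.
\<close>

lemma ex_frobenius_subalgebra:
  assumes X: "frobenius_algebra X" and b: "subalgebra_idem X b"
    and i: "i \<in> mor C A (alg_ob X)" and p: "p \<in> mor C (alg_ob X) A" and pi: "p \<cdot> i = idm A" and ip: "i \<cdot> p = b"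
  shows "\<exists>S. frobenius_subalgebra X S \<and> incl S = i \<and> incl_dual X S = p"
proof -
  let ?P = "alg_ob X" and ?m = "alg_mult X" and ?d = "alg_comult X" and ?e = "alg_unit X"
    and ?eps = "alg_counit X" and ?D = "frob_dual X"
  define k where "k = coev ?D"
  define S where "S = \<lparr>alg_ob = A, alg_mult = p \<cdot> ?m \<cdot> (i \<otimes>\<^sub>m i),
    alg_comult = (p \<otimes>\<^sub>m p) \<cdot> ?d \<cdot> i, alg_unit = p \<cdot> ?e, alg_counit = ?eps \<cdot> i, incl = i\<rparr>"
  have ip_arr: "arr i" "src C i = A" "tgt C i = ?P" "arr p" "src C p = ?P" "tgt C p = A" "A \<in> Ob C"
    using i p mor_obD by (auto simp: mor_iff)
  have b_arr: "arr b" "src C b = ?P" "tgt C b = ?P"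
    using ip_arr by (simp_all add: ip[symmetric] typing)
  have k_arr: "arr k" "src C k = \<^bold>1" "tgt C k = ?P \<otimes>\<^sub>o ?P"
    using left_dual_arr[OF frobenius_duality(1)[OF X]] by (simp_all add: k_def frob_dual_def)
  note a = ip_arr b_arr k_arr frobenius_arr[OF X]
  have bi: "b \<cdot> i = i" and pb: "p \<cdot> b = p"
    using a pi by (simp_all add: ip[symmetric] arr_assoc arr_comp_id)
      (simp add: arr_assoc[symmetric] arr_comp_id)
  have b_unit: "b \<cdot> ?e = ?e" and b_mult: "b \<cdot> ?m \<cdot> (b \<otimes>\<^sub>m b) = ?m \<cdot> (b \<otimes>\<^sub>m b)"
    and b_k: "(b \<rtimes> ?P) \<cdot> k = (?P \<ltimes> b) \<cdot> k"
    using b by (auto simp: subalgebra_idem_def self_dual_def k_def)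
  \<comment> \<open>The image of \<open>b\<close> is closed under multiplication; hence \<open>i\<close> is multiplicative.\<close>
  have closed: "b \<cdot> ?m \<cdot> (i \<otimes>\<^sub>m i) = ?m \<cdot> (i \<otimes>\<^sub>m i)"
  proof -
    have bb: "(b \<otimes>\<^sub>m b) \<cdot> (i \<otimes>\<^sub>m i) = i \<otimes>\<^sub>m i"
      by (simp add: interchange a bi)
    have "(b \<cdot> ?m \<cdot> (b \<otimes>\<^sub>m b)) \<cdot> (i \<otimes>\<^sub>m i) = (?m \<cdot> (b \<otimes>\<^sub>m b)) \<cdot> (i \<otimes>\<^sub>m i)"
      unfolding b_mult ..
    then show ?thesis
      by (simp add: arr_assoc typing a bb)
  qed
  have ipm: "i \<cdot> p \<cdot> ?m \<cdot> (i \<otimes>\<^sub>m i) = ?m \<cdot> (i \<otimes>\<^sub>m i)"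
    using closed by (simp add: ip[symmetric] arr_assoc typing a)
  have ipe: "i \<cdot> p \<cdot> ?e = ?e"
    using b_unit by (simp add: ip[symmetric] arr_assoc typing a)
  \<comment> \<open>As \<open>b\<close> slides around the coevaluation, projecting one of its legs already projects the other.\<close>
  have k1: "(b \<otimes>\<^sub>m p) \<cdot> k = (?P \<ltimes> p) \<cdot> k" and k2: "(p \<otimes>\<^sub>m b) \<cdot> k = (p \<rtimes> ?P) \<cdot> k"
  proof -
    have "(b \<otimes>\<^sub>m p) \<cdot> k = (?P \<ltimes> p) \<cdot> (b \<rtimes> ?P) \<cdot> k"
      by (simp add: tensor_right_left[of b p ?P ?P, symmetric] arr_assoc typing a)
    also have "\<dots> = (?P \<ltimes> (p \<cdot> b)) \<cdot> k"
      unfolding b_k by (simp add: layers a)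
    finally show "(b \<otimes>\<^sub>m p) \<cdot> k = (?P \<ltimes> p) \<cdot> k"
      unfolding pb .
    have "(p \<otimes>\<^sub>m b) \<cdot> k = (p \<rtimes> ?P) \<cdot> (?P \<ltimes> b) \<cdot> k"
      by (simp add: tensor_left_right[of p b ?P ?P, symmetric] arr_assoc typing a)
    also have "\<dots> = ((p \<cdot> b) \<rtimes> ?P) \<cdot> k"
      unfolding b_k[symmetric] by (simp add: layers a)
    finally show "(p \<otimes>\<^sub>m b) \<cdot> k = (p \<rtimes> ?P) \<cdot> k"
      unfolding pb .
  qed
  define k' where "k' = (p \<otimes>\<^sub>m p) \<cdot> k"
  have k': "k' \<in> mor C \<^bold>1 (A \<otimes>\<^sub>o A)"
    by (simp add: k'_def mor_iff typing a)
  have k'_arr: "arr k'" "src C k' = \<^bold>1" "tgt C k' = A \<otimes>\<^sub>o A"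
    using k' by (auto simp: mor_iff)
  have ik1: "(i \<rtimes> A) \<cdot> k' = (?P \<ltimes> p) \<cdot> k"
  proof -
    have "(i \<rtimes> A) \<cdot> k' = (b \<otimes>\<^sub>m p) \<cdot> k"
      by (simp add: k'_def arr_assoc[symmetric] interchange typing a arr_comp_id ip)
    then show ?thesis
      unfolding k1 .
  qed
  have ik2: "(A \<ltimes> i) \<cdot> k' = (p \<rtimes> ?P) \<cdot> k"
  proof -
    have "(A \<ltimes> i) \<cdot> k' = (p \<otimes>\<^sub>m b) \<cdot> k"
      by (simp add: k'_def arr_assoc[symmetric] interchange typing a arr_comp_id ip)
    then show ?thesis
      unfolding k2 .
  qed
  let ?m' = "p \<cdot> ?m \<cdot> (i \<otimes>\<^sub>m i)" and ?e' = "p \<cdot> ?e" and ?d' = "(p \<otimes>\<^sub>m p) \<cdot> ?d \<cdot> i"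
  have assoc: "?m \<cdot> (?m \<rtimes> ?P) = ?m \<cdot> (?P \<ltimes> ?m)"
    and unit: "?m \<cdot> (?e \<rtimes> ?P) = idm ?P" "?m \<cdot> (?P \<ltimes> ?e) = idm ?P"
    using X by (auto simp: frobenius_algebra_def unital_algebra_def)
  have alg: "unital_algebra A ?m' ?e'"
  proof -
    have "(i \<otimes>\<^sub>m i) \<cdot> (?m' \<rtimes> A) = (?m \<cdot> (i \<otimes>\<^sub>m i)) \<otimes>\<^sub>m i"
      by (simp add: interchange typing a arr_comp_id ipm)
    also have "\<dots> = (?m \<rtimes> ?P) \<cdot> ((i \<otimes>\<^sub>m i) \<otimes>\<^sub>m i)"
      by (subst interchange) (simp_all add: typing a arr_comp_id)
    finally have 1: "?m' \<cdot> (?m' \<rtimes> A) = p \<cdot> (?m \<cdot> (?m \<rtimes> ?P)) \<cdot> ((i \<otimes>\<^sub>m i) \<otimes>\<^sub>m i)"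
      by (simp add: arr_assoc typing a)
    have "(i \<otimes>\<^sub>m i) \<cdot> (A \<ltimes> ?m') = i \<otimes>\<^sub>m (?m \<cdot> (i \<otimes>\<^sub>m i))"
      by (simp add: interchange typing a arr_comp_id ipm)
    also have "\<dots> = (?P \<ltimes> ?m) \<cdot> (i \<otimes>\<^sub>m (i \<otimes>\<^sub>m i))"
      by (subst interchange) (simp_all add: typing a arr_comp_id)
    finally have 2: "?m' \<cdot> (A \<ltimes> ?m') = p \<cdot> (?m \<cdot> (?P \<ltimes> ?m)) \<cdot> (i \<otimes>\<^sub>m (i \<otimes>\<^sub>m i))"
      by (simp add: arr_assoc typing a)
    have "?m' \<cdot> (?m' \<rtimes> A) = ?m' \<cdot> (A \<ltimes> ?m')"
      unfolding 1 2 assoc by (simp add: arr_tensor_assoc a)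
    moreover have "?m' \<cdot> (?e' \<rtimes> A) = idm A"
    proof -
      have "(i \<otimes>\<^sub>m i) \<cdot> (?e' \<rtimes> A) = ?e \<otimes>\<^sub>m i"
        by (simp add: interchange typing a arr_comp_id ipe)
      also have "\<dots> = (?e \<rtimes> ?P) \<cdot> i"
        using tensor_left_right[of ?e i "\<^bold>1" ?P] by (simp add: layers a)
      finally have "?m' \<cdot> (?e' \<rtimes> A) = p \<cdot> (?m \<cdot> (?e \<rtimes> ?P)) \<cdot> i"
        by (simp add: arr_assoc typing a)
      then show ?thesis
        by (simp add: unit arr_comp_id a pi)
    qed
    moreover have "?m' \<cdot> (A \<ltimes> ?e') = idm A"
    proof -
      have "(i \<otimes>\<^sub>m i) \<cdot> (A \<ltimes> ?e') = i \<otimes>\<^sub>m ?e"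
        by (simp add: interchange typing a arr_comp_id ipe)
      also have "\<dots> = (?P \<ltimes> ?e) \<cdot> i"
        using tensor_right_left[of i ?e ?P "\<^bold>1"] by (simp add: layers a)
      finally have "?m' \<cdot> (A \<ltimes> ?e') = p \<cdot> (?m \<cdot> (?P \<ltimes> ?e)) \<cdot> i"
        by (simp add: arr_assoc typing a)
      then show ?thesis
        by (simp add: unit arr_comp_id a pi)
    qed
    ultimately show ?thesis
      by (simp add: unital_algebra_def mor_iff typing a)
  qed
  \<comment> \<open>Bending a leg of \<open>h \<circ> (i \<otimes> i)\<close> in the subalgebra amounts to bending the leg of \<open>h\<close> in \<open>X\<close>. For
    \<open>h = p \<circ> m\<close> this concerns the comultiplication, for \<open>h = \<epsilon> \<circ> m\<close> the zigzag identities.\<close>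
  have bend1: "((h \<cdot> (i \<otimes>\<^sub>m i)) \<rtimes> A) \<cdot> (A \<ltimes> k')
      = (Z \<ltimes> p) \<cdot> ((h \<rtimes> ?P) \<cdot> (?P \<ltimes> k)) \<cdot> i"
    if h: "arr h" "src C h = ?P \<otimes>\<^sub>o ?P" "tgt C h = Z" for h Z
  proof -
    have "(i \<otimes>\<^sub>m i \<rtimes> A) \<cdot> (A \<ltimes> k') = i \<otimes>\<^sub>m ((i \<rtimes> A) \<cdot> k')"
      by (subst interchange) (simp_all add: typing a k'_arr arr_comp_id)
    also have "\<dots> = (?P \<ltimes> ((?P \<ltimes> p) \<cdot> k)) \<cdot> i"
      unfolding ik1 using tensor_right_left[of i "(?P \<ltimes> p) \<cdot> k" ?P "\<^bold>1"] by (simp add: typing a)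
    finally have 1: "((h \<cdot> (i \<otimes>\<^sub>m i)) \<rtimes> A) \<cdot> (A \<ltimes> k')
        = ((h \<rtimes> A) \<cdot> ((?P \<otimes>\<^sub>o ?P) \<ltimes> p)) \<cdot> (?P \<ltimes> k) \<cdot> i"
      using h by (simp add: layers a k'_arr)
    have 2: "(h \<rtimes> A) \<cdot> ((?P \<otimes>\<^sub>o ?P) \<ltimes> p) = (Z \<ltimes> p) \<cdot> (h \<rtimes> ?P)"
      by (rule slide) (simp_all add: a h)
    show ?thesis
      unfolding 1 2 using h arr_ob[OF h(1)] by (simp add: arr_assoc typing a)
  qed
  have bend2: "(A \<ltimes> (h \<cdot> (i \<otimes>\<^sub>m i))) \<cdot> (k' \<rtimes> A)
      = (p \<rtimes> Z) \<cdot> ((?P \<ltimes> h) \<cdot> (k \<rtimes> ?P)) \<cdot> i"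
    if h: "arr h" "src C h = ?P \<otimes>\<^sub>o ?P" "tgt C h = Z" for h Z
  proof -
    have "((A \<ltimes> i) \<otimes>\<^sub>m i) \<cdot> (k' \<rtimes> A) = ((A \<ltimes> i) \<cdot> k') \<otimes>\<^sub>m i"
      by (subst interchange) (simp_all add: typing a k'_arr arr_comp_id)
    also have "\<dots> = (((p \<rtimes> ?P) \<cdot> k) \<rtimes> ?P) \<cdot> i"
      unfolding ik2 using tensor_left_right[of "(p \<rtimes> ?P) \<cdot> k" i "\<^bold>1" ?P] by (simp add: typing a)
    finally have 1: "(A \<ltimes> (h \<cdot> (i \<otimes>\<^sub>m i))) \<cdot> (k' \<rtimes> A)
        = ((A \<ltimes> h) \<cdot> (p \<rtimes> (?P \<otimes>\<^sub>o ?P))) \<cdot> (k \<rtimes> ?P) \<cdot> i"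
      using h by (simp add: layers a k'_arr)
    have 2: "(A \<ltimes> h) \<cdot> (p \<rtimes> (?P \<otimes>\<^sub>o ?P)) = (p \<rtimes> Z) \<cdot> (?P \<ltimes> h)"
      by (rule slide[symmetric]) (simp_all add: a h)
    show ?thesis
      unfolding 1 2 using h arr_ob[OF h(1)] by (simp add: arr_assoc typing a)
  qed
  have m': "?m' = (p \<cdot> ?m) \<cdot> (i \<otimes>\<^sub>m i)" and eps_m': "(?eps \<cdot> i) \<cdot> ?m' = (?eps \<cdot> ?m) \<cdot> (i \<otimes>\<^sub>m i)"
    by (simp_all add: arr_assoc typing a ipm)
  have d1: "?d' = (?m' \<rtimes> A) \<cdot> (A \<ltimes> k')"
  proof -
    have "((p \<cdot> ?m) \<rtimes> ?P) \<cdot> (?P \<ltimes> k) = (p \<rtimes> ?P) \<cdot> ?d"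
      using frobenius_duality(2)[OF X] by (simp add: k_def[symmetric] whisker_right arr_assoc typing a)
    then have "(?m' \<rtimes> A) \<cdot> (A \<ltimes> k') = (A \<ltimes> p) \<cdot> (p \<rtimes> ?P) \<cdot> ?d \<cdot> i"
      unfolding m' by (subst bend1[of "p \<cdot> ?m" A]) (simp_all add: typing a arr_assoc)
    also have "\<dots> = ?d'"
      using tensor_right_left[of p p A ?P] by (intro comp_reassoc) (simp_all add: typing a)
    finally show ?thesis ..
  qed
  have d2: "?d' = (A \<ltimes> ?m') \<cdot> (k' \<rtimes> A)"
  proof -
    have "(?P \<ltimes> (p \<cdot> ?m)) \<cdot> (k \<rtimes> ?P) = (?P \<ltimes> p) \<cdot> ?d"
      using frobenius_duality(3)[OF X] by (simp add: k_def[symmetric] whisker_left arr_assoc typing a)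
    then have "(A \<ltimes> ?m') \<cdot> (k' \<rtimes> A) = (p \<rtimes> A) \<cdot> (?P \<ltimes> p) \<cdot> ?d \<cdot> i"
      unfolding m' by (subst bend2[of "p \<cdot> ?m" A]) (simp_all add: typing a arr_assoc)
    also have "\<dots> = ?d'"
      using tensor_left_right[of p p ?P A] by (intro comp_reassoc) (simp_all add: typing a)
    finally show ?thesis ..
  qed
  have X_zigzag: "((?eps \<cdot> ?m) \<rtimes> ?P) \<cdot> (?P \<ltimes> k) = idm ?P"
    "(?P \<ltimes> (?eps \<cdot> ?m)) \<cdot> (k \<rtimes> ?P) = idm ?P"
    using zigzag[OF frobenius_duality(1)[OF X]] by (simp_all add: k_def frob_dual_def)
  have zigzag1: "(((?eps \<cdot> i) \<cdot> ?m') \<rtimes> A) \<cdot> (A \<ltimes> k') = idm A"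
    unfolding eps_m' by (subst bend1[of "?eps \<cdot> ?m" "\<^bold>1"]) (simp_all add: X_zigzag typing a arr_comp_id pi)
  have zigzag2: "(A \<ltimes> ((?eps \<cdot> i) \<cdot> ?m')) \<cdot> (k' \<rtimes> A) = idm A"
    unfolding eps_m' by (subst bend2[of "?eps \<cdot> ?m" "\<^bold>1"]) (simp_all add: X_zigzag typing a arr_comp_id pi)
  have S: "frobenius_algebra S" "?d' \<cdot> ?e' = k'"
    using frobenius_from_copairing[of S k'] alg k' d1 d2 zigzag1 zigzag2
    by (simp_all add: S_def mor_iff typing a)
  note DX = frobenius_duality(1)[OF X] and DS = frobenius_duality(1)[OF S(1)]
  have k_S: "coev (frob_dual S) = k'"
    using S(2) by (simp add: S_def frob_dual_def)
  have dual_i: "incl_dual X S = p"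
    unfolding incl_dual_def using i p ik1 k_S
    by (intro dual_mor_eqI[OF DS DX]) (simp_all add: S_def frob_dual_def k_def)
  have bidual_i: "incl_bidual X S = i"
    unfolding incl_bidual_def dual_i using i p ik2 k_S
    by (intro dual_mor_eqI[OF DX DS]) (simp_all add: S_def frob_dual_def k_def)
  have "frobenius_subalgebra X S"
    using S(1) i split_monoI[OF i p pi] ipm ipe dual_i bidual_i pi
    by (simp add: frobenius_subalgebra_def S_def)
  with dual_i show ?thesis
    by (auto simp: S_def)
qed

end

section \<open>Hermitian forms on hom-spaces\<close>

context linear_category
begin

lemma finsum_mor_mono_neutral:
  assumes "A \<in> Ob C" "B \<in> Ob C" "finite J" "K \<subseteq> J" and "\<And>j. j \<in> K \<Longrightarrow> v j \<in> mor C A B"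
    and "\<And>j. j \<in> J - K \<Longrightarrow> v j = zero_mor A B"
  shows "(\<Oplus>\<^bsub>Hom C A B\<^esub>j\<in>K. v j) = (\<Oplus>\<^bsub>Hom C A B\<^esub>j\<in>J. v j)"
proof -
  interpret abelian_group "Hom C A B"
    using assms by (intro Hom_abelian_group)
  have "v j \<in> carrier (Hom C A B)" if "j \<in> J" for j
    using assms that by (cases "j \<in> K") (auto simp: mor_def)
  then show ?thesis
    using assms by (intro add.finprod_mono_neutral_cong_left) auto
qed

text \<open>
  A sum over an infinite set is \<open>0\<close> by convention, so the form attached to a basis is definite only
  because the basis is finite.
\<close>

lemma hom_basis_finite:
  assumes U: "hom_basis P S U" and P: "P \<in> Ob C" and S: "S \<in> Ob C" and fin: "fin_dim P S"
  shows "finite U"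
proof (rule ccontr)
  assume "infinite U"
  then obtain v :: "nat \<Rightarrow> 'm" where v: "inj v" "range v \<subseteq> U"
    using infinite_countable_subset by blast
  have U_mor: "U \<subseteq> mor C P S" and unique: "\<And>f. f \<in> mor C P S \<Longrightarrow> \<exists>!c. coords P S U f c"
    using U by (auto simp: hom_basis_def)
  from v U_mor have v_mor: "v j \<in> mor C P S" for j
    by auto
  obtain d c k where c: "k \<le> d" "c k \<noteq> 0"
    and c0: "(\<Oplus>\<^bsub>Hom C P S\<^esub>j\<in>{..d}. c j \<odot>\<^bsub>Hom C P S\<^esub> v j) = zero_mor P S"
    by (rule hom_dependency[OF fin v_mor])
  interpret abelian_group "Hom C P S"
    using P S by (rule Hom_abelian_group)
  \<comment> \<open>The dependency gives the zero morphism a second coordinate vector.\<close>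
  define c' where "c' u = (if u \<in> v ` {..d} then c (the_inv v u) else 0)" for u
  have c'v: "c' (v j) = c j" if "j \<le> d" for j
    using v that by (auto simp: c'_def the_inv_f_f)
  have supp: "{u. c' u \<noteq> 0} \<subseteq> v ` {..d}"
    by (auto simp: c'_def)
  have "(\<Oplus>\<^bsub>Hom C P S\<^esub>u\<in>{u. c' u \<noteq> 0}. c' u \<odot>\<^bsub>Hom C P S\<^esub> u)
      = (\<Oplus>\<^bsub>Hom C P S\<^esub>u\<in>v ` {..d}. c' u \<odot>\<^bsub>Hom C P S\<^esub> u)"
    using supp v_mor P S by (intro finsum_mor_mono_neutral) (auto intro!: smult_mor_closed smult_zero)
  also have "\<dots> = (\<Oplus>\<^bsub>Hom C P S\<^esub>j\<in>{..d}. c' (v j) \<odot>\<^bsub>Hom C P S\<^esub> v j)"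
    using v v_mor P S smult_mor_closed carrier_Hom
    by (subst finsum_reindex) (auto simp: inj_on_def inj_def Pi_def)
  also have "\<dots> = (\<Oplus>\<^bsub>Hom C P S\<^esub>j\<in>{..d}. c j \<odot>\<^bsub>Hom C P S\<^esub> v j)"
    using P S v_mor by (intro finsum_mor_cong) (auto simp: c'v smult_mor_closed)
  finally have "coords P S U (zero_mor P S) c'"
    using supp v c0 by (auto simp: coords_def intro: finite_subset)
  moreover have "coords P S U (zero_mor P S) (\<lambda>_. 0)"
    using P S by (simp add: coords_def finsum_mor_empty)
  ultimately have "c' = (\<lambda>_. 0)"
    using unique[OF zero_mor_closed[OF P S]] by blast
  with c'v[of k] c show False
    by simp
qed

end

locale finite_hom_basis = linear_category C for C :: "('o, 'm) moncat" (structure) +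
  fixes P S :: 'o and U :: "'m set"
  assumes src_ob: "P \<in> Ob C" and tgt_ob: "S \<in> Ob C" and hom_basis: "hom_basis P S U" and finite_basis: "finite U"
begin

abbreviation coeff :: "'m \<Rightarrow> 'm \<Rightarrow> complex" where
  "coeff \<equiv> basis_coeff P S U"

abbreviation form :: "'m \<Rightarrow> 'm \<Rightarrow> complex" where
  "form \<equiv> basis_form P S U"

lemma basis_mor: "u \<in> U \<Longrightarrow> u \<in> mor C P S"
  using hom_basis by (auto simp: hom_basis_def)

lemma coords_iff:
  "coords P S U f c \<longleftrightarrow> {u. c u \<noteq> 0} \<subseteq> U \<and> f = (\<Oplus>\<^bsub>Hom C P S\<^esub>u\<in>U. c u \<odot>\<^bsub>Hom C P S\<^esub> u)"
proof -
  have "(\<Oplus>\<^bsub>Hom C P S\<^esub>u\<in>{u. c u \<noteq> 0}. c u \<odot>\<^bsub>Hom C P S\<^esub> u) = (\<Oplus>\<^bsub>Hom C P S\<^esub>u\<in>U. c u \<odot>\<^bsub>Hom C P S\<^esub> u)"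
    if "{u. c u \<noteq> 0} \<subseteq> U"
    using that src_ob tgt_ob finite_basis basis_mor
    by (intro finsum_mor_mono_neutral) (auto intro!: smult_mor_closed smult_zero)
  then show ?thesis
    using finite_basis by (auto simp: coords_def intro: finite_subset)
qed

lemma coeff_eqI:
  assumes "{u. c u \<noteq> 0} \<subseteq> U" "f = (\<Oplus>\<^bsub>Hom C P S\<^esub>u\<in>U. c u \<odot>\<^bsub>Hom C P S\<^esub> u)"
  shows "coeff f = c"
proof -
  have "f \<in> mor C P S"
    unfolding assms(2) using src_ob tgt_ob basis_mor by (intro finsum_mor_closed smult_mor_closed)
  then have "\<exists>!c. coords P S U f c"
    using hom_basis by (simp add: hom_basis_def)
  then show ?thesis
    unfolding basis_coeff_def using assms coords_iff by (intro the1_equality) auto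
qed

lemma coeff_coords:
  assumes "f \<in> mor C P S"
  shows "{u. coeff f u \<noteq> 0} \<subseteq> U" "f = (\<Oplus>\<^bsub>Hom C P S\<^esub>u\<in>U. coeff f u \<odot>\<^bsub>Hom C P S\<^esub> u)"
proof -
  have "\<exists>!c. coords P S U f c"
    using assms hom_basis by (simp add: hom_basis_def)
  then have "coords P S U f (coeff f)"
    unfolding basis_coeff_def by (rule theI')
  then show "{u. coeff f u \<noteq> 0} \<subseteq> U" "f = (\<Oplus>\<^bsub>Hom C P S\<^esub>u\<in>U. coeff f u \<odot>\<^bsub>Hom C P S\<^esub> u)"
    by (simp_all add: coords_iff)
qed

lemma coeff_add:
  assumes "f \<in> mor C P S" "g \<in> mor C P S"
  shows "coeff (f \<oplus>\<^bsub>Hom C P S\<^esub> g) = (\<lambda>u. coeff f u + coeff g u)"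
proof (rule coeff_eqI)
  show "{u. coeff f u + coeff g u \<noteq> 0} \<subseteq> U"
    using coeff_coords(1)[OF assms(1)] coeff_coords(1)[OF assms(2)] by force
  interpret abelian_group "Hom C P S"
    using src_ob tgt_ob by (rule Hom_abelian_group)
  have "(\<Oplus>\<^bsub>Hom C P S\<^esub>u\<in>U. (coeff f u + coeff g u) \<odot>\<^bsub>Hom C P S\<^esub> u)
     = (\<Oplus>\<^bsub>Hom C P S\<^esub>u\<in>U. (coeff f u \<odot>\<^bsub>Hom C P S\<^esub> u) \<oplus>\<^bsub>Hom C P S\<^esub> (coeff g u \<odot>\<^bsub>Hom C P S\<^esub> u))"
    using src_ob tgt_ob basis_mor
    by (intro finsum_mor_cong) (auto simp: smult_add add_mor_closed smult_mor_closed)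
  also have "\<dots> = f \<oplus>\<^bsub>Hom C P S\<^esub> g"
    using src_ob tgt_ob basis_mor smult_mor_closed carrier_Hom coeff_coords(2)[OF assms(1), symmetric]
      coeff_coords(2)[OF assms(2), symmetric]
    by (subst finsum_addf) auto
  finally show "f \<oplus>\<^bsub>Hom C P S\<^esub> g = (\<Oplus>\<^bsub>Hom C P S\<^esub>u\<in>U. (coeff f u + coeff g u) \<odot>\<^bsub>Hom C P S\<^esub> u)" ..
qed

lemma coeff_smult:
  assumes "f \<in> mor C P S"
  shows "coeff (z \<odot>\<^bsub>Hom C P S\<^esub> f) = (\<lambda>u. z * coeff f u)"
proof (rule coeff_eqI)
  show "{u. z * coeff f u \<noteq> 0} \<subseteq> U"
    using coeff_coords(1)[OF assms(1)] by force
  interpret module complex_ring "Hom C P S"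
    using src_ob tgt_ob by (rule Hom_module)
  have "z \<odot>\<^bsub>Hom C P S\<^esub> f = z \<odot>\<^bsub>Hom C P S\<^esub> (\<Oplus>\<^bsub>Hom C P S\<^esub>u\<in>U. coeff f u \<odot>\<^bsub>Hom C P S\<^esub> u)"
    using coeff_coords(2)[OF assms] by simp
  also have "\<dots> = (\<Oplus>\<^bsub>Hom C P S\<^esub>u\<in>U. z \<odot>\<^bsub>Hom C P S\<^esub> (coeff f u \<odot>\<^bsub>Hom C P S\<^esub> u))"
    using src_ob tgt_ob finite_basis basis_mor smult_mor_closed carrier_Hom smult_r_distr[of z]
    by (intro additive_finsum) (auto simp: smult_0_mor)
  also have "\<dots> = (\<Oplus>\<^bsub>Hom C P S\<^esub>u\<in>U. (z * coeff f u) \<odot>\<^bsub>Hom C P S\<^esub> u)"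
    using src_ob tgt_ob basis_mor by (intro finsum_mor_cong) (auto simp: smult_assoc smult_mor_closed)
  finally show "z \<odot>\<^bsub>Hom C P S\<^esub> f = (\<Oplus>\<^bsub>Hom C P S\<^esub>u\<in>U. (z * coeff f u) \<odot>\<^bsub>Hom C P S\<^esub> u)" .
qed

lemma form_add_left:
  "\<lbrakk>f \<in> mor C P S; g \<in> mor C P S\<rbrakk> \<Longrightarrow> form (f \<oplus>\<^bsub>Hom C P S\<^esub> g) h = form f h + form g h"
  by (simp add: basis_form_def coeff_add sum.distrib distrib_right)

lemma form_smult_left: "f \<in> mor C P S \<Longrightarrow> form (z \<odot>\<^bsub>Hom C P S\<^esub> f) h = z * form f h"
  by (simp add: basis_form_def coeff_smult sum_distrib_left mult.assoc)

lemma form_cnj: "form f g = cnj (form g f)"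
  by (simp add: basis_form_def mult.commute)

lemma form_zero_left: "form (zero_mor P S) h = 0"
  using form_smult_left[OF zero_mor_closed[OF src_ob tgt_ob], of 0 h] src_ob tgt_ob
  by (simp add: smult_zero zero_mor_closed)

lemma form_diff_left:
  assumes "f \<in> mor C P S" "g \<in> mor C P S"
  shows "form (f \<ominus>\<^bsub>Hom C P S\<^esub> g) h = form f h - form g h"
  using form_add_left[OF diff_mor_closed[OF assms] assms(2), of h]
  by (simp add: diff_add_cancel[OF assms])

lemma form_add_right:
  "\<lbrakk>f \<in> mor C P S; g \<in> mor C P S\<rbrakk> \<Longrightarrow> form h (f \<oplus>\<^bsub>Hom C P S\<^esub> g) = form h f + form h g"
  by (subst (1 2 3) form_cnj) (simp add: form_add_left)

lemma form_diff_right: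
  "\<lbrakk>f \<in> mor C P S; g \<in> mor C P S\<rbrakk> \<Longrightarrow> form h (f \<ominus>\<^bsub>Hom C P S\<^esub> g) = form h f - form h g"
  by (subst (1 2 3) form_cnj) (simp add: form_diff_left)

lemma form_self: "form f f = of_real (\<Sum>u\<in>U. (cmod (coeff f u))\<^sup>2)"
  by (simp add: basis_form_def complex_norm_square del: of_real_power)

text \<open>
  Stated for two summands because positivity is needed for a sum of two positive operators.
\<close>

lemma form_self_sum_eq_zeroD:
  assumes f: "f \<in> mor C P S" and eq: "form f f + form g g = 0"
  shows "f = zero_mor P S"
proof -
  have "(\<Sum>u\<in>U. (cmod (coeff f u))\<^sup>2) + (\<Sum>u\<in>U. (cmod (coeff g u))\<^sup>2) = 0"
    using eq unfolding form_self of_real_add[symmetric] of_real_eq_0_iff .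
  then have "(\<Sum>u\<in>U. (cmod (coeff f u))\<^sup>2) = 0"
    using sum_nonneg[of U "\<lambda>u. (cmod (coeff f u))\<^sup>2"] sum_nonneg[of U "\<lambda>u. (cmod (coeff g u))\<^sup>2"] by simp
  then have "coeff f u = 0" if "u \<in> U" for u
    using that finite_basis by (simp add: sum_nonneg_eq_0_iff)
  then have "(\<Oplus>\<^bsub>Hom C P S\<^esub>u\<in>U. coeff f u \<odot>\<^bsub>Hom C P S\<^esub> u) = zero_mor P S"
    using src_ob tgt_ob basis_mor by (intro finsum_mor_zero) (auto simp: smult_zero)
  with coeff_coords(2)[OF f] show ?thesis by simp
qed

lemma form_self_eq_zeroD: "\<lbrakk>f \<in> mor C P S; form f f = 0\<rbrakk> \<Longrightarrow> f = zero_mor P S"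
  using form_self_sum_eq_zeroD[of f "zero_mor P S"] by (simp add: form_zero_left)

lemma form_right_cancel:
  assumes "h \<in> mor C P S" "h' \<in> mor C P S" and eq: "\<And>f. f \<in> mor C P S \<Longrightarrow> form f h = form f h'"
  shows "h = h'"
proof -
  have "form (h \<ominus>\<^bsub>Hom C P S\<^esub> h') (h \<ominus>\<^bsub>Hom C P S\<^esub> h') = 0"
    using assms by (simp add: form_diff_right diff_mor_closed)
  then show ?thesis
    using form_self_eq_zeroD[OF diff_mor_closed[OF assms(1,2)]] diff_eq_0_iff[OF assms(1,2)] by simp
qed

text \<open>
  The Riesz representation of a linear functional by its conjugated values on the orthonormal basis.
\<close>

lemma form_represents:
  assumes add: "\<And>f g. \<lbrakk>f \<in> mor C P S; g \<in> mor C P S\<rbrakk> \<Longrightarrow> \<phi> (f \<oplus>\<^bsub>Hom C P S\<^esub> g) = \<phi> f + \<phi> g"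
    and smult: "\<And>z f. f \<in> mor C P S \<Longrightarrow> \<phi> (z \<odot>\<^bsub>Hom C P S\<^esub> f) = z * \<phi> f"
  shows "\<exists>h\<in>mor C P S. \<forall>f\<in>mor C P S. form f h = \<phi> f"
proof -
  define c where "c u = (if u \<in> U then cnj (\<phi> u) else 0)" for u
  define h where "h = (\<Oplus>\<^bsub>Hom C P S\<^esub>u\<in>U. c u \<odot>\<^bsub>Hom C P S\<^esub> u)"
  have h: "h \<in> mor C P S"
    unfolding h_def using src_ob tgt_ob basis_mor by (intro finsum_mor_closed smult_mor_closed)
  have ch: "coeff h = c"
    by (rule coeff_eqI) (auto simp: h_def c_def)
  have "form f h = \<phi> f" if f: "f \<in> mor C P S" for f
  proof -
    have "\<phi> (zero_mor P S) = 0"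
      using smult[OF zero_mor_closed[OF src_ob tgt_ob], of 0] src_ob tgt_ob by (simp add: smult_zero zero_mor_closed)
    then have "\<phi> (\<Oplus>\<^bsub>Hom C P S\<^esub>u\<in>U. coeff f u \<odot>\<^bsub>Hom C P S\<^esub> u) = (\<Sum>u\<in>U. \<phi> (coeff f u \<odot>\<^bsub>Hom C P S\<^esub> u))"
      using src_ob tgt_ob finite_basis basis_mor smult_mor_closed by (intro additive_finsum_complex add) auto
    also have "\<dots> = (\<Sum>u\<in>U. coeff f u * cnj (c u))"
      using basis_mor by (intro sum.cong) (auto simp: smult c_def)
    finally show ?thesis
      using coeff_coords(2)[OF f] by (simp add: basis_form_def ch)
  qed
  with h show ?thesis by blast
qed

end

section \<open>Semisimple objects\<close>

context linear_category
begin

lemma assoc_middle: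
  assumes f: "f \<in> mor C A B" and g: "g \<in> mor C B D" and h: "h \<in> mor C D E" and k: "k \<in> mor C E F"
  shows "(k \<cdot> h) \<cdot> g \<cdot> f = k \<cdot> (h \<cdot> g) \<cdot> f"
  using comp_assoc[OF comp_closed[OF f g] h k] comp_assoc[OF f g h] by simp

lemma monoD:
  assumes "is_mono f" "f \<in> mor C A B" "g \<in> mor C Z A" "h \<in> mor C Z A" "f \<cdot> g = f \<cdot> h"
  shows "g = h"
  using assms by (auto simp: is_mono_def mor_iff)

lemma kernelD:
  assumes "is_kernel k f" and "f \<in> mor C A B"
  shows "k \<in> mor C (src C k) A" and "f \<cdot> k = zero_mor (src C k) B"
    and "\<And>Z g. \<lbrakk>g \<in> mor C Z A; f \<cdot> g = zero_mor Z B\<rbrakk> \<Longrightarrow> \<exists>h\<in>mor C Z (src C k). k \<cdot> h = g"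
proof -
  have "src C f = A" "tgt C f = B"
    using assms(2) by (auto simp: mor_iff)
  then show "k \<in> mor C (src C k) A" and "f \<cdot> k = zero_mor (src C k) B"
    and "\<And>Z g. \<lbrakk>g \<in> mor C Z A; f \<cdot> g = zero_mor Z B\<rbrakk> \<Longrightarrow> \<exists>h\<in>mor C Z (src C k). k \<cdot> h = g"
    using assms(1) unfolding is_kernel_def by blast+
qed

lemma kernel_mono:
  assumes k: "is_kernel k f" and f: "f \<in> mor C A B"
  shows "is_mono k"
  unfolding is_mono_def
proof (intro conjI allI ballI impI)
  note k_mor = kernelD(1)[OF k f]
  have tgt: "tgt C k = A"
    using k_mor by (simp add: mor_iff)
  show "k \<in> mor C (src C k) (tgt C k)"
    using k_mor tgt by simp
  fix Z g h assume g: "g \<in> mor C Z (src C k)" and h: "h \<in> mor C Z (src C k)" and eq: "k \<cdot> g = k \<cdot> h"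
  have "f \<cdot> k \<cdot> g = zero_mor Z B"
    using comp_assoc[OF g k_mor f] kernelD(2)[OF k f] comp_zero_left[OF g] mor_obD[OF f] by simp
  moreover have "k \<cdot> g \<in> mor C Z A"
    using g k_mor by (rule comp_closed)
  moreover have "src C f = A" "tgt C f = B"
    using f by (auto simp: mor_iff)
  ultimately have "\<exists>!x. x \<in> mor C Z (src C k) \<and> k \<cdot> x = k \<cdot> g"
    using k unfolding is_kernel_def by blast
  with g h eq show "g = h" by metis
qed

lemma zero_ob_mor:
  assumes "is_zero_ob Z" and "f \<in> mor C A Z"
  shows "f = zero_mor A Z"
proof -
  have "\<exists>!f. f \<in> mor C A Z" "zero_mor A Z \<in> mor C A Z"
    using assms mor_obD[OF assms(2)] by (auto simp: is_zero_ob_def zero_mor_closed)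
  with assms(2) show ?thesis by blast
qed

lemma simple_id:
  assumes "simple S"
  shows "S \<in> Ob C" "idm S \<noteq> zero_mor S S"
proof -
  show S: "S \<in> Ob C"
    using assms by (simp add: simple_def)
  show "idm S \<noteq> zero_mor S S"
  proof
    assume id: "idm S = zero_mor S S"
    have "f = zero_mor A S" if "f \<in> mor C A S" for f A
      using comp_id_left[OF that] comp_zero_left[OF that S] id by simp
    moreover have "f = zero_mor S A" if "f \<in> mor C S A" for f A
      using comp_id_right[OF that] comp_zero_right[OF that S] id by simp
    ultimately have "is_zero_ob S"
      unfolding is_zero_ob_def using S zero_mor_closed by blast
    with assms show False
      by (simp add: simple_def)
  qed
qed

end

context abelian_category
begin

text \<open>
  The image of \<open>b\<close> is the kernel of \<open>1 - b\<close>.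
\<close>

lemma idempotent_splits:
  assumes b: "b \<in> mor C P P" and idem: "b \<cdot> b = b"
  shows "\<exists>A i p. i \<in> mor C A P \<and> p \<in> mor C P A \<and> p \<cdot> i = idm A \<and> i \<cdot> p = b"
proof -
  have P: "P \<in> Ob C" and id: "idm P \<in> mor C P P"
    using b mor_obD id_mor_closed by auto
  define f where "f = idm P \<ominus>\<^bsub>Hom C P P\<^esub> b"
  have f: "f \<in> mor C P P"
    unfolding f_def using id b by (rule diff_mor_closed)
  obtain i where i: "is_kernel i f"
    using ex_kernel[OF f] by blast
  let ?A = "src C i"
  note i_mor = kernelD(1)[OF i f]
  have "f \<cdot> b = zero_mor P P"
    by (simp add: f_def comp_diff_left[OF b id b] comp_id_left[OF b] idem diff_self[OF b])
  then obtain p where p: "p \<in> mor C P ?A" and ip: "i \<cdot> p = b"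
    using kernelD(3)[OF i f b] by blast
  have "b \<cdot> i = i"
  proof -
    have "f \<cdot> i = i \<ominus>\<^bsub>Hom C ?A P\<^esub> (b \<cdot> i)"
      by (simp add: f_def comp_diff_left[OF i_mor id b] comp_id_left[OF i_mor])
    then show ?thesis
      using kernelD(2)[OF i f] diff_eq_0_iff[OF i_mor comp_closed[OF i_mor b]] by simp
  qed
  then have "i \<cdot> p \<cdot> i = i \<cdot> idm ?A"
    using comp_assoc[OF i_mor p i_mor] comp_id_right[OF i_mor] ip by simp
  then have "p \<cdot> i = idm ?A"
    using monoD[OF kernel_mono[OF i f] i_mor comp_closed[OF i_mor p] id_mor_closed] mor_obD[OF i_mor]
    by blast
  with i_mor p ip show ?thesis by blast
qed

text \<open>
  The kernel of \<open>f\<close> is a subobject of \<open>S\<close>, and it is not all of \<open>S\<close>. Hence it is zero and \<open>f\<close> is a nonzero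
  subobject of \<open>T\<close>.
\<close>

lemma simple_mor_iso:
  assumes S: "simple S" and T: "simple T" and f: "f \<in> mor C S T" and nz: "f \<noteq> zero_mor S T"
  shows "is_iso f"
proof -
  obtain k where k: "is_kernel k f"
    using ex_kernel[OF f] by blast
  note k_mor = kernelD(1)[OF k f]
  let ?K = "src C k"
  have "tgt C k = S"
    using k_mor by (simp add: mor_iff)
  with S kernel_mono[OF k f] have "is_zero_ob ?K \<or> is_iso k"
    by (simp add: simple_def)
  moreover have "\<not> is_iso k"
  proof
    assume "is_iso k"
    then obtain h where h: "h \<in> mor C S ?K" "k \<cdot> h = idm S"
      using \<open>tgt C k = S\<close> by (auto simp: is_iso_def)
    have "f = (f \<cdot> k) \<cdot> h"
      using comp_assoc[OF h(1) k_mor f] h(2) comp_id_right[OF f] by simp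
    then have "f = zero_mor S T"
      using kernelD(2)[OF k f] comp_zero_left[OF h(1)] mor_obD[OF f] by simp
    with nz show False ..
  qed
  ultimately have zero: "is_zero_ob ?K" by blast
  have "g = h" if g: "g \<in> mor C Z S" and h: "h \<in> mor C Z S" and eq: "f \<cdot> g = f \<cdot> h" for Z g h
  proof -
    have "f \<cdot> (g \<ominus>\<^bsub>Hom C Z S\<^esub> h) = zero_mor Z T"
      using comp_diff_right[OF g h f] eq diff_self[OF comp_closed[OF h f]] by simp
    then obtain x where x: "x \<in> mor C Z ?K" "k \<cdot> x = g \<ominus>\<^bsub>Hom C Z S\<^esub> h"
      using kernelD(3)[OF k f diff_mor_closed[OF g h]] by blast
    have "k \<cdot> x = zero_mor Z S"
      using zero_ob_mor[OF zero x(1)] comp_zero_right[OF k_mor] mor_obD[OF g] by simp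
    with x(2) show "g = h"
      using diff_eq_0_iff[OF g h] by simp
  qed
  then have "is_mono f"
    using f by (auto simp: is_mono_def mor_iff)
  then have "is_zero_ob S \<or> is_iso f"
    using T f by (auto simp: simple_def mor_iff)
  with S show ?thesis
    by (simp add: simple_def)
qed

text \<open>
  Each summand is replaced by the representative isomorphic to it, so that isomorphic summands become
  equal.
\<close>

lemma semisimple_decomposition:
  assumes P: "semisimple P" and R: "simple_representatives R"
  shows "\<exists>(n::nat) T j e. P \<in> Ob C \<and>
    (\<forall>k<n. T k \<in> R \<and> j k \<in> mor C (T k) P \<and> e k \<in> mor C P (T k)) \<and>
    (\<Oplus>\<^bsub>Hom C P P\<^esub>k\<in>{..<n}. j k \<cdot> e k) = idm P"
proof -
  obtain n S i p where sum: "direct_sum P n S i p" and S: "\<And>k. k < n \<Longrightarrow> simple (S k)"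
    using P by (auto simp: semisimple_def)
  have P: "P \<in> Ob C" and i: "\<And>k. k < n \<Longrightarrow> i k \<in> mor C (S k) P"
    and p: "\<And>k. k < n \<Longrightarrow> p k \<in> mor C P (S k)"
    and id: "(\<Oplus>\<^bsub>Hom C P P\<^esub>k\<in>{..<n}. i k \<cdot> p k) = idm P"
    using sum by (auto simp: direct_sum_def)
  have "\<forall>k. \<exists>x. k < n \<longrightarrow> fst x \<in> R \<and> fst (snd x) \<in> mor C (fst x) P \<and>
    snd (snd x) \<in> mor C P (fst x) \<and> fst (snd x) \<cdot> snd (snd x) = i k \<cdot> p k"
  proof
    fix k show "\<exists>x. k < n \<longrightarrow> fst x \<in> R \<and> fst (snd x) \<in> mor C (fst x) P \<and>
      snd (snd x) \<in> mor C P (fst x) \<and> fst (snd x) \<cdot> snd (snd x) = i k \<cdot> p k"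
    proof (cases "k < n")
      case k: True
      then obtain T where T: "T \<in> R" "isomorphic T (S k)"
        using R S unfolding simple_representatives_def by blast
      then obtain t where t: "t \<in> mor C T (S k)" "is_iso t"
        by (auto simp: isomorphic_def)
      moreover from t have "src C t = T" "tgt C t = S k"
        by (auto simp: mor_iff)
      ultimately obtain s where s: "s \<in> mor C (S k) T" "t \<cdot> s = idm (S k)"
        unfolding is_iso_def by auto
      have "(i k \<cdot> t) \<cdot> s \<cdot> p k = i k \<cdot> (t \<cdot> s) \<cdot> p k"
        using p[OF k] s(1) t(1) i[OF k] by (rule assoc_middle)
      also have "\<dots> = i k \<cdot> p k"
        by (simp add: s(2) comp_id_left[OF p[OF k]])
      finally show ?thesis
        using T(1) comp_closed[OF t(1) i[OF k]] comp_closed[OF p[OF k] s(1)]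
        by (intro exI[of _ "(T, i k \<cdot> t, s \<cdot> p k)"]) simp
    qed simp
  qed
  from choice[OF this] obtain x where "\<forall>k. k < n \<longrightarrow> fst (x k) \<in> R \<and>
    fst (snd (x k)) \<in> mor C (fst (x k)) P \<and> snd (snd (x k)) \<in> mor C P (fst (x k)) \<and>
    fst (snd (x k)) \<cdot> snd (snd (x k)) = i k \<cdot> p k" ..
  then have x: "\<And>k. k < n \<Longrightarrow> fst (x k) \<in> R"
    "\<And>k. k < n \<Longrightarrow> fst (snd (x k)) \<in> mor C (fst (x k)) P"
    "\<And>k. k < n \<Longrightarrow> snd (snd (x k)) \<in> mor C P (fst (x k))"
    "\<And>k. k < n \<Longrightarrow> fst (snd (x k)) \<cdot> snd (snd (x k)) = i k \<cdot> p k"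
    by simp_all
  have "(\<Oplus>\<^bsub>Hom C P P\<^esub>k\<in>{..<n}. fst (snd (x k)) \<cdot> snd (snd (x k)))
      = (\<Oplus>\<^bsub>Hom C P P\<^esub>k\<in>{..<n}. i k \<cdot> p k)"
  proof (rule finsum_mor_cong[OF P P refl])
    fix k assume "k \<in> {..<n}"
    then have k: "k < n" by simp
    show "fst (snd (x k)) \<cdot> snd (snd (x k)) = i k \<cdot> p k" "i k \<cdot> p k \<in> mor C P P"
      using x(4)[OF k] comp_closed[OF p[OF k] i[OF k]] .
  qed
  with id have sum: "(\<Oplus>\<^bsub>Hom C P P\<^esub>k\<in>{..<n}. fst (snd (x k)) \<cdot> snd (snd (x k))) = idm P"
    by (rule trans[rotated])
  show ?thesis
    by (rule exI[of _ n], rule exI[of _ "\<lambda>k. fst (x k)"], rule exI[of _ "\<lambda>k. fst (snd (x k))"],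
        rule exI[of _ "\<lambda>k. snd (snd (x k))"]) (simp add: x(1-3) P sum)
qed

end

section \<open>Polynomials in an endomorphism\<close>

context linear_category
begin

inductive endo_poly :: "'o \<Rightarrow> 'm \<Rightarrow> 'm \<Rightarrow> bool" for P N where
  one: "endo_poly P N (idm P)"
| add: "\<lbrakk>endo_poly P N x; endo_poly P N y\<rbrakk> \<Longrightarrow> endo_poly P N (x \<oplus>\<^bsub>Hom C P P\<^esub> y)"
| smult: "endo_poly P N x \<Longrightarrow> endo_poly P N (z \<odot>\<^bsub>Hom C P P\<^esub> x)"
| mult: "endo_poly P N x \<Longrightarrow> endo_poly P N (N \<cdot> x)"

lemma endo_poly_comm:
  assumes "endo_poly P N x" and N: "N \<in> mor C P P"
  shows "x \<in> mor C P P \<and> x \<cdot> N = N \<cdot> x"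
  using assms(1)
proof induction
  case one
  then show ?case
    using N mor_obD id_mor_closed by (auto simp: comp_id_left comp_id_right)
next
  case (add x y)
  then show ?case
    using N by (simp add: add_mor_closed comp_add_left[OF N] comp_add_right[OF _ _ N])
next
  case (smult x z)
  then show ?case
    using N by (simp add: smult_mor_closed comp_smult_left[OF N] comp_smult_right[OF _ N])
next
  case (mult x)
  then show ?case
    using N comp_closed comp_assoc[OF N _ N, of x] by auto
qed

lemma add_eq_zero_imp_smult:
  assumes "f \<in> mor C A B" "g \<in> mor C A B" and "f \<oplus>\<^bsub>Hom C A B\<^esub> g = zero_mor A B"
  shows "f = (-1) \<odot>\<^bsub>Hom C A B\<^esub> g"
proof -
  note g = smult_mor_closed[OF assms(2), of "-1"]
  have "((-1) \<odot>\<^bsub>Hom C A B\<^esub> g) \<oplus>\<^bsub>Hom C A B\<^esub> g = zero_mor A B"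
    using smult_add[OF assms(2), of "-1" 1] assms(2) by (simp add: smult_zero smult_one)
  then show ?thesis
    using eq_diffI[OF assms(1,2) zero_mor_closed assms(3)] eq_diffI[OF g assms(2) zero_mor_closed] mor_obD[OF g]
    by simp
qed

lemma diff_conv_add:
  assumes "f \<in> mor C A B" "g \<in> mor C A B"
  shows "f \<ominus>\<^bsub>Hom C A B\<^esub> g = f \<oplus>\<^bsub>Hom C A B\<^esub> ((-1) \<odot>\<^bsub>Hom C A B\<^esub> g)"
proof -
  interpret abelian_group "Hom C A B"
    using assms(1) by (intro Hom_abelian_group mor_obD)
  have "\<ominus>\<^bsub>Hom C A B\<^esub> g = (-1) \<odot>\<^bsub>Hom C A B\<^esub> g"
    using assms by (intro add_eq_zero_imp_smult) (auto simp: mor_def l_neg)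
  then show ?thesis
    by (simp add: minus_eq)
qed

text \<open>
  If multiplication by \<open>N\<close> can be cancelled on its own image, then a polynomial relation of \<open>N\<close>
  can be divided by a power of \<open>N\<close> until it has the form \<open>N \<cdot> (c + N \<cdot> q(N)) = 0\<close> with \<open>c \<noteq> 0\<close>.
  So \<open>N\<close> is invertible on its image, by a polynomial in \<open>N\<close>.
\<close>

lemma poly_group_inverse:
  assumes N: "N \<in> mor C P P" and fin: "fin_dim P P"
    and cancel: "\<And>x. \<lbrakk>endo_poly P N x; N \<cdot> N \<cdot> x = zero_mor P P\<rbrakk> \<Longrightarrow> N \<cdot> x = zero_mor P P"
  shows "\<exists>Y. endo_poly P N Y \<and> N \<cdot> N \<cdot> Y = N"
proof -
  have P: "P \<in> Ob C"
    using mor_obD[OF N] by simp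
  define pow where "pow k = ((\<lambda>x. N \<cdot> x) ^^ k) (idm P)" for k
  have pow_poly: "endo_poly P N (pow k)" for k
    by (induction k) (auto simp: pow_def intro: endo_poly.intros)
  have poly_mor: "x \<in> mor C P P" if "endo_poly P N x" for x
    using endo_poly_comm[OF that N] by simp
  have zero: "endo_poly P N (zero_mor P P)"
    using endo_poly.smult[OF endo_poly.one, of P N 0] P by (simp add: smult_zero id_mor_closed)
  define val where "val c d = (\<Oplus>\<^bsub>Hom C P P\<^esub>k\<in>{..d}. c k \<odot>\<^bsub>Hom C P P\<^esub> pow k)" for c d
  interpret abelian_group "Hom C P P"
    using P P by (rule Hom_abelian_group)
  have carrier: "x \<in> carrier (Hom C P P)" if "x \<in> mor C P P" for x
    using that by (simp add: mor_def)
  have terms: "c k \<odot>\<^bsub>Hom C P P\<^esub> pow k \<in> mor C P P" for c k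
    by (intro smult_mor_closed poly_mor pow_poly)
  have val_0: "val c 0 = c 0 \<odot>\<^bsub>Hom C P P\<^esub> idm P" for c
    unfolding val_def using terms[of c 0] by (subst finsum_0) (auto simp: pow_def carrier)
  have val_Suc: "val c (Suc d) = (N \<cdot> val (\<lambda>k. c (Suc k)) d) \<oplus>\<^bsub>Hom C P P\<^esub> c 0 \<odot>\<^bsub>Hom C P P\<^esub> idm P" for c d
  proof -
    have "val c (Suc d) = (\<Oplus>\<^bsub>Hom C P P\<^esub>k\<in>{..d}. c (Suc k) \<odot>\<^bsub>Hom C P P\<^esub> pow (Suc k)) \<oplus>\<^bsub>Hom C P P\<^esub> c 0 \<odot>\<^bsub>Hom C P P\<^esub> pow 0"
      unfolding val_def using terms carrier by (intro finsum_Suc2) auto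
    also have "(\<Oplus>\<^bsub>Hom C P P\<^esub>k\<in>{..d}. c (Suc k) \<odot>\<^bsub>Hom C P P\<^esub> pow (Suc k))
        = (\<Oplus>\<^bsub>Hom C P P\<^esub>k\<in>{..d}. N \<cdot> (c (Suc k) \<odot>\<^bsub>Hom C P P\<^esub> pow k))"
      using P comp_closed[OF terms N] comp_smult_right[OF poly_mor[OF pow_poly] N]
      by (intro finsum_mor_cong) (auto simp: pow_def)
    also have "\<dots> = N \<cdot> val (\<lambda>k. c (Suc k)) d"
      unfolding val_def using P N terms[of "\<lambda>k. c (Suc k)"] by (intro comp_finsum_right[symmetric]) auto
    finally show ?thesis
      by (simp add: pow_def)
  qed
  have val_poly: "endo_poly P N (val c d)" for c d
  proof (induction d arbitrary: c)
    case 0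
    then show ?case by (simp add: val_0 endo_poly.intros)
  next
    case (Suc d)
    then show ?case by (simp add: val_Suc endo_poly.intros)
  qed
  \<comment> \<open>Induction on the degree: a relation without constant term is divided by \<open>N\<close>.\<close>
  have step: "\<exists>Y. endo_poly P N Y \<and> N \<cdot> N \<cdot> Y = N"
    if "\<exists>k\<le>d. c k \<noteq> 0" "N \<cdot> val c d = zero_mor P P" for c d
    using that
  proof (induction d arbitrary: c)
    case 0
    then have "c 0 \<odot>\<^bsub>Hom C P P\<^esub> N = zero_mor P P"
      using N comp_smult_right[OF id_mor_closed[OF P] N] by (simp add: val_0 comp_id_right)
    then have "inverse (c 0) \<odot>\<^bsub>Hom C P P\<^esub> (c 0 \<odot>\<^bsub>Hom C P P\<^esub> N) = zero_mor P P"
      by (simp add: smult_0_mor P)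
    with 0 have "N = zero_mor P P"
      by (simp add: smult_assoc[OF N] smult_one[OF N])
    then show ?case
      using comp_zero_right[OF N P] endo_poly.one[of P N] comp_id_right[OF N] by metis
  next
    case (Suc d)
    define q where "q = val (\<lambda>k. c (Suc k)) d"
    have q: "endo_poly P N q" "q \<in> mor C P P" "N \<cdot> q \<in> mor C P P" "N \<cdot> N \<cdot> q \<in> mor C P P"
      using val_poly poly_mor endo_poly.mult by (auto simp: q_def)
    have rel: "(N \<cdot> N \<cdot> q) \<oplus>\<^bsub>Hom C P P\<^esub> c 0 \<odot>\<^bsub>Hom C P P\<^esub> N = zero_mor P P"
      using Suc.prems(2) comp_add_right[OF q(3) smult_mor_closed[OF id_mor_closed[OF P]] N]
        comp_smult_right[OF id_mor_closed[OF P] N] comp_id_right[OF N]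
      by (simp add: val_Suc q_def[symmetric])
    show ?case
    proof (cases "c 0 = 0")
      case True
      then have "N \<cdot> N \<cdot> q = zero_mor P P"
        using rel q(4) by (simp add: smult_zero[OF N] carrier)
      then have "N \<cdot> val (\<lambda>k. c (Suc k)) d = zero_mor P P"
        using cancel[OF q(1)] by (simp add: q_def)
      moreover have "\<exists>k\<le>d. c (Suc k) \<noteq> 0"
        using Suc.prems(1) True by (metis Suc_le_mono not0_implies_Suc)
      ultimately show ?thesis
        by (intro Suc.IH[of "\<lambda>k. c (Suc k)"]) auto
    next
      case False
      have "N \<cdot> N \<cdot> q = (-1) \<odot>\<^bsub>Hom C P P\<^esub> (c 0 \<odot>\<^bsub>Hom C P P\<^esub> N)"
        using rel q(4) N by (intro add_eq_zero_imp_smult smult_mor_closed)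
      then have "(- inverse (c 0)) \<odot>\<^bsub>Hom C P P\<^esub> (N \<cdot> N \<cdot> q) = N"
        using False N by (simp add: smult_assoc smult_one)
      then have "N \<cdot> N \<cdot> ((- inverse (c 0)) \<odot>\<^bsub>Hom C P P\<^esub> q) = N"
        using comp_smult_right[OF q(2) N] comp_smult_right[OF q(3) N] by simp
      with q(1) show ?thesis
        using endo_poly.smult by blast
    qed
  qed
  obtain d c k where "k \<le> d" "c k \<noteq> 0" "val c d = zero_mor P P"
    unfolding val_def by (rule hom_dependency[OF fin poly_mor[OF pow_poly]])
  then show ?thesis
    using step[of d c] comp_zero_right[OF N P] by auto
qed

end

section \<open>Self-adjoint endomorphisms of a semisimple object\<close>

locale semisimple_object = abelian_category C for C :: "('o, 'm) moncat" (structure) +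
  fixes P :: 'o and R :: "'o set" and \<B> :: "'o \<Rightarrow> 'm set"
    and n :: nat and T :: "nat \<Rightarrow> 'o" and j e :: "nat \<Rightarrow> 'm"
  assumes schur: "\<And>S f. simple S \<Longrightarrow> f \<in> mor C S S \<Longrightarrow> \<exists>z. f = z \<odot>\<^bsub>Hom C S S\<^esub> idm S"
    and object_basis: "basis_of_object P R \<B>"
    and P: "P \<in> Ob C"
    and summand_rep: "\<And>k. k < n \<Longrightarrow> T k \<in> R"
    and j_mor: "\<And>k. k < n \<Longrightarrow> j k \<in> mor C (T k) P"
    and e_mor: "\<And>k. k < n \<Longrightarrow> e k \<in> mor C P (T k)"
    and sum_id: "(\<Oplus>\<^bsub>Hom C P P\<^esub>k\<in>{..<n}. j k \<cdot> e k) = idm P"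
begin

lemma reps: "simple_representatives R"
  using object_basis by (simp add: basis_of_object_def)

lemma rep_simple: "S \<in> R \<Longrightarrow> simple S"
  using reps by (simp add: simple_representatives_def)

lemma rep_ob: "S \<in> R \<Longrightarrow> S \<in> Ob C"
  using simple_id(1)[OF rep_simple] .

text \<open>
  A nonzero morphism would be an isomorphism between two different representatives.
\<close>

lemma reps_no_mor:
  assumes "S \<in> R" "S' \<in> R" "S \<noteq> S'" and f: "f \<in> mor C S S'"
  shows "f = zero_mor S S'"
proof (rule ccontr)
  assume "f \<noteq> zero_mor S S'"
  then have "isomorphic S S'"
    using simple_mor_iso[OF rep_simple rep_simple f] assms(1,2) f by (auto simp: isomorphic_def)
  moreover have "isomorphic S' S'"
  proof -
    have id: "idm S' \<in> mor C S' S'"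
      using assms(2) by (intro id_mor_closed rep_ob)
    then have "src C (idm S') = S'" "tgt C (idm S') = S'" "idm S' \<cdot> idm S' = idm S'"
      using comp_id_left[OF id] by (auto simp: mor_iff)
    with id show ?thesis
      by (auto simp: isomorphic_def is_iso_def intro!: bexI[of _ "idm S'"])
  qed
  moreover have "\<exists>!U. U \<in> R \<and> isomorphic U S'"
    using reps rep_simple[OF assms(2)] by (simp add: simple_representatives_def)
  ultimately show False
    using assms(1-3) by blast
qed

definition scalar :: "'o \<Rightarrow> 'm \<Rightarrow> complex" where
  "scalar S f = (THE z. f = z \<odot>\<^bsub>Hom C S S\<^esub> idm S)"

lemma scalar_eqI:
  assumes "S \<in> R" and "f = z \<odot>\<^bsub>Hom C S S\<^esub> idm S"
  shows "scalar S f = z"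
  unfolding scalar_def
  using assms smult_cancel[OF id_mor_closed simple_id(2)[OF rep_simple]] rep_ob
  by (intro the_equality) auto

lemma scalar_smult_id:
  assumes "S \<in> R" and "f \<in> mor C S S"
  shows "scalar S f \<odot>\<^bsub>Hom C S S\<^esub> idm S = f"
  using schur[OF rep_simple[OF assms(1)] assms(2)] scalar_eqI[OF assms(1)] by auto

lemma scalar_add:
  assumes S: "S \<in> R" and "f \<in> mor C S S" "g \<in> mor C S S"
  shows "scalar S (f \<oplus>\<^bsub>Hom C S S\<^esub> g) = scalar S f + scalar S g"
  using assms scalar_smult_id[OF S] by (intro scalar_eqI) (simp_all add: smult_add id_mor_closed rep_ob)

lemma scalar_smult:
  assumes S: "S \<in> R" and "f \<in> mor C S S"
  shows "scalar S (z \<odot>\<^bsub>Hom C S S\<^esub> f) = z * scalar S f"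
  using assms scalar_smult_id[OF S] by (intro scalar_eqI) (simp_all add: smult_assoc[symmetric] id_mor_closed rep_ob)

lemma scalar_zero: "S \<in> R \<Longrightarrow> scalar S (zero_mor S S) = 0"
  by (rule scalar_eqI) (simp_all add: smult_zero id_mor_closed rep_ob)

lemma scalar_zeroD: "\<lbrakk>S \<in> R; f \<in> mor C S S; scalar S f = 0\<rbrakk> \<Longrightarrow> f = zero_mor S S"
  using scalar_smult_id[of S f] by (simp add: smult_zero id_mor_closed rep_ob)

lemma mor_from_eq_sum:
  assumes "f \<in> mor C P Z"
  shows "f = (\<Oplus>\<^bsub>Hom C P Z\<^esub>k\<in>{..<n}. (f \<cdot> j k) \<cdot> e k)"
proof -
  have "f = f \<cdot> (\<Oplus>\<^bsub>Hom C P P\<^esub>k\<in>{..<n}. j k \<cdot> e k)"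
    using assms by (simp add: sum_id comp_id_right)
  also have "\<dots> = (\<Oplus>\<^bsub>Hom C P Z\<^esub>k\<in>{..<n}. f \<cdot> j k \<cdot> e k)"
    using assms P comp_closed[OF e_mor j_mor] by (intro comp_finsum_right) auto
  also have "\<dots> = (\<Oplus>\<^bsub>Hom C P Z\<^esub>k\<in>{..<n}. (f \<cdot> j k) \<cdot> e k)"
    using assms P mor_obD[OF assms] comp_closed[OF e_mor comp_closed[OF j_mor assms]] comp_assoc[OF e_mor j_mor assms]
    by (intro finsum_mor_cong) auto
  finally show ?thesis .
qed

lemma mor_to_eq_sum:
  assumes "y \<in> mor C Z P"
  shows "y = (\<Oplus>\<^bsub>Hom C Z P\<^esub>k\<in>{..<n}. j k \<cdot> e k \<cdot> y)"
proof -
  have "y = (\<Oplus>\<^bsub>Hom C P P\<^esub>k\<in>{..<n}. j k \<cdot> e k) \<cdot> y"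
    using assms by (simp add: sum_id comp_id_left)
  also have "\<dots> = (\<Oplus>\<^bsub>Hom C Z P\<^esub>k\<in>{..<n}. (j k \<cdot> e k) \<cdot> y)"
    using assms P comp_closed[OF e_mor j_mor] by (intro comp_finsum_left) auto
  also have "\<dots> = (\<Oplus>\<^bsub>Hom C Z P\<^esub>k\<in>{..<n}. j k \<cdot> e k \<cdot> y)"
    using assms P mor_obD[OF assms] comp_closed[OF comp_closed[OF assms e_mor] j_mor] comp_assoc[OF assms e_mor j_mor]
    by (intro finsum_mor_cong) auto
  finally show ?thesis .
qed

lemma mor_to_zeroI:
  assumes "y \<in> mor C Z P" and "\<And>S f. \<lbrakk>S \<in> R; f \<in> mor C P S\<rbrakk> \<Longrightarrow> f \<cdot> y = zero_mor Z S"
  shows "y = zero_mor Z P"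
proof -
  have "(\<Oplus>\<^bsub>Hom C Z P\<^esub>k\<in>{..<n}. j k \<cdot> e k \<cdot> y) = zero_mor Z P"
    using assms(2)[OF summand_rep e_mor] P mor_obD[OF assms(1)] comp_zero_right[OF j_mor]
    by (intro finsum_mor_zero) auto
  with mor_to_eq_sum[OF assms(1)] show ?thesis by simp
qed

lemma mor_to_eqI:
  assumes y: "y \<in> mor C Z P" and z: "z \<in> mor C Z P" and eq: "\<And>S f. \<lbrakk>S \<in> R; f \<in> mor C P S\<rbrakk> \<Longrightarrow> f \<cdot> y = f \<cdot> z"
  shows "y = z"
proof -
  have "y \<ominus>\<^bsub>Hom C Z P\<^esub> z = zero_mor Z P"
    using comp_diff_right[OF y z] diff_self[OF comp_closed[OF z]] eq
    by (intro mor_to_zeroI diff_mor_closed[OF y z]) simp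
  then show ?thesis
    by (simp add: diff_eq_0_iff[OF y z])
qed

lemma mor_from_zeroI:
  assumes "f \<in> mor C P Z" and "\<And>k. k < n \<Longrightarrow> f \<cdot> j k = zero_mor (T k) Z"
  shows "f = zero_mor P Z"
proof -
  have "(\<Oplus>\<^bsub>Hom C P Z\<^esub>k\<in>{..<n}. (f \<cdot> j k) \<cdot> e k) = zero_mor P Z"
    using assms(2) P mor_obD[OF assms(1)] comp_zero_left[OF e_mor]
    by (intro finsum_mor_zero) auto
  with mor_from_eq_sum[OF assms(1)] show ?thesis by simp
qed

lemma fin_dim_to_simple:
  assumes S: "S \<in> R"
  shows "fin_dim P S"
proof (rule fin_dimI[where d = n and \<Phi> = "\<lambda>k f. if T k = S then scalar S (f \<cdot> j k) else 0"])
  show "P \<in> Ob C" "S \<in> Ob C"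
    using P S rep_ob by auto
  fix k f assume k: "k < n" and f: "f \<in> mor C P S"
  have fj: "f \<cdot> j k \<in> mor C S S" if "T k = S"
    using comp_closed[OF j_mor[OF k] f] that by simp
  show "(if T k = S then scalar S ((z \<odot>\<^bsub>Hom C P S\<^esub> f) \<cdot> j k) else 0)
      = z * (if T k = S then scalar S (f \<cdot> j k) else 0)" for z
    using comp_smult_left[OF j_mor[OF k] f, of z] scalar_smult[OF S] fj by auto
  show "(if T k = S then scalar S ((f \<oplus>\<^bsub>Hom C P S\<^esub> g) \<cdot> j k) else 0)
      = (if T k = S then scalar S (f \<cdot> j k) else 0) + (if T k = S then scalar S (g \<cdot> j k) else 0)"
    if g: "g \<in> mor C P S" for g
  proof (cases "T k = S")
    case True
    then have "g \<cdot> j k \<in> mor C S S"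
      using comp_closed[OF j_mor[OF k] g] by simp
    with True show ?thesis
      using comp_add_left[OF j_mor[OF k] f g] scalar_add[OF S] fj by auto
  qed simp
next
  fix f assume f: "f \<in> mor C P S" and zero: "\<And>k. k < n \<Longrightarrow> (if T k = S then scalar S (f \<cdot> j k) else 0) = 0"
  show "f = zero_mor P S"
  proof (rule mor_from_zeroI[OF f])
    fix k assume k: "k < n"
    have fj: "f \<cdot> j k \<in> mor C (T k) S"
      using comp_closed[OF j_mor[OF k] f] .
    show "f \<cdot> j k = zero_mor (T k) S"
      using zero[OF k] scalar_zeroD[OF S] fj reps_no_mor[OF summand_rep[OF k] S _ fj]
      by (cases "T k = S") auto
  qed
qed

text \<open>
  An endomorphism is determined by its matrix with respect to the decomposition, whose entries are
  scalars or zero by Schur's lemma; the index \<open>i\<close> encodes the matrix position.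
\<close>

lemma fin_dim_endo: "fin_dim P P"
proof (rule fin_dimI[where d = "n * n"
      and \<Phi> = "\<lambda>i f. let k = i div n; l = i mod n in if T k = T l then scalar (T k) (e k \<cdot> f \<cdot> j l) else 0"])
  show "P \<in> Ob C" "P \<in> Ob C"
    by (fact P)+
  have efj: "e k \<cdot> f \<cdot> j l \<in> mor C (T l) (T k)" if "k < n" "l < n" "f \<in> mor C P P" for k l f
    using that comp_closed j_mor e_mor by blast
  fix i f assume i: "i < n * n" and f: "f \<in> mor C P P"
  define k l where "k = i div n" and "l = i mod n"
  have kl: "k < n" "l < n"
    using i by (auto simp: k_def l_def less_mult_imp_div_less) (metis mod_less_divisor mult_0 neq0_conv not_less_zero)
  note fj = comp_closed[OF j_mor[OF kl(2)] f]
  show "(let k = i div n; l = i mod n in if T k = T l then scalar (T k) (e k \<cdot> (z \<odot>\<^bsub>Hom C P P\<^esub> f) \<cdot> j l) else 0)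
      = z * (let k = i div n; l = i mod n in if T k = T l then scalar (T k) (e k \<cdot> f \<cdot> j l) else 0)" for z
    using comp_smult_left[OF j_mor[OF kl(2)] f] comp_smult_right[OF fj e_mor[OF kl(1)]]
      scalar_smult[OF summand_rep[OF kl(2)]] efj[OF kl f]
    by (cases "T k = T l") (simp_all add: k_def[symmetric] l_def[symmetric])
  show "(let k = i div n; l = i mod n in if T k = T l then scalar (T k) (e k \<cdot> (f \<oplus>\<^bsub>Hom C P P\<^esub> g) \<cdot> j l) else 0)
      = (let k = i div n; l = i mod n in if T k = T l then scalar (T k) (e k \<cdot> f \<cdot> j l) else 0)
      + (let k = i div n; l = i mod n in if T k = T l then scalar (T k) (e k \<cdot> g \<cdot> j l) else 0)"
    if g: "g \<in> mor C P P" for g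
    using comp_add_left[OF j_mor[OF kl(2)] f g] comp_add_right[OF fj comp_closed[OF j_mor[OF kl(2)] g] e_mor[OF kl(1)]]
      scalar_add[OF summand_rep[OF kl(2)]] efj[OF kl f] efj[OF kl g]
    by (cases "T k = T l") (simp_all add: k_def[symmetric] l_def[symmetric])
next
  fix f assume f: "f \<in> mor C P P"
    and zero: "\<And>i. i < n * n \<Longrightarrow>
      (let k = i div n; l = i mod n in if T k = T l then scalar (T k) (e k \<cdot> f \<cdot> j l) else 0) = 0"
  have comp_zero: "e k \<cdot> f \<cdot> j l = zero_mor (T l) (T k)" if k: "k < n" and l: "l < n" for k l
  proof -
    have efj: "e k \<cdot> f \<cdot> j l \<in> mor C (T l) (T k)"
      using comp_closed[OF comp_closed[OF j_mor[OF l] f] e_mor[OF k]] .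
    have "k * n + l < n * n"
    proof -
      have "k * n + l < Suc k * n"
        using l by simp
      also have "\<dots> \<le> n * n"
        using k by (intro mult_le_mono) auto
      finally show ?thesis .
    qed
    from zero[OF this] l have "T k = T l \<Longrightarrow> scalar (T k) (e k \<cdot> f \<cdot> j l) = 0"
      by simp
    then show ?thesis
      using scalar_zeroD[OF summand_rep[OF k]] efj reps_no_mor[OF summand_rep[OF l] summand_rep[OF k] _ efj]
      by (cases "T k = T l") auto
  qed
  show "f = zero_mor P P"
  proof (rule mor_from_zeroI[OF f])
    fix l assume l: "l < n"
    have fj: "f \<cdot> j l \<in> mor C (T l) P"
      using comp_closed[OF j_mor[OF l] f] .
    have "(\<Oplus>\<^bsub>Hom C (T l) P\<^esub>k\<in>{..<n}. j k \<cdot> e k \<cdot> f \<cdot> j l) = zero_mor (T l) P"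
      using comp_zero[OF _ l] P mor_obD[OF fj] comp_zero_right[OF j_mor]
      by (intro finsum_mor_zero) auto
    with mor_to_eq_sum[OF fj] show "f \<cdot> j l = zero_mor (T l) P" by simp
  qed
qed

lemma hom_basis_rep:
  assumes "S \<in> R"
  shows "finite_hom_basis C P S (\<B> S)"
proof unfold_locales
  show "P \<in> Ob C" "S \<in> Ob C" "hom_basis P S (\<B> S)"
    using P rep_ob object_basis assms by (auto simp: basis_of_object_def)
  then show "finite (\<B> S)"
    using hom_basis_finite fin_dim_to_simple[OF assms] by blast
qed

abbreviation hform :: "'o \<Rightarrow> 'm \<Rightarrow> 'm \<Rightarrow> complex" where
  "hform S \<equiv> basis_form P S (\<B> S)"

text \<open>
  This makes the map \<open>M'\<close> onto. The morphism \<open>t\<close> combines the inclusions of the summands isomorphic to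
  \<open>S\<close>, weighted by the values of the functional \<open>\<langle>\<cdot>, h\<rangle>\<close> at the corresponding projections; these span
  \<open>Hom(P,S)\<close>.
\<close>

lemma form_represented_by_mor:
  assumes S: "S \<in> R" and h: "h \<in> mor C P S"
  shows "\<exists>t\<in>mor C S P. \<forall>f\<in>mor C P S. scalar S (f \<cdot> t) = hform S f h"
proof -
  interpret finite_hom_basis C P S "\<B> S"
    by (rule hom_basis_rep[OF S])
  define K where "K = {k. k < n \<and> T k = S}"
  have K: "finite K" "\<And>k. k \<in> K \<Longrightarrow> j k \<in> mor C S P" "\<And>k. k \<in> K \<Longrightarrow> e k \<in> mor C P S"
    using j_mor e_mor by (auto simp: K_def)
  define t where "t = (\<Oplus>\<^bsub>Hom C S P\<^esub>k\<in>K. hform S (e k) h \<odot>\<^bsub>Hom C S P\<^esub> j k)"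
  have t: "t \<in> mor C S P"
    unfolding t_def using K P rep_ob[OF S] by (intro finsum_mor_closed smult_mor_closed)
  have "scalar S (f \<cdot> t) = hform S f h" if f: "f \<in> mor C P S" for f
  proof -
    have fj: "f \<cdot> j k \<in> mor C S S" if "k \<in> K" for k
      using comp_closed[OF K(2)[OF that] f] .
    have "f \<cdot> t = (\<Oplus>\<^bsub>Hom C S S\<^esub>k\<in>K. f \<cdot> (hform S (e k) h \<odot>\<^bsub>Hom C S P\<^esub> j k))"
      unfolding t_def using f K rep_ob[OF S] smult_mor_closed by (intro comp_finsum_right) auto
    also have "\<dots> = (\<Oplus>\<^bsub>Hom C S S\<^esub>k\<in>K. hform S (e k) h \<odot>\<^bsub>Hom C S S\<^esub> (f \<cdot> j k))"
      using f K rep_ob[OF S] smult_mor_closed[OF fj] by (intro finsum_mor_cong) (auto simp: comp_smult_right)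
    finally have "scalar S (f \<cdot> t) = (\<Sum>k\<in>K. scalar S (hform S (e k) h \<odot>\<^bsub>Hom C S S\<^esub> (f \<cdot> j k)))"
      using S K(1) rep_ob[OF S] smult_mor_closed[OF fj]
      by (simp add: additive_finsum_complex[where F = "scalar S"] scalar_add scalar_zero)
    also have "\<dots> = (\<Sum>k\<in>K. scalar S (f \<cdot> j k) * hform S (e k) h)"
      using fj by (intro sum.cong) (auto simp: scalar_smult[OF S] mult.commute)
    finally have 1: "scalar S (f \<cdot> t) = (\<Sum>k\<in>K. scalar S (f \<cdot> j k) * hform S (e k) h)" .
    have fje: "(f \<cdot> j k) \<cdot> e k \<in> mor C P S" if "k < n" for k
      using comp_closed[OF e_mor[OF that] comp_closed[OF j_mor[OF that] f]] .
    have "hform S f h = hform S (\<Oplus>\<^bsub>Hom C P S\<^esub>k\<in>{..<n}. (f \<cdot> j k) \<cdot> e k) h"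
      using mor_from_eq_sum[OF f] by simp
    also have "\<dots> = (\<Sum>k<n. hform S ((f \<cdot> j k) \<cdot> e k) h)"
      using P rep_ob[OF S] fje
      by (intro additive_finsum_complex[where F = "\<lambda>f. hform S f h"]) (auto simp: form_add_left form_zero_left)
    also have "\<dots> = (\<Sum>k\<in>K. hform S ((f \<cdot> j k) \<cdot> e k) h)"
    proof (rule sum.mono_neutral_right)
      show "\<forall>k\<in>{..<n} - K. hform S ((f \<cdot> j k) \<cdot> e k) h = 0"
      proof
        fix k assume "k \<in> {..<n} - K"
        then have k: "k < n" "T k \<noteq> S"
          by (auto simp: K_def)
        have "f \<cdot> j k = zero_mor (T k) S"
          using reps_no_mor[OF summand_rep[OF k(1)] S k(2) comp_closed[OF j_mor[OF k(1)] f]] .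
        then show "hform S ((f \<cdot> j k) \<cdot> e k) h = 0"
          using comp_zero_left[OF e_mor[OF k(1)] rep_ob[OF S]] by (simp add: form_zero_left)
      qed
    qed (auto simp: K_def)
    also have "\<dots> = (\<Sum>k\<in>K. scalar S (f \<cdot> j k) * hform S (e k) h)"
    proof (rule sum.cong)
      fix k assume k: "k \<in> K"
      have "(f \<cdot> j k) \<cdot> e k = (scalar S (f \<cdot> j k) \<odot>\<^bsub>Hom C S S\<^esub> idm S) \<cdot> e k"
        using scalar_smult_id[OF S fj[OF k]] by simp
      also have "\<dots> = scalar S (f \<cdot> j k) \<odot>\<^bsub>Hom C P S\<^esub> e k"
        using K(3)[OF k] by (simp add: comp_smult_left id_mor_closed rep_ob[OF S] comp_id_left)
      finally show "hform S ((f \<cdot> j k) \<cdot> e k) h = scalar S (f \<cdot> j k) * hform S (e k) h"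
        using K(3)[OF k] by (simp add: form_smult_left)
    qed simp
    finally show ?thesis
      using 1 by simp
  qed
  with t show ?thesis by blast
qed

text \<open>
  For an idempotent \<open>a\<close> this means that \<open>f \<mapsto> f \<circ> a\<close> is an orthogonal projection on each \<open>Hom(P,S)\<close>.
\<close>

definition self_adjoint :: "'m \<Rightarrow> bool" where
  "self_adjoint a \<longleftrightarrow> a \<in> mor C P P \<and>
    (\<forall>S\<in>R. \<forall>f\<in>mor C P S. \<forall>h\<in>mor C P S. hform S (f \<cdot> a) h = hform S f (h \<cdot> a))"

lemma self_adjoint_mor: "self_adjoint a \<Longrightarrow> a \<in> mor C P P"
  by (simp add: self_adjoint_def)

lemma self_adjointD:
  "\<lbrakk>self_adjoint a; S \<in> R; f \<in> mor C P S; h \<in> mor C P S\<rbrakk> \<Longrightarrow> hform S (f \<cdot> a) h = hform S f (h \<cdot> a)"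
  by (simp add: self_adjoint_def)

text \<open>
  The right-hand side of the hypothesis is Hermitian in \<open>f\<close> and \<open>h\<close>; hence so is the left-hand side.
\<close>

lemma self_adjointI:
  assumes a: "a \<in> mor C P P"
    and "\<And>S f h. \<lbrakk>S \<in> R; f \<in> mor C P S; h \<in> mor C P S\<rbrakk> \<Longrightarrow> hform S (f \<cdot> a) h = hform S (f \<cdot> a) (h \<cdot> a)"
  shows "self_adjoint a"
  unfolding self_adjoint_def
proof (intro conjI ballI)
  fix S f h assume S: "S \<in> R" and f: "f \<in> mor C P S" and h: "h \<in> mor C P S"
  interpret finite_hom_basis C P S "\<B> S"
    by (rule hom_basis_rep[OF S])
  have "hform S f (h \<cdot> a) = cnj (hform S (h \<cdot> a) f)"
    by (rule form_cnj)
  also have "\<dots> = cnj (hform S (h \<cdot> a) (f \<cdot> a))"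
    using assms(2)[OF S h f] by simp
  also have "\<dots> = hform S (f \<cdot> a) (h \<cdot> a)"
    by (rule form_cnj[symmetric])
  finally show "hform S (f \<cdot> a) h = hform S f (h \<cdot> a)"
    using assms(2)[OF S f h] by simp
qed fact

lemma self_adjoint_id: "self_adjoint (idm P)"
  using P id_mor_closed by (auto simp: self_adjoint_def comp_id_right)

lemma
  assumes a: "self_adjoint a" and b: "self_adjoint b"
  shows self_adjoint_add: "self_adjoint (a \<oplus>\<^bsub>Hom C P P\<^esub> b)"
    and self_adjoint_diff: "self_adjoint (a \<ominus>\<^bsub>Hom C P P\<^esub> b)"
proof -
  note a' = self_adjoint_mor[OF a] and b' = self_adjoint_mor[OF b]
  have "hform S (f \<cdot> (a \<oplus>\<^bsub>Hom C P P\<^esub> b)) h = hform S f (h \<cdot> (a \<oplus>\<^bsub>Hom C P P\<^esub> b)) \<and>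
      hform S (f \<cdot> (a \<ominus>\<^bsub>Hom C P P\<^esub> b)) h = hform S f (h \<cdot> (a \<ominus>\<^bsub>Hom C P P\<^esub> b))"
    if S: "S \<in> R" and f: "f \<in> mor C P S" and h: "h \<in> mor C P S" for S f h
  proof -
    interpret finite_hom_basis C P S "\<B> S"
      by (rule hom_basis_rep[OF S])
    show ?thesis
      using a b S f h comp_closed[OF a'] comp_closed[OF b']
      by (simp add: comp_add_right[OF a' b'] comp_diff_right[OF a' b'] form_add_left form_add_right
          form_diff_left form_diff_right self_adjointD)
  qed
  then show "self_adjoint (a \<oplus>\<^bsub>Hom C P P\<^esub> b)" "self_adjoint (a \<ominus>\<^bsub>Hom C P P\<^esub> b)"
    using add_mor_closed[OF a' b'] diff_mor_closed[OF a' b'] by (simp_all add: self_adjoint_def)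
qed

text \<open>
  \<open>\<langle>f \<circ> N, f \<circ> N\<rangle> = \<langle>f \<circ> N \<circ> N, f\<rangle>\<close>, so an element in the kernel of \<open>N\<^sup>2\<close> lies in the kernel of \<open>N\<close>.
\<close>

lemma self_adjoint_cancel:
  assumes N: "self_adjoint N" and y: "y \<in> mor C P P" and zero: "(y \<cdot> N) \<cdot> N = zero_mor P P"
  shows "y \<cdot> N = zero_mor P P"
proof (rule mor_to_zeroI)
  have N': "N \<in> mor C P P"
    using N by (simp add: self_adjoint_def)
  then show "y \<cdot> N \<in> mor C P P"
    using y by (intro comp_closed)
  fix S f assume S: "S \<in> R" and f: "f \<in> mor C P S"
  interpret finite_hom_basis C P S "\<B> S"
    by (rule hom_basis_rep[OF S])
  have fyN: "f \<cdot> y \<cdot> N \<in> mor C P S" and fy: "f \<cdot> y \<in> mor C P S"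
    using comp_closed N' y f by blast+
  have eq: "(f \<cdot> y \<cdot> N) \<cdot> N = zero_mor P S" "(f \<cdot> y) \<cdot> N = f \<cdot> y \<cdot> N"
    using zero comp_assoc[OF N' comp_closed[OF N' y] f] comp_zero_right[OF f P] comp_assoc[OF N' y f] by auto
  have "hform S (f \<cdot> y \<cdot> N) (f \<cdot> y \<cdot> N) = hform S ((f \<cdot> y \<cdot> N) \<cdot> N) (f \<cdot> y)"
    using self_adjointD[OF N S fyN fy] by (simp add: eq(2))
  also have "\<dots> = 0"
    by (simp add: eq(1) form_zero_left)
  finally show "f \<cdot> y \<cdot> N = zero_mor P S"
    by (rule form_self_eq_zeroD[OF fyN])
qed

text \<open>
  For orthogonal projections \<open>a\<close>, \<open>b\<close> the operator \<open>N = (1 - a) + (1 - b)\<close> is positive: its kernel is what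
  \<open>a\<close> and \<open>b\<close> both fix. If \<open>Y\<close> inverts \<open>N\<close> on its image, then \<open>c = 1 - N Y\<close> is the projection onto the
  kernel. It is recorded that \<open>c\<close> is a polynomial in \<open>N\<close>, since this is how \<open>c\<close> inherits symmetries
  other than self-adjointness from \<open>a\<close> and \<open>b\<close>.
\<close>

lemma ex_intersection_projection:
  assumes a: "self_adjoint a" "a \<cdot> a = a" and b: "self_adjoint b" "b \<cdot> b = b"
  defines "N \<equiv> (idm P \<ominus>\<^bsub>Hom C P P\<^esub> a) \<oplus>\<^bsub>Hom C P P\<^esub> (idm P \<ominus>\<^bsub>Hom C P P\<^esub> b)"
  shows "\<exists>c. endo_poly P N c \<and> self_adjoint c \<and> c \<cdot> c = c \<and> c \<cdot> a = c \<and> c \<cdot> b = c \<and>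
    (\<forall>Z. \<forall>y\<in>mor C Z P. a \<cdot> y = y \<longrightarrow> b \<cdot> y = y \<longrightarrow> c \<cdot> y = y) \<and>
    (\<forall>Z. \<forall>f\<in>mor C P Z. f \<cdot> a = f \<longrightarrow> f \<cdot> b = f \<longrightarrow> f \<cdot> c = f)"
proof -
  define a' b' where "a' = idm P \<ominus>\<^bsub>Hom C P P\<^esub> a" and "b' = idm P \<ominus>\<^bsub>Hom C P P\<^esub> b"
  have N_def: "N = a' \<oplus>\<^bsub>Hom C P P\<^esub> b'"
    by (simp add: N_def a'_def b'_def)
  have sa: "self_adjoint a'" "self_adjoint b'" "self_adjoint N"
    unfolding N_def a'_def b'_def by (intro self_adjoint_add self_adjoint_diff self_adjoint_id a b)+
  have id: "idm P \<in> mor C P P" and a_mor: "a \<in> mor C P P" and b_mor: "b \<in> mor C P P"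
    and a': "a' \<in> mor C P P" and b': "b' \<in> mor C P P" and N: "N \<in> mor C P P"
    using a b sa id_mor_closed[OF P] by (simp_all add: self_adjoint_mor)
  have from_a': "f \<cdot> a' = f \<ominus>\<^bsub>Hom C P Z\<^esub> (f \<cdot> a)" and from_b': "f \<cdot> b' = f \<ominus>\<^bsub>Hom C P Z\<^esub> (f \<cdot> b)"
    if "f \<in> mor C P Z" for f Z
    unfolding a'_def b'_def
    using comp_diff_right[OF id a_mor that] comp_diff_right[OF id b_mor that] by (simp_all add: comp_id_right[OF that])
  have to_a': "a' \<cdot> y = y \<ominus>\<^bsub>Hom C Z P\<^esub> (a \<cdot> y)" and to_b': "b' \<cdot> y = y \<ominus>\<^bsub>Hom C Z P\<^esub> (b \<cdot> y)"
    if "y \<in> mor C Z P" for y Z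
    unfolding a'_def b'_def
    using comp_diff_left[OF that id a_mor] comp_diff_left[OF that id b_mor] by (simp_all add: comp_id_left[OF that])
  have idem: "a' \<cdot> a' = a'" "b' \<cdot> b' = b'"
  proof -
    have "a' \<cdot> a = zero_mor P P" "b' \<cdot> b = zero_mor P P"
      using to_a'[OF a_mor] to_b'[OF b_mor] a b by (simp_all add: diff_self a_mor b_mor)
    then show "a' \<cdot> a' = a'" "b' \<cdot> b' = b'"
      using from_a'[OF a'] from_b'[OF b'] by (simp_all add: diff_zero_mor a' b')
  qed
  have "N \<cdot> x = zero_mor P P" if x: "endo_poly P N x" and zero: "N \<cdot> N \<cdot> x = zero_mor P P" for x
  proof -
    have x': "x \<in> mor C P P" "x \<cdot> N = N \<cdot> x" and Nx: "(N \<cdot> x) \<cdot> N = N \<cdot> N \<cdot> x"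
      using endo_poly_comm[OF x N] endo_poly_comm[OF endo_poly.mult[OF x] N] by auto
    then show ?thesis
      using self_adjoint_cancel[OF sa(3) x'(1)] zero by simp
  qed
  then obtain Y where Y: "endo_poly P N Y" and NNY: "N \<cdot> N \<cdot> Y = N"
    using poly_group_inverse[OF N fin_dim_endo] by blast
  have Y_mor: "Y \<in> mor C P P" and comm: "Y \<cdot> N = N \<cdot> Y"
    using endo_poly_comm[OF Y N] by auto
  note NY_mor = comp_closed[OF Y_mor N]
  define c where "c = idm P \<ominus>\<^bsub>Hom C P P\<^esub> (N \<cdot> Y)"
  have c: "c \<in> mor C P P"
    unfolding c_def using id NY_mor by (rule diff_mor_closed)
  have poly: "endo_poly P N c"
    unfolding c_def diff_conv_add[OF id NY_mor] using Y by (intro endo_poly.intros)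
  have from_c: "f \<cdot> c = f \<ominus>\<^bsub>Hom C P Z\<^esub> ((f \<cdot> N) \<cdot> Y)" if "f \<in> mor C P Z" for f Z
    unfolding c_def using comp_diff_right[OF id NY_mor that] comp_assoc[OF Y_mor N that]
    by (simp add: comp_id_right[OF that])
  have to_c: "c \<cdot> y = y \<ominus>\<^bsub>Hom C Z P\<^esub> (Y \<cdot> N \<cdot> y)" if "y \<in> mor C Z P" for y Z
    unfolding c_def comm[symmetric]
    using comp_diff_left[OF that id comp_closed[OF N Y_mor]] comp_assoc[OF that N Y_mor]
    by (simp add: comp_id_left[OF that])
  have cN: "c \<cdot> N = zero_mor P P"
    using to_c[OF N] NNY comm comp_assoc[OF N N Y_mor] comp_assoc[OF Y_mor N N] comp_assoc[OF N Y_mor N]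
    by (simp add: diff_self[OF N])
  have cc: "c \<cdot> c = c"
    using from_c[OF c] cN comp_zero_left[OF Y_mor P] by (simp add: diff_zero_mor[OF c])
  have "self_adjoint c"
  proof (rule self_adjointI[OF c])
    fix S f h assume S: "S \<in> R" and f: "f \<in> mor C P S" and h: "h \<in> mor C P S"
    interpret finite_hom_basis C P S "\<B> S"
      by (rule hom_basis_rep[OF S])
    \<comment> \<open>\<open>h - h \<circ> c = h \<circ> Y \<circ> N\<close> is orthogonal to \<open>f \<circ> c\<close>, because \<open>N\<close> is self-adjoint and \<open>c \<circ> N = 0\<close>.\<close>
    note hY = comp_closed[OF Y_mor h]
    note hYN = comp_closed[OF N hY]
    note fc = comp_closed[OF c f]
    have "(f \<cdot> c) \<cdot> N = zero_mor P S"
      using comp_assoc[OF N c f] cN comp_zero_right[OF f P] by simp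
    then have "hform S (f \<cdot> c) ((h \<cdot> Y) \<cdot> N) = 0"
      using self_adjointD[OF sa(3) S fc hY] by (simp add: form_zero_left)
    moreover have "h \<cdot> c = h \<ominus>\<^bsub>Hom C P S\<^esub> ((h \<cdot> Y) \<cdot> N)"
      using from_c[OF h] comp_assoc[OF Y_mor N h] comp_assoc[OF N Y_mor h] comm by simp
    ultimately show "hform S (f \<cdot> c) h = hform S (f \<cdot> c) (h \<cdot> c)"
      using h hYN by (simp add: form_diff_right)
  qed
  moreover have "c \<cdot> a = c" "c \<cdot> b = c"
  proof -
    have "f \<cdot> c \<cdot> a = f \<cdot> c \<and> f \<cdot> c \<cdot> b = f \<cdot> c" if S: "S \<in> R" and f: "f \<in> mor C P S" for S f
    proof -
      interpret finite_hom_basis C P S "\<B> S"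
        by (rule hom_basis_rep[OF S])
      define g where "g = f \<cdot> c"
      have g: "g \<in> mor C P S"
        unfolding g_def using c f by (rule comp_closed)
      have ga: "g \<cdot> a' \<in> mor C P S" and gb: "g \<cdot> b' \<in> mor C P S"
        using comp_closed a' b' g by blast+
      have "g \<cdot> N = zero_mor P S"
        unfolding g_def using comp_assoc[OF N c f] cN comp_zero_right[OF f P] by simp
      then have "(g \<cdot> a') \<oplus>\<^bsub>Hom C P S\<^esub> (g \<cdot> b') = zero_mor P S"
        using comp_add_right[OF a' b' g] by (simp add: N_def)
      then have "hform S (g \<cdot> a') g + hform S (g \<cdot> b') g = 0"
        using form_add_left[OF ga gb, of g] by (simp add: form_zero_left)
      \<comment> \<open>As \<open>a'\<close> and \<open>b'\<close> are orthogonal projections, the two summands are squared norms.\<close>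
      moreover have "hform S (g \<cdot> a') g = hform S (g \<cdot> a') (g \<cdot> a')"
        using self_adjointD[OF sa(1) S ga g] comp_assoc[OF a' a' g] idem by simp
      moreover have "hform S (g \<cdot> b') g = hform S (g \<cdot> b') (g \<cdot> b')"
        using self_adjointD[OF sa(2) S gb g] comp_assoc[OF b' b' g] idem by simp
      ultimately have "g \<cdot> a' = zero_mor P S" "g \<cdot> b' = zero_mor P S"
        using form_self_sum_eq_zeroD[OF ga, of "g \<cdot> b'"] form_self_sum_eq_zeroD[OF gb, of "g \<cdot> a'"]
        by (simp_all add: add.commute)
      then have "g \<cdot> a = g" "g \<cdot> b = g"
        using from_a'[OF g] from_b'[OF g] diff_eq_0_iff[OF g comp_closed[OF a_mor g]]
          diff_eq_0_iff[OF g comp_closed[OF b_mor g]] by simp_all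
      then show ?thesis
        unfolding g_def using comp_assoc[OF a_mor c f] comp_assoc[OF b_mor c f] by simp
    qed
    then show "c \<cdot> a = c" "c \<cdot> b = c"
      using mor_to_eqI[OF comp_closed[OF a_mor c] c] mor_to_eqI[OF comp_closed[OF b_mor c] c] by blast+
  qed
  moreover have "c \<cdot> y = y" if y: "y \<in> mor C Z P" and "a \<cdot> y = y" "b \<cdot> y = y" for Z y
  proof -
    have Z: "Z \<in> Ob C"
      using mor_obD[OF y] by simp
    interpret abelian_group "Hom C Z P"
      using Z P by (rule Hom_abelian_group)
    have "N \<cdot> y = zero_mor Z P"
      using to_a'[OF y] to_b'[OF y] that comp_add_left[OF y a' b'] by (simp add: N_def diff_self[OF y])
    then show ?thesis
      using to_c[OF y] comp_zero_right[OF Y_mor Z] by (simp add: diff_zero_mor[OF y])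
  qed
  moreover have "f \<cdot> c = f" if f: "f \<in> mor C P Z" and "f \<cdot> a = f" "f \<cdot> b = f" for Z f
  proof -
    have Z: "Z \<in> Ob C"
      using mor_obD[OF f] by simp
    interpret abelian_group "Hom C P Z"
      using P Z by (rule Hom_abelian_group)
    have "f \<cdot> N = zero_mor P Z"
      using from_a'[OF f] from_b'[OF f] that comp_add_right[OF a' b' f] by (simp add: N_def diff_self[OF f])
    then show ?thesis
      using from_c[OF f] comp_zero_left[OF Y_mor Z] by (simp add: diff_zero_mor[OF f])
  qed
  ultimately show ?thesis
    using poly cc by blast
qed

end

section \<open>Endomorphisms that are their own dual\<close>

context linear_monoidal_category
begin

lemma coev_frob_arr:
  assumes "frobenius_algebra X"
  shows "arr (coev (frob_dual X))" "src C (coev (frob_dual X)) = \<^bold>1"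
    "tgt C (coev (frob_dual X)) = alg_ob X \<otimes>\<^sub>o alg_ob X"
  using left_dual_arr[OF frobenius_duality(1)[OF assms]] by (simp_all add: frob_dual_def)

lemma self_dual_mor: "self_dual X b \<Longrightarrow> b \<in> mor C (alg_ob X) (alg_ob X)"
  by (simp add: self_dual_def)

lemma self_dualD:
  "self_dual X b \<Longrightarrow>
    (b \<rtimes> alg_ob X) \<cdot> coev (frob_dual X) = (alg_ob X \<ltimes> b) \<cdot> coev (frob_dual X)"
  by (simp add: self_dual_def)

lemma self_dual_id: "frobenius_algebra X \<Longrightarrow> self_dual X (idm (alg_ob X))"
  by (simp add: self_dual_def id_mor_closed frobenius_arr)

lemma
  assumes X: "frobenius_algebra X" and a: "self_dual X a"
  shows self_dual_add: "self_dual X b \<Longrightarrow> self_dual X (a \<oplus>\<^bsub>Hom C (alg_ob X) (alg_ob X)\<^esub> b)"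
    and self_dual_smult: "self_dual X (z \<odot>\<^bsub>Hom C (alg_ob X) (alg_ob X)\<^esub> a)"
proof -
  let ?P = "alg_ob X" and ?k = "coev (frob_dual X)"
  note a' = self_dual_mor[OF a]
  have id: "idm ?P \<in> mor C ?P ?P" and k: "?k \<in> mor C \<^bold>1 (?P \<otimes>\<^sub>o ?P)"
    using frobenius_arr(1)[OF X] id_mor_closed coev_frob_arr[OF X] by (auto simp: mor_iff)
  note l = tensor_mor_closed[OF _ id] and r = tensor_mor_closed[OF id]
  show "self_dual X (a \<oplus>\<^bsub>Hom C ?P ?P\<^esub> b)" if b: "self_dual X b"
  proof -
    note b' = self_dual_mor[OF b]
    show ?thesis
      unfolding self_dual_def
      using comp_add_left[OF k l[OF a'] l[OF b']] comp_add_left[OF k r[OF a'] r[OF b']]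
        self_dualD[OF a] self_dualD[OF b] add_mor_closed[OF a' b']
      by (simp add: tensor_add_left[OF a' b' id] tensor_add_right[OF id a' b'])
  qed
  show "self_dual X (z \<odot>\<^bsub>Hom C ?P ?P\<^esub> a)"
    unfolding self_dual_def
    using comp_smult_left[OF k l[OF a']] comp_smult_left[OF k r[OF a']]
      self_dualD[OF a] smult_mor_closed[OF a']
    by (simp add: tensor_smult_left[OF a' id] tensor_smult_right[OF id a'])
qed

lemma self_dual_diff:
  assumes X: "frobenius_algebra X" and a: "self_dual X a" and b: "self_dual X b"
  shows "self_dual X (a \<ominus>\<^bsub>Hom C (alg_ob X) (alg_ob X)\<^esub> b)"
  unfolding diff_conv_add[OF self_dual_mor[OF a] self_dual_mor[OF b]]
  by (intro self_dual_add self_dual_smult assms)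

lemma transpose_comp:
  assumes X: "frobenius_algebra X" and a: "self_dual X a" and b: "self_dual X b"
  shows "((a \<cdot> b) \<rtimes> alg_ob X) \<cdot> coev (frob_dual X)
    = (alg_ob X \<ltimes> (b \<cdot> a)) \<cdot> coev (frob_dual X)"
proof -
  let ?P = "alg_ob X" and ?k = "coev (frob_dual X)"
  have ab: "arr a" "src C a = ?P" "tgt C a = ?P" "arr b" "src C b = ?P" "tgt C b = ?P"
    using self_dual_mor[OF a] self_dual_mor[OF b] by (auto simp: mor_iff)
  note t = ab coev_frob_arr[OF X] frobenius_arr(1)[OF X]
  have "((a \<cdot> b) \<rtimes> ?P) \<cdot> ?k = (a \<rtimes> ?P) \<cdot> (b \<rtimes> ?P) \<cdot> ?k"
    by (simp add: layers t)
  also have "\<dots> = ((a \<rtimes> ?P) \<cdot> (?P \<ltimes> b)) \<cdot> ?k"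
    unfolding self_dualD[OF b] by (simp add: layers t)
  also have "\<dots> = ((?P \<ltimes> b) \<cdot> (a \<rtimes> ?P)) \<cdot> ?k"
    using slide[of a b ?P ?P ?P ?P] by (simp add: t)
  also have "\<dots> = (?P \<ltimes> b) \<cdot> (?P \<ltimes> a) \<cdot> ?k"
    unfolding self_dualD[OF a, symmetric] by (simp add: layers t)
  finally show ?thesis
    by (simp add: layers t)
qed

lemma self_dual_comp:
  assumes X: "frobenius_algebra X" and a: "self_dual X a" and b: "self_dual X b" and "a \<cdot> b = b \<cdot> a"
  shows "self_dual X (a \<cdot> b)"
  using transpose_comp[OF X a b] comp_closed[OF self_dual_mor[OF b] self_dual_mor[OF a]] assms(4)
  by (simp add: self_dual_def)

text \<open>
  The dual of \<open>a = a \<circ> b\<close> is \<open>b\<^sup>* \<circ> a\<^sup>* = b \<circ> a\<close>. For projections, a one-sided comparison therefore implies the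
  two-sided one.
\<close>

lemma self_dual_comp_flip:
  assumes X: "frobenius_algebra X" and a: "self_dual X a" and b: "self_dual X b" and ab: "a \<cdot> b = a"
  shows "b \<cdot> a = a"
proof -
  note D = frobenius_duality(1)[OF X]
  note ba = comp_closed[OF self_dual_mor[OF a] self_dual_mor[OF b]]
  show ?thesis
    using dual_bend_cancel[OF D, of "b \<cdot> a" "alg_ob X" a] transpose_comp[OF X a b] self_dualD[OF a] ba
      self_dual_mor[OF a] by (simp add: ab frob_dual_def)
qed

lemma self_dual_poly:
  assumes X: "frobenius_algebra X" and N: "self_dual X N" and x: "endo_poly (alg_ob X) N x"
  shows "self_dual X x"
  using x
proof induction
  case (mult x)
  have "N \<cdot> x = x \<cdot> N"
    using endo_poly_comm[OF mult.hyps self_dual_mor[OF N]] by simp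
  with self_dual_comp[OF X N mult.IH] show ?case .
qed (intro self_dual_id self_dual_add self_dual_smult X; assumption)+

end

section \<open>Rigid invariance is self-adjointness\<close>

locale semisimple_frobenius_algebra =
  rigid_abelian_monoidal_category C + semisimple_object C "alg_ob X" R \<B> n T j e
  for C :: "('o, 'm) moncat" (structure) and X :: "('o, 'm) frob_alg"
    and R :: "'o set" and \<B> :: "'o \<Rightarrow> 'm set"
    and n :: nat and T :: "nat \<Rightarrow> 'o" and j e :: "nat \<Rightarrow> 'm" +
  assumes frobenius: "frobenius_algebra X"
begin

abbreviation XO :: "'o" where
  "XO \<equiv> alg_ob X"

abbreviation dual_X :: "('o, 'm) dual_datum" where
  "dual_X \<equiv> frob_dual X"

lemma dual_X: "left_dual XO dual_X"
  by (rule frobenius_duality(1)[OF frobenius])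

lemma dual_ob_dual_X [simp]: "dual_ob dual_X = XO"
  by (simp add: frob_dual_def)

text \<open>
  The relation says that \<open>g : X\<^sup>* \<rightarrow> S\<^sup>*\<close> is the dual of \<open>t : S \<rightarrow> X\<close>. It is used to compute \<open>\<kappa>'(f, g)\<close> as the
  scalar by which \<open>f \<circ> t\<close> acts on \<open>S\<close>.
\<close>

definition mate :: "('o, 'm) dual_datum \<Rightarrow> 'm \<Rightarrow> 'm \<Rightarrow> bool" where
  "mate DS g t \<longleftrightarrow> (XO \<ltimes> g) \<cdot> coev dual_X = (t \<rtimes> dual_ob DS) \<cdot> coev DS"

lemma ex_mate:
  assumes DS: "left_dual S DS" and g: "g \<in> mor C XO (dual_ob DS)"
  shows "\<exists>t\<in>mor C S XO. mate DS g t"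
proof -
  have "arr g" "src C g = XO" "tgt C g = dual_ob DS"
    using g by (auto simp: mor_iff)
  note t = this left_dual_arr[OF DS] left_dual_arr[OF dual_X] typing
  let ?v = "(XO \<ltimes> g) \<cdot> coev dual_X"
  have "arr ?v" "src C ?v = \<^bold>1" "tgt C ?v = XO \<otimes>\<^sub>o dual_ob DS"
    by (simp_all add: t)
  note b = bend[OF DS this left_dual_arr(1)[OF dual_X]]
  show ?thesis
    by (intro bexI[OF _ b(1)]) (simp only: mate_def b(2))
qed

lemma mate_dual:
  assumes DS: "left_dual S DS" and t: "t \<in> mor C S XO"
  shows "dual_mor DS dual_X t \<in> mor C XO (dual_ob DS)" and "mate DS (dual_mor DS dual_X t) t"
  using dual_mor_coev[OF DS dual_X t] by (simp_all add: mate_def)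

lemma mate_comp:
  assumes DS: "left_dual S DS" and g: "g \<in> mor C XO (dual_ob DS)" and t: "t \<in> mor C S XO"
    and m: "mate DS g t" and a: "self_dual X a"
  shows "mate DS (g \<cdot> a) (a \<cdot> t)"
proof -
  let ?k = "coev dual_X"
  have ar: "arr g" "src C g = XO" "tgt C g = dual_ob DS" "arr t" "src C t = S" "tgt C t = XO"
    "arr a" "src C a = XO" "tgt C a = XO"
    using g t self_dual_mor[OF a] by (auto simp: mor_iff)
  note ty = ar left_dual_arr[OF DS] left_dual_arr[OF dual_X]
  have "(XO \<ltimes> (g \<cdot> a)) \<cdot> ?k = (XO \<ltimes> g) \<cdot> (XO \<ltimes> a) \<cdot> ?k"
    by (simp add: layers ty)
  also have "\<dots> = ((XO \<ltimes> g) \<cdot> (a \<rtimes> XO)) \<cdot> ?k"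
    unfolding self_dualD[OF a, symmetric] by (simp add: layers ty)
  also have "\<dots> = ((a \<rtimes> dual_ob DS) \<cdot> (XO \<ltimes> g)) \<cdot> ?k"
    using slide[of a g XO XO XO "dual_ob DS"] by (simp add: ty)
  also have "\<dots> = (a \<rtimes> dual_ob DS) \<cdot> (XO \<ltimes> g) \<cdot> ?k"
    by (simp add: layers ty)
  also have "\<dots> = ((a \<cdot> t) \<rtimes> dual_ob DS) \<cdot> coev DS"
    unfolding m[unfolded mate_def] by (simp add: layers ty)
  finally show ?thesis
    by (simp add: mate_def)
qed

lemma mate_unique:
  assumes "left_dual S DS" "t \<in> mor C S XO" "t' \<in> mor C S XO" "mate DS g t" "mate DS g t'"
  shows "t = t'"
  using assms(4,5) unfolding mate_def by (intro bend_cancel[OF assms(1-3)]) (rule trans[OF sym])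

lemma rig_kappa_mate:
  assumes S: "S \<in> R" and DS: "left_dual S DS" and f: "f \<in> mor C XO S"
    and g: "g \<in> mor C XO (dual_ob DS)" and t: "t \<in> mor C S XO" and m: "mate DS g t"
  shows "rig_kappa dual_X S DS f g = scalar S (f \<cdot> t)"
proof -
  let ?Q = "dual_ob DS"
  have ar: "arr g" "src C g = XO" "tgt C g = ?Q" "arr t" "src C t = S" "tgt C t = XO"
    "arr f" "src C f = XO" "tgt C f = S"
    using g t f by (auto simp: mor_iff)
  note ty = ar left_dual_arr[OF DS] left_dual_arr[OF dual_X]
  have ft: "f \<cdot> t \<in> mor C S S"
    using t f by (rule comp_closed)
  have idS: "idm S \<in> mor C S S" and idQ: "idm ?Q \<in> mor C ?Q ?Q" and coevS: "coev DS \<in> mor C \<^bold>1 (S \<otimes>\<^sub>o ?Q)"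
    by (simp_all add: mor_iff typing ty)
  have smult: "((z \<odot>\<^bsub>Hom C S S\<^esub> idm S) \<rtimes> ?Q) \<cdot> coev DS = z \<odot>\<^bsub>Hom C \<^bold>1 (S \<otimes>\<^sub>o ?Q)\<^esub> coev DS" for z
    using comp_smult_left[OF coevS tensor_mor_closed[OF idS idQ]]
    by (simp add: tensor_smult_left[OF idS idQ] tensor_id arr_comp_id ty)
  have "(f \<otimes>\<^sub>m g) \<cdot> coev dual_X = (f \<rtimes> ?Q) \<cdot> (XO \<ltimes> g) \<cdot> coev dual_X"
    using tensor_left_right[of f g XO ?Q] by (intro comp_reassoc[symmetric]) (simp_all add: typing ty)
  also have "\<dots> = ((f \<cdot> t) \<rtimes> ?Q) \<cdot> coev DS"
    unfolding m[unfolded mate_def] by (simp add: layers ty)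
  also have "\<dots> = scalar S (f \<cdot> t) \<odot>\<^bsub>Hom C \<^bold>1 (S \<otimes>\<^sub>o ?Q)\<^esub> coev DS"
    using smult[of "scalar S (f \<cdot> t)"] scalar_smult_id[OF S ft] by simp
  finally have eq: "(f \<otimes>\<^sub>m g) \<cdot> coev dual_X = scalar S (f \<cdot> t) \<odot>\<^bsub>Hom C \<^bold>1 (S \<otimes>\<^sub>o ?Q)\<^esub> coev DS" .
  have "z = scalar S (f \<cdot> t)" if "(f \<otimes>\<^sub>m g) \<cdot> coev dual_X = z \<odot>\<^bsub>Hom C \<^bold>1 (S \<otimes>\<^sub>o ?Q)\<^esub> coev DS" for z
  proof -
    have "z \<odot>\<^bsub>Hom C S S\<^esub> idm S = scalar S (f \<cdot> t) \<odot>\<^bsub>Hom C S S\<^esub> idm S"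
      by (rule bend_cancel[OF DS smult_mor_closed[OF idS] smult_mor_closed[OF idS]])
        (unfold smult, rule trans[OF that[symmetric] eq])
    then show ?thesis
      by (rule smult_cancel[OF idS simple_id(2)[OF rep_simple[OF S]]])
  qed
  with eq show ?thesis
    unfolding rig_kappa_def by (intro the_equality)
qed

lemma rig_map_mate:
  assumes S: "S \<in> R" and DS: "left_dual S DS"
    and g: "g \<in> mor C XO (dual_ob DS)" and t: "t \<in> mor C S XO" and m: "mate DS g t"
  shows "rig_map XO dual_X S DS (\<B> S) g = h \<longleftrightarrow>
    h \<in> mor C XO S \<and> (\<forall>f\<in>mor C XO S. hform S f h = scalar S (f \<cdot> t))"
proof -
  interpret h: finite_hom_basis C XO S "\<B> S"
    by (rule hom_basis_rep[OF S])
  have "rig_map XO dual_X S DS (\<B> S) g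
      = (THE h. h \<in> mor C XO S \<and> (\<forall>f\<in>mor C XO S. hform S f h = scalar S (f \<cdot> t)))"
    unfolding rig_map_def using rig_kappa_mate[OF S DS _ g t m] by (intro arg_cong[of _ _ The]) auto
  moreover have "\<exists>h\<in>mor C XO S. \<forall>f\<in>mor C XO S. hform S f h = scalar S (f \<cdot> t)"
    using comp_add_left[OF t] comp_smult_left[OF t] comp_closed[OF t] scalar_add[OF S] scalar_smult[OF S]
    by (intro h.form_represents) auto
  then obtain h0 where h0: "h0 \<in> mor C XO S" "\<And>f. f \<in> mor C XO S \<Longrightarrow> hform S f h0 = scalar S (f \<cdot> t)"
    by blast
  have unique: "h \<in> mor C XO S \<and> (\<forall>f\<in>mor C XO S. hform S f h = scalar S (f \<cdot> t)) \<longleftrightarrow> h = h0" for h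
    using h0 h.form_right_cancel[OF _ h0(1), of h] by auto
  ultimately show ?thesis
    by auto
qed

text \<open>
  Let \<open>V\<close> and \<open>W\<close> be the images of composition with \<open>a\<close> on \<open>Hom(X,S)\<close> and on \<open>Hom(X\<^sup>*,S\<^sup>*)\<close>. As
  \<open>\<kappa>'(f, g \<circ> a) = \<kappa>'(f \<circ> a, g)\<close>, the orthogonal complement of \<open>M'(W)\<close> consists of the \<open>f\<close> with \<open>f \<circ> a = 0\<close>. So
  \<open>M'(W) = V\<close> means that kernel and image of the projection \<open>f \<mapsto> f \<circ> a\<close> are orthogonal complements.
\<close>

lemma rigid_invariant_iff_self_adjoint:
  assumes A: "frobenius_subalgebra X A"
  shows "rigid_invariant XO dual_X R \<B> (frob_dual A) (incl A) (incl_dual X A)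
    \<longleftrightarrow> self_adjoint (subalg_idem X A)" (is "?rigid \<longleftrightarrow> _")
proof -
  let ?i = "incl A" and ?p = "incl_dual X A" and ?a = "subalg_idem X A"
  note i = subalgebra_split(1)[OF frobenius A] and p = subalgebra_split(2)[OF frobenius A]
    and pi = subalgebra_split(3)[OF frobenius A]
  have sub: "subalgebra_idem X ?a"
    by (rule subalg_idem_subalgebra[OF frobenius A])
  then have tr: "self_dual X ?a" and idem: "?a \<cdot> ?a = ?a"
    by (auto simp: subalgebra_idem_def)
  note a = self_dual_mor[OF tr]
  \<comment> \<open>Both sides of the invariance condition depend only on the idempotent.\<close>
  have factor: "{g \<cdot> ?p | g. g \<in> mor C (alg_ob A) Z} = {g \<in> mor C XO Z. g \<cdot> ?a = g}" for Z
  proof (intro equalityI subsetI)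
    fix h assume "h \<in> {g \<cdot> ?p | g. g \<in> mor C (alg_ob A) Z}"
    then obtain g where g: "g \<in> mor C (alg_ob A) Z" "h = g \<cdot> ?p" by blast
    have "(g \<cdot> ?p) \<cdot> ?i \<cdot> ?p = g \<cdot> (?p \<cdot> ?i) \<cdot> ?p"
      using p i p g(1) by (rule assoc_middle)
    also have "\<dots> = g \<cdot> ?p"
      by (simp add: pi comp_id_left[OF p])
    finally show "h \<in> {g \<in> mor C XO Z. g \<cdot> ?a = g}"
      using comp_closed[OF p g(1)] g(2) by (simp add: subalg_idem_def)
  next
    fix h assume "h \<in> {g \<in> mor C XO Z. g \<cdot> ?a = g}"
    then have h: "h \<in> mor C XO Z" "h \<cdot> ?a = h" by auto
    then have "h = (h \<cdot> ?i) \<cdot> ?p"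
      using comp_assoc[OF p i h(1)] by (simp add: subalg_idem_def)
    then show "h \<in> {g \<cdot> ?p | g. g \<in> mor C (alg_ob A) Z}"
      using comp_closed[OF i h(1)] by blast
  qed
  have src: "src C ?i = alg_ob A" and dual_A: "dual_ob (frob_dual A) = alg_ob A"
    using i by (auto simp: mor_iff frob_dual_def)
  have rigid: "?rigid \<longleftrightarrow> (\<forall>S\<in>R. \<forall>DS. left_dual S DS \<longrightarrow>
      rig_map XO dual_X S DS (\<B> S) ` {g \<in> mor C XO (dual_ob DS). g \<cdot> ?a = g}
      = {f \<in> mor C XO S. f \<cdot> ?a = f})"
    unfolding rigid_invariant_def src dual_A factor incl_dual_def[symmetric] ..
  show ?thesis
  proof
    assume ?rigid
    show "self_adjoint ?a"
    proof (rule self_adjointI[OF a])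
      fix S f h assume S: "S \<in> R" and f: "f \<in> mor C XO S" and h: "h \<in> mor C XO S"
      obtain DS where DS: "left_dual S DS"
        using ex_left_dual[OF rep_ob[OF S]] by blast
      interpret h: finite_hom_basis C XO S "\<B> S"
        by (rule hom_basis_rep[OF S])
      have "(f \<cdot> ?a) \<cdot> ?a = f \<cdot> ?a"
        using comp_assoc[OF a a f] idem by simp
      then have "f \<cdot> ?a \<in> {f \<in> mor C XO S. f \<cdot> ?a = f}"
        using comp_closed[OF a f] by simp
      then have "f \<cdot> ?a \<in> rig_map XO dual_X S DS (\<B> S) ` {g \<in> mor C XO (dual_ob DS). g \<cdot> ?a = g}"
        using \<open>?rigid\<close>[unfolded rigid, rule_format, OF S DS] by simp
      then obtain g where g: "g \<in> mor C XO (dual_ob DS)" "g \<cdot> ?a = g"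
        and gh: "rig_map XO dual_X S DS (\<B> S) g = f \<cdot> ?a"
        by auto
      obtain t where t: "t \<in> mor C S XO" "mate DS g t"
        using ex_mate[OF DS g(1)] by blast
      have at: "?a \<cdot> t = t"
        using mate_unique[OF DS comp_closed[OF t(1) a] t(1)] mate_comp[OF DS g(1) t tr] g(2) t(2) by simp
      have form: "hform S f' (f \<cdot> ?a) = scalar S (f' \<cdot> t)" if "f' \<in> mor C XO S" for f'
        using rig_map_mate[OF S DS g(1) t] gh that by blast
      have "hform S h (f \<cdot> ?a) = hform S (h \<cdot> ?a) (f \<cdot> ?a)"
        using form[OF h] form[OF comp_closed[OF a h]] comp_assoc[OF t(1) a h] at by simp
      then show "hform S (f \<cdot> ?a) h = hform S (f \<cdot> ?a) (h \<cdot> ?a)"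
        by (subst (1 2) h.form_cnj) simp
    qed
  next
    assume sa: "self_adjoint ?a"
    show ?rigid
      unfolding rigid
    proof (intro ballI allI impI equalityI subsetI)
      fix S DS h assume S: "S \<in> R" and DS: "left_dual S DS"
        and "h \<in> rig_map XO dual_X S DS (\<B> S) ` {g \<in> mor C XO (dual_ob DS). g \<cdot> ?a = g}"
      then obtain g where g: "g \<in> mor C XO (dual_ob DS)" "g \<cdot> ?a = g"
        and gh: "rig_map XO dual_X S DS (\<B> S) g = h"
        by blast
      interpret h: finite_hom_basis C XO S "\<B> S"
        by (rule hom_basis_rep[OF S])
      obtain t where t: "t \<in> mor C S XO" "mate DS g t"
        using ex_mate[OF DS g(1)] by blast
      have at: "?a \<cdot> t = t"
        using mate_unique[OF DS comp_closed[OF t(1) a] t(1)] mate_comp[OF DS g(1) t tr] g(2) t(2) by simp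
      have h: "h \<in> mor C XO S" and form: "\<And>f'. f' \<in> mor C XO S \<Longrightarrow> hform S f' h = scalar S (f' \<cdot> t)"
        using rig_map_mate[OF S DS g(1) t] gh by auto
      have "h \<cdot> ?a = h"
      proof (rule h.form_right_cancel[OF comp_closed[OF a h] h])
        fix f assume f: "f \<in> mor C XO S"
        have "hform S f (h \<cdot> ?a) = hform S (f \<cdot> ?a) h"
          using self_adjointD[OF sa S f h] by simp
        then show "hform S f (h \<cdot> ?a) = hform S f h"
          using form[OF f] form[OF comp_closed[OF a f]] comp_assoc[OF t(1) a f] at by simp
      qed
      with h show "h \<in> {f \<in> mor C XO S. f \<cdot> ?a = f}" by simp
    next
      fix S DS h assume S: "S \<in> R" and DS: "left_dual S DS" and "h \<in> {f \<in> mor C XO S. f \<cdot> ?a = f}"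
      then have h: "h \<in> mor C XO S" "h \<cdot> ?a = h" by auto
      obtain t where t: "t \<in> mor C S XO" and form: "\<And>f. f \<in> mor C XO S \<Longrightarrow> scalar S (f \<cdot> t) = hform S f h"
        using form_represented_by_mor[OF S h(1)] by blast
      let ?g = "dual_mor DS dual_X t"
      note g = mate_dual[OF DS t]
      have ga: "?g \<cdot> ?a \<in> mor C XO (dual_ob DS)"
        using comp_closed[OF a g(1)] .
      have "hform S f h = scalar S (f \<cdot> ?a \<cdot> t)" if f: "f \<in> mor C XO S" for f
        using form[OF comp_closed[OF a f]] comp_assoc[OF t a f] self_adjointD[OF sa S f h(1)] h(2) by simp
      then have "rig_map XO dual_X S DS (\<B> S) (?g \<cdot> ?a) = h"
        using rig_map_mate[OF S DS ga comp_closed[OF t a] mate_comp[OF DS g(1) t g(2) tr]] h(1) by blast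
      moreover have "(?g \<cdot> ?a) \<cdot> ?a = ?g \<cdot> ?a"
        using comp_assoc[OF a a g(1)] idem by simp
      ultimately show "h \<in> rig_map XO dual_X S DS (\<B> S) ` {g \<in> mor C XO (dual_ob DS). g \<cdot> ?a = g}"
        using ga by blast
    qed
  qed
qed

end

section \<open>Intersections and sums of symmetric projections\<close>

context linear_category
begin

lemma diff_eq_self_iff:
  assumes f: "f \<in> mor C A B" and g: "g \<in> mor C A B"
  shows "f \<ominus>\<^bsub>Hom C A B\<^esub> g = f \<longleftrightarrow> g = zero_mor A B"
proof
  interpret abelian_group "Hom C A B"
    using f by (intro Hom_abelian_group mor_obD)
  assume "f \<ominus>\<^bsub>Hom C A B\<^esub> g = f"
  then have "g \<oplus>\<^bsub>Hom C A B\<^esub> f = f"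
    using diff_add_cancel[OF f g] a_comm[of f g] f g by (simp add: mor_def)
  then show "g = zero_mor A B"
    using eq_diffI[OF g f f] by (simp add: diff_self[OF f])
qed (simp add: diff_zero_mor[OF f])

text \<open>
  Let \<open>k\<close> be the first index occurring in a nontrivial linear relation between the \<open>u l\<close>. Multiplication
  of the relation by \<open>1 - u (k + 1)\<close> kills all terms with larger index and leaves a multiple of
  \<open>u k - u (k + 1)\<close>.
\<close>

lemma decreasing_idempotents_stabilize:
  assumes P: "P \<in> Ob C" and fin: "fin_dim P P"
    and u: "\<And>k. u k \<in> mor C P P" "\<And>k. u k \<cdot> u k = u k" and dec: "\<And>k. u (Suc k) \<cdot> u k = u (Suc k)" "\<And>k. u k \<cdot> u (Suc k) = u (Suc k)"
  shows "\<exists>k. u (Suc k) = u k"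
proof -
  obtain d c k' where k': "k' \<le> d" "c k' \<noteq> 0"
    and rel: "(\<Oplus>\<^bsub>Hom C P P\<^esub>k\<in>{..d}. c k \<odot>\<^bsub>Hom C P P\<^esub> u k) = zero_mor P P"
    by (rule hom_dependency[OF fin u(1)])
  define k where "k = (LEAST k. k \<le> d \<and> c k \<noteq> 0)"
  have k: "k \<le> d" "c k \<noteq> 0"
    using LeastI[of "\<lambda>k. k \<le> d \<and> c k \<noteq> 0" k'] k' by (auto simp: k_def)
  have below: "c l = 0" if "l < k" for l
    using not_less_Least[of l "\<lambda>k. k \<le> d \<and> c k \<noteq> 0"] that k(1) by (auto simp: k_def)
  have above: "u (Suc k + l) \<cdot> u (Suc k) = u (Suc k + l)" for l
  proof (induction l)
    case 0
    then show ?case using u(2) by simp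
  next
    case (Suc l)
    then show ?case
      using comp_assoc[OF u(1) u(1) u(1), of "Suc (Suc k + l)" "Suc k + l" "Suc k"] dec(1)[of "Suc k + l"] by simp
  qed
  have id: "idm P \<in> mor C P P"
    using P by (rule id_mor_closed)
  define w where "w = idm P \<ominus>\<^bsub>Hom C P P\<^esub> u (Suc k)"
  have w: "w \<in> mor C P P"
    unfolding w_def using id u(1) by (rule diff_mor_closed)
  have uw: "u l \<cdot> w = u l \<ominus>\<^bsub>Hom C P P\<^esub> (u l \<cdot> u (Suc k))" for l
    unfolding w_def by (simp add: comp_diff_right[OF id u(1) u(1)] comp_id_right[OF u(1)])
  have ukw: "u k \<cdot> w \<in> mor C P P"
    using comp_closed[OF w u(1)] .
  have "(\<Oplus>\<^bsub>Hom C P P\<^esub>l\<in>{..d}. (c l \<odot>\<^bsub>Hom C P P\<^esub> u l) \<cdot> w) = c k \<odot>\<^bsub>Hom C P P\<^esub> (u k \<cdot> w)"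
  proof (rule finsum_mor_single)
    show "(c k \<odot>\<^bsub>Hom C P P\<^esub> u k) \<cdot> w = c k \<odot>\<^bsub>Hom C P P\<^esub> (u k \<cdot> w)"
      by (rule comp_smult_left[OF w u(1)])
    show "(c l \<odot>\<^bsub>Hom C P P\<^esub> u l) \<cdot> w = zero_mor P P" if "l \<noteq> k" for l
    proof (cases "l < k")
      case True
      then show ?thesis
        using below smult_zero[OF u(1)] comp_zero_left[OF w P] by simp
    next
      case False
      with that have "l = Suc k + (l - Suc k)" by simp
      then have "u l \<cdot> u (Suc k) = u l"
        using above by metis
      then have "u l \<cdot> w = zero_mor P P"
        using uw diff_self[OF u(1)] by simp
      then show ?thesis
        using comp_smult_left[OF w u(1)] smult_0_mor[OF P P] by simp
    qed
  qed (use P k ukw smult_mor_closed in auto)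
  moreover have "(\<Oplus>\<^bsub>Hom C P P\<^esub>l\<in>{..d}. (c l \<odot>\<^bsub>Hom C P P\<^esub> u l) \<cdot> w) = zero_mor P P"
    using comp_finsum_left[OF w P, of "{..d}" "\<lambda>l. c l \<odot>\<^bsub>Hom C P P\<^esub> u l"] rel comp_zero_left[OF w P]
    by (simp add: smult_mor_closed u(1))
  ultimately have "c k \<odot>\<^bsub>Hom C P P\<^esub> (u k \<cdot> w) = zero_mor P P"
    by simp
  then have "inverse (c k) \<odot>\<^bsub>Hom C P P\<^esub> (c k \<odot>\<^bsub>Hom C P P\<^esub> (u k \<cdot> w)) = zero_mor P P"
    by (simp add: smult_0_mor[OF P P])
  then have "u k \<cdot> w = zero_mor P P"
    using k(2) by (simp add: smult_assoc[OF ukw] smult_one[OF ukw])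
  then have "u (Suc k) = u k"
    unfolding uw dec(2) by (simp add: diff_eq_0_iff[OF u(1) u(1)])
  then show ?thesis ..
qed

end

context linear_monoidal_category
begin

text \<open>
  A morphism into \<open>P\<close> factors through a split subobject iff it is fixed by the idempotent. So pullbacks
  of split subobjects can be described by idempotents.
\<close>

lemma sub_intersectionI:
  assumes i: "i \<in> mor C A P" and p: "p \<in> mor C P A" and pi: "p \<cdot> i = idm A"
    and j: "j \<in> mor C B P" and q: "q \<in> mor C P B" and qj: "q \<cdot> j = idm B"
    and k: "k \<in> mor C D P" and r: "r \<in> mor C P D" and rk: "r \<cdot> k = idm D"
    and le: "(i \<cdot> p) \<cdot> k = k" "(j \<cdot> q) \<cdot> k = k"
    and univ: "\<And>Z y. \<lbrakk>y \<in> mor C Z P; (i \<cdot> p) \<cdot> y = y; (j \<cdot> q) \<cdot> y = y\<rbrakk> \<Longrightarrow> (k \<cdot> r) \<cdot> y = y"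
  shows "sub_intersection k i j"
proof -
  let ?u = "p \<cdot> k" and ?v = "q \<cdot> k"
  have u: "?u \<in> mor C D A" and v: "?v \<in> mor C D B"
    using comp_closed k p q by blast+
  have iu: "i \<cdot> ?u = k" and jv: "j \<cdot> ?v = k"
    using le comp_assoc[OF k p i] comp_assoc[OF k q j] by simp_all
  have src: "src C ?u = D" "src C i = A" "src C j = B"
    using u i j by (auto simp: mor_iff)
  have mono: "w = w'" if "w \<in> mor C Z D" "w' \<in> mor C Z D" "k \<cdot> w = k \<cdot> w'" for Z w w'
    using monoD[OF split_monoI[OF k r rk] k that] .
  have "is_pullback ?u ?v i j"
    unfolding is_pullback_def src
  proof (intro conjI allI ballI impI)
    show "?u \<in> mor C D A" "?v \<in> mor C D B" "i \<cdot> ?u = j \<cdot> ?v"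
      using u v iu jv by simp_all
    fix Z g h assume g: "g \<in> mor C Z A" and h: "h \<in> mor C Z B" and eq: "i \<cdot> g = j \<cdot> h"
    let ?y = "i \<cdot> g"
    have y: "?y \<in> mor C Z P"
      using g i by (rule comp_closed)
    have "(i \<cdot> p) \<cdot> i \<cdot> g = i \<cdot> (p \<cdot> i) \<cdot> g"
      using g i p i by (rule assoc_middle)
    then have 1: "(i \<cdot> p) \<cdot> ?y = ?y"
      using pi comp_id_left[OF g] by simp
    have "(j \<cdot> q) \<cdot> j \<cdot> h = j \<cdot> (q \<cdot> j) \<cdot> h"
      using h j q j by (rule assoc_middle)
    then have 2: "(j \<cdot> q) \<cdot> ?y = ?y"
      using qj comp_id_left[OF h] eq by simp
    have kry: "k \<cdot> r \<cdot> ?y = ?y"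
      using univ[OF y 1 2] comp_assoc[OF y r k] by simp
    have ry: "r \<cdot> ?y \<in> mor C Z D"
      using y r by (rule comp_closed)
    have "?u \<cdot> r \<cdot> ?y = p \<cdot> ?y"
      using comp_assoc[OF ry k p] kry by simp
    then have urg: "?u \<cdot> r \<cdot> ?y = g"
      using comp_assoc[OF g i p] pi comp_id_left[OF g] by simp
    have "?v \<cdot> r \<cdot> ?y = q \<cdot> ?y"
      using comp_assoc[OF ry k q] kry by simp
    then have vrh: "?v \<cdot> r \<cdot> ?y = h"
      using comp_assoc[OF h j q] qj comp_id_left[OF h] eq by simp
    show "\<exists>!w. w \<in> mor C Z D \<and> ?u \<cdot> w = g \<and> ?v \<cdot> w = h"
    proof (rule ex1I[of _ "r \<cdot> ?y"])
      fix w assume w: "w \<in> mor C Z D \<and> ?u \<cdot> w = g \<and> ?v \<cdot> w = h"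
      then have "k \<cdot> w = ?y"
        using comp_assoc[of w Z D ?u A i P] u i iu by simp
      then have "k \<cdot> w = k \<cdot> r \<cdot> ?y"
        using kry by simp
      with mono w ry show "w = r \<cdot> ?y" by blast
    qed (use ry urg vrh in blast)
  qed
  with iu show ?thesis
    unfolding sub_intersection_def by metis
qed

lemma ambiently_selfdualI:
  assumes X: "frobenius_algebra X" and i: "i \<in> mor C A (alg_ob X)" and p: "p \<in> mor C (alg_ob X) A"
    and pi: "p \<cdot> i = idm A" and ip: "self_dual X (i \<cdot> p)"
  shows "ambiently_selfdual (alg_ob X) (frob_dual X) i"
proof -
  have "dual_mor (frob_dual X) (frob_dual X) (i \<cdot> p) = i \<cdot> p"
    using self_dual_iff[OF X self_dual_mor[OF ip]] ip by simp
  moreover have "splits (alg_ob X) (i \<cdot> p) i p"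
    using i p pi by (auto simp: splits_def mor_iff)
  ultimately show ?thesis
    unfolding ambiently_selfdual_def ambient_dual_def by (intro exI[of _ p]) simp
qed

end

text \<open>
  An arbitrary upper bound of \<open>i\<close> and \<open>j\<close> need not split, but in an abelian category it is the kernel of
  some \<open>f\<close>, and \<open>f\<close> vanishes on \<open>i\<close> and \<open>j\<close>.
\<close>

lemma (in abelian_category) sub_joinI:
  assumes i: "i \<in> mor C A P" and j: "j \<in> mor C B P"
    and k: "k \<in> mor C D P" and r: "r \<in> mor C P D" and rk: "r \<cdot> k = idm D"
    and le: "(k \<cdot> r) \<cdot> i = i" "(k \<cdot> r) \<cdot> j = j"
    and univ: "\<And>Z f. \<lbrakk>f \<in> mor C P Z; f \<cdot> i = zero_mor A Z; f \<cdot> j = zero_mor B Z\<rbrakk> \<Longrightarrow> f \<cdot> k = zero_mor D Z"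
  shows "sub_join P k i j"
proof -
  have src: "src C i = A" "src C j = B" "src C k = D" "tgt C k = P"
    using i j k by (auto simp: mor_iff)
  have ri: "r \<cdot> i \<in> mor C A D" and rj: "r \<cdot> j \<in> mor C B D"
    using comp_closed i j r by blast+
  have "subobject P k"
    using split_monoI[OF k r rk] src by (simp add: subobject_def)
  moreover have "sub_le i k" "sub_le j k"
    unfolding sub_le_def src using ri rj le comp_assoc[OF i r k] comp_assoc[OF j r k] by auto
  moreover have "sub_le k l" if l: "subobject P l" "sub_le i l" "sub_le j l" for l
  proof -
    let ?L = "src C l"
    have l_mor: "l \<in> mor C ?L P"
      using l(1) by (auto simp: subobject_def is_mono_def)
    obtain u v where u: "u \<in> mor C A ?L" "l \<cdot> u = i" and v: "v \<in> mor C B ?L" "l \<cdot> v = j"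
      using l(2,3) by (auto simp: sub_le_def src)
    obtain g where g: "is_kernel l g"
      using l(1) mono_normal by (auto simp: subobject_def)
    have "src C g = P"
      using g l_mor by (auto simp: is_kernel_def mor_iff)
    then have g_mor: "g \<in> mor C P (tgt C g)"
      using g by (simp add: is_kernel_def)
    let ?Z = "tgt C g"
    have Z: "?Z \<in> Ob C"
      using mor_obD[OF g_mor] by simp
    have gl: "g \<cdot> l = zero_mor ?L ?Z"
      using kernelD(2)[OF g g_mor] .
    have "g \<cdot> i = zero_mor A ?Z"
      using comp_assoc[OF u(1) l_mor g_mor] u(2) gl comp_zero_left[OF u(1) Z] by simp
    moreover have "g \<cdot> j = zero_mor B ?Z"
      using comp_assoc[OF v(1) l_mor g_mor] v(2) gl comp_zero_left[OF v(1) Z] by simp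
    ultimately have "g \<cdot> k = zero_mor D ?Z"
      by (rule univ[OF g_mor])
    from kernelD(3)[OF g g_mor k this] show ?thesis
      by (auto simp: sub_le_def src)
  qed
  ultimately show ?thesis
    by (auto simp: sub_join_def)
qed

context semisimple_frobenius_algebra
begin

definition sym_proj :: "'m \<Rightarrow> bool" where
  "sym_proj a \<longleftrightarrow> a \<cdot> a = a \<and> self_dual X a \<and> self_adjoint a"

lemma sym_projD:
  assumes "sym_proj a"
  shows "a \<cdot> a = a" "self_dual X a" "self_adjoint a" "a \<in> mor C XO XO"
  using assms self_dual_mor by (auto simp: sym_proj_def)

lemma sym_proj_complement:
  assumes a: "sym_proj a"
  shows "sym_proj (idm XO \<ominus>\<^bsub>Hom C XO XO\<^esub> a)"
proof -
  note a' = sym_projD[OF a]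
  have id: "idm XO \<in> mor C XO XO"
    using mor_obD[OF a'(4)] id_mor_closed by simp
  let ?a = "idm XO \<ominus>\<^bsub>Hom C XO XO\<^esub> a"
  have "?a \<cdot> a = zero_mor XO XO"
    by (simp add: comp_diff_left[OF a'(4) id a'(4)] comp_id_left[OF a'(4)] a'(1) diff_self[OF a'(4)])
  moreover have "?a \<cdot> ?a = ?a \<ominus>\<^bsub>Hom C XO XO\<^esub> (?a \<cdot> a)"
    using comp_diff_right[OF id a'(4) diff_mor_closed[OF id a'(4)]] comp_id_right[OF diff_mor_closed[OF id a'(4)]]
    by simp
  ultimately have "?a \<cdot> ?a = ?a"
    using diff_zero_mor[OF diff_mor_closed[OF id a'(4)]] by simp
  then show ?thesis
    using a' by (simp add: sym_proj_def self_dual_diff self_dual_id frobenius self_adjoint_diff self_adjoint_id)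
qed

lemma ex_sym_proj_meet:
  assumes a: "sym_proj a" and b: "sym_proj b"
  shows "\<exists>c. sym_proj c \<and> a \<cdot> c = c \<and> c \<cdot> a = c \<and> b \<cdot> c = c \<and> c \<cdot> b = c \<and>
    (\<forall>Z. \<forall>y\<in>mor C Z XO. a \<cdot> y = y \<longrightarrow> b \<cdot> y = y \<longrightarrow> c \<cdot> y = y) \<and>
    (\<forall>Z. \<forall>f\<in>mor C XO Z. f \<cdot> a = f \<longrightarrow> f \<cdot> b = f \<longrightarrow> f \<cdot> c = f)"
proof -
  note a' = sym_projD[OF a] and b' = sym_projD[OF b]
  let ?N = "(idm XO \<ominus>\<^bsub>Hom C XO XO\<^esub> a) \<oplus>\<^bsub>Hom C XO XO\<^esub> (idm XO \<ominus>\<^bsub>Hom C XO XO\<^esub> b)"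
  obtain c where c: "endo_poly XO ?N c" "self_adjoint c" "c \<cdot> c = c" "c \<cdot> a = c" "c \<cdot> b = c"
    and univ: "\<forall>Z. \<forall>y\<in>mor C Z XO. a \<cdot> y = y \<longrightarrow> b \<cdot> y = y \<longrightarrow> c \<cdot> y = y"
      "\<forall>Z. \<forall>f\<in>mor C XO Z. f \<cdot> a = f \<longrightarrow> f \<cdot> b = f \<longrightarrow> f \<cdot> c = f"
    using ex_intersection_projection[OF a'(3,1) b'(3,1)] by blast
  have "self_dual X ?N"
    by (intro self_dual_add self_dual_diff self_dual_id frobenius a' b')
  then have tr: "self_dual X c"
    using c(1) by (rule self_dual_poly[OF frobenius])
  have "a \<cdot> c = c" "b \<cdot> c = c"
    using self_dual_comp_flip[OF frobenius tr a'(2) c(4)] self_dual_comp_flip[OF frobenius tr b'(2) c(5)] .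
  with c tr univ show ?thesis
    by (auto simp: sym_proj_def)
qed

text \<open>
  The projection is \<open>1 - c\<close>, where \<open>c\<close> is the meet of the complements \<open>1 - a\<close> and \<open>1 - b\<close>.
\<close>

lemma ex_sym_proj_join:
  assumes a: "sym_proj a" and b: "sym_proj b"
  shows "\<exists>d. sym_proj d \<and> d \<cdot> a = a \<and> d \<cdot> b = b \<and>
    (\<forall>Z. \<forall>f\<in>mor C XO Z. f \<cdot> a = zero_mor XO Z \<longrightarrow> f \<cdot> b = zero_mor XO Z \<longrightarrow> f \<cdot> d = zero_mor XO Z)"
proof -
  note a' = sym_projD[OF a] and b' = sym_projD[OF b]
  have id: "idm XO \<in> mor C XO XO"
    using mor_obD[OF a'(4)] id_mor_closed by simp
  let ?neg = "\<lambda>a. idm XO \<ominus>\<^bsub>Hom C XO XO\<^esub> a"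
  obtain c where c: "sym_proj c" "c \<cdot> ?neg a = c" "c \<cdot> ?neg b = c"
    and univ: "\<And>Z f. \<lbrakk>f \<in> mor C XO Z; f \<cdot> ?neg a = f; f \<cdot> ?neg b = f\<rbrakk> \<Longrightarrow> f \<cdot> c = f"
    using ex_sym_proj_meet[OF sym_proj_complement[OF a] sym_proj_complement[OF b]]
    by blast
  note c' = sym_projD[OF c(1)]
  have comp_neg: "f \<cdot> ?neg x = f \<ominus>\<^bsub>Hom C XO Z\<^esub> (f \<cdot> x)" if "f \<in> mor C XO Z" "x \<in> mor C XO XO" for f x Z
    using comp_diff_right[OF id that(2,1)] comp_id_right[OF that(1)] by simp
  have neg_comp: "?neg c \<cdot> x = x \<ominus>\<^bsub>Hom C XO XO\<^esub> (c \<cdot> x)" if "x \<in> mor C XO XO" for x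
    using comp_diff_left[OF that id c'(4)] comp_id_left[OF that] by simp
  have "c \<cdot> a = zero_mor XO XO" "c \<cdot> b = zero_mor XO XO"
    using c(2,3) comp_neg[OF c'(4) a'(4)] comp_neg[OF c'(4) b'(4)]
      diff_eq_self_iff[OF c'(4) comp_closed[OF a'(4) c'(4)]] diff_eq_self_iff[OF c'(4) comp_closed[OF b'(4) c'(4)]]
    by simp_all
  then have "?neg c \<cdot> a = a" "?neg c \<cdot> b = b"
    using neg_comp a'(4) b'(4) by (simp_all add: diff_zero_mor)
  moreover have "f \<cdot> ?neg c = zero_mor XO Z"
    if f: "f \<in> mor C XO Z" and "f \<cdot> a = zero_mor XO Z" "f \<cdot> b = zero_mor XO Z" for f Z
  proof -
    have "f \<cdot> c = f"
      using that comp_neg[OF f a'(4)] comp_neg[OF f b'(4)] by (intro univ) (simp_all add: diff_zero_mor[OF f])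
    then show ?thesis
      using comp_neg[OF f c'(4)] diff_self[OF f] by simp
  qed
  ultimately show ?thesis
    using sym_proj_complement[OF c(1)] by blast
qed

section \<open>The lattice of Frobenius subalgebras invariant under rigidity\<close>

text \<open>
  The idempotents of the Frobenius subalgebras that are invariant under rigidity.
\<close>

definition basis_idem :: "'m \<Rightarrow> bool" where
  "basis_idem a \<longleftrightarrow> subalgebra_idem X a \<and> self_adjoint a"

lemma basis_idem_projection: "basis_idem a \<Longrightarrow> sym_proj a"
  by (simp add: basis_idem_def subalgebra_idem_def sym_proj_def)

lemmas basis_idemD = sym_projD[OF basis_idem_projection]

lemma frobenius_basis_subalgebra_iff:
  "frobenius_basis_subalgebra X R \<B> A \<longleftrightarrow> frobenius_subalgebra X A \<and> basis_idem (subalg_idem X A)"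
  using rigid_invariant_iff_self_adjoint subalg_idem_subalgebra[OF frobenius]
  by (auto simp: frobenius_basis_subalgebra_def basis_idem_def)

lemma basis_idem_id: "basis_idem (idm XO)"
proof -
  note a = frobenius_arr[OF frobenius]
  show ?thesis
    using self_dual_id[OF frobenius] self_adjoint_id a
    by (simp add: basis_idem_def subalgebra_idem_def typing arr_comp_id)
qed

text \<open>
  The unit \<open>e\<close> and the product \<open>m \<circ> (c \<otimes> c)\<close> are fixed by \<open>a\<close> and \<open>b\<close>, and so by \<open>c\<close>.
\<close>

lemma basis_idem_meet:
  assumes a: "basis_idem a" and b: "basis_idem b" and c: "sym_proj c"
    and le: "a \<cdot> c = c" "b \<cdot> c = c"
    and univ: "\<And>Z y. \<lbrakk>y \<in> mor C Z XO; a \<cdot> y = y; b \<cdot> y = y\<rbrakk> \<Longrightarrow> c \<cdot> y = y"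
  shows "basis_idem c"
proof -
  note c' = sym_projD[OF c]
  let ?m = "alg_mult X" and ?e = "alg_unit X"
  let ?y = "?m \<cdot> (c \<otimes>\<^sub>m c)"
  have mult: "x \<cdot> ?y = ?y" if x: "basis_idem x" "x \<cdot> c = c" for x
  proof -
    have "arr x" "src C x = XO" "tgt C x = XO" "arr c" "src C c = XO" "tgt C c = XO"
      using basis_idemD(4)[OF x(1)] c'(4) by (auto simp: mor_iff)
    note ty = this frobenius_arr[OF frobenius]
    have eq: "x \<cdot> ?m \<cdot> (x \<otimes>\<^sub>m x) = ?m \<cdot> (x \<otimes>\<^sub>m x)"
      using x(1) by (simp add: basis_idem_def subalgebra_idem_def)
    have cc: "(x \<otimes>\<^sub>m x) \<cdot> (c \<otimes>\<^sub>m c) = c \<otimes>\<^sub>m c"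
      by (simp add: interchange ty x(2))
    have "(x \<cdot> ?m \<cdot> (x \<otimes>\<^sub>m x)) \<cdot> (c \<otimes>\<^sub>m c) = (?m \<cdot> (x \<otimes>\<^sub>m x)) \<cdot> (c \<otimes>\<^sub>m c)"
      unfolding eq ..
    then show ?thesis
      by (simp add: arr_assoc typing ty cc)
  qed
  have "arr c" "src C c = XO" "tgt C c = XO"
    using c'(4) by (auto simp: mor_iff)
  note ty = this frobenius_arr[OF frobenius]
  have "?e \<in> mor C \<^bold>1 XO" "?y \<in> mor C (XO \<otimes>\<^sub>o XO) XO"
    by (simp_all add: mor_iff typing ty)
  moreover have "a \<cdot> ?e = ?e" "b \<cdot> ?e = ?e"
    using a b by (simp_all add: basis_idem_def subalgebra_idem_def)
  ultimately have "c \<cdot> ?e = ?e" "c \<cdot> ?y = ?y"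
    using univ mult a b le by blast+
  then show ?thesis
    using c' by (simp add: basis_idem_def subalgebra_idem_def)
qed

definition idem_le :: "'m \<Rightarrow> 'm \<Rightarrow> bool" where
  "idem_le a b \<longleftrightarrow> a \<cdot> b = a \<and> b \<cdot> a = a"

lemma idem_le_trans:
  assumes "idem_le a b" "idem_le b c" "basis_idem a" "basis_idem b" "basis_idem c"
  shows "idem_le a c"
proof -
  note a = basis_idemD(4)[OF assms(3)] and b = basis_idemD(4)[OF assms(4)] and c = basis_idemD(4)[OF assms(5)]
  show ?thesis
    using assms(1,2) comp_assoc[OF c b a] comp_assoc[OF a b c] by (simp add: idem_le_def)
qed

lemma idem_le_antisym: "\<lbrakk>idem_le a b; idem_le b a\<rbrakk> \<Longrightarrow> a = b"
  by (simp add: idem_le_def)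

lemma idem_le_refl: "basis_idem a \<Longrightarrow> idem_le a a"
  by (simp add: idem_le_def basis_idemD)

text \<open>
  The last clause makes the image of \<open>c\<close> the intersection of the two images as subobjects of \<open>X\<close>, which is
  more than being the meet.
\<close>

lemma ex_basis_idem_meet:
  assumes a: "basis_idem a" and b: "basis_idem b"
  shows "\<exists>c. basis_idem c \<and> idem_le c a \<and> idem_le c b \<and>
    (\<forall>x. basis_idem x \<longrightarrow> idem_le x a \<longrightarrow> idem_le x b \<longrightarrow> idem_le x c) \<and>
    (\<forall>Z. \<forall>y\<in>mor C Z XO. a \<cdot> y = y \<longrightarrow> b \<cdot> y = y \<longrightarrow> c \<cdot> y = y)"
proof -
  obtain c where c: "sym_proj c" and le: "a \<cdot> c = c" "c \<cdot> a = c" "b \<cdot> c = c" "c \<cdot> b = c"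
    and univ: "\<And>Z y. \<lbrakk>y \<in> mor C Z XO; a \<cdot> y = y; b \<cdot> y = y\<rbrakk> \<Longrightarrow> c \<cdot> y = y"
      "\<And>Z f. \<lbrakk>f \<in> mor C XO Z; f \<cdot> a = f; f \<cdot> b = f\<rbrakk> \<Longrightarrow> f \<cdot> c = f"
    using ex_sym_proj_meet[OF basis_idem_projection[OF a] basis_idem_projection[OF b]] by blast
  have "idem_le x c" if "basis_idem x" "idem_le x a" "idem_le x b" for x
    using univ[OF basis_idemD(4)[OF that(1)]] that(2,3) by (simp add: idem_le_def)
  moreover have "basis_idem c"
    by (rule basis_idem_meet[OF a b c le(1,3) univ(1)])
  ultimately show ?thesis
    using le univ(1) by (auto simp: idem_le_def)
qed

text \<open>
  By the chain condition \<open>F\<close> has a minimal element, and the common lower bounds make it least.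
\<close>

lemma ex_least_basis_idem:
  assumes F: "\<And>a. a \<in> F \<Longrightarrow> basis_idem a" and nonempty: "a0 \<in> F"
    and meet: "\<And>a b. \<lbrakk>a \<in> F; b \<in> F\<rbrakk> \<Longrightarrow> \<exists>c\<in>F. idem_le c a \<and> idem_le c b"
  shows "\<exists>m\<in>F. \<forall>a\<in>F. idem_le m a"
proof -
  have "\<exists>m\<in>F. \<forall>a\<in>F. idem_le a m \<longrightarrow> a = m"
  proof (rule ccontr)
    assume "\<not> ?thesis"
    then have next_ex: "\<exists>b. b \<in> F \<and> idem_le b a \<and> b \<noteq> a" if "a \<in> F" for a
      using that by blast
    have "\<exists>u. \<forall>k::nat. u k \<in> F \<and> idem_le (u (Suc k)) (u k) \<and> u (Suc k) \<noteq> u k"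
      using dependent_nat_choice[of "\<lambda>_ a. a \<in> F" "\<lambda>_ a b. idem_le b a \<and> b \<noteq> a"] nonempty next_ex by blast
    then obtain u where u: "\<And>k::nat. u k \<in> F" "\<And>k. idem_le (u (Suc k)) (u k)" "\<And>k. u (Suc k) \<noteq> u k"
      by blast
    have "\<exists>k. u (Suc k) = u k"
      using F[OF u(1)] u(2) basis_idemD(1,4)
      by (intro decreasing_idempotents_stabilize[OF P fin_dim_endo]) (auto simp: idem_le_def)
    with u(3) show False by blast
  qed
  then obtain m where m: "m \<in> F" "\<And>a. \<lbrakk>a \<in> F; idem_le a m\<rbrakk> \<Longrightarrow> a = m"
    by blast
  have "idem_le m a" if "a \<in> F" for a
    using meet[OF m(1) that] m(2) by blast
  with m(1) show ?thesis by blast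
qed

definition idem_class :: "'m \<Rightarrow> ('o, 'm) frob_subalg set" where
  "idem_class a = {A. frobenius_subalgebra X A \<and> subalg_idem X A = a}"

lemma subalg_class_eq: "frobenius_subalgebra X A \<Longrightarrow> subalg_class X A = idem_class (subalg_idem X A)"
  by (auto simp: subalg_class_def subalg_equiv_def idem_class_def)

lemma ex_subalgebra_of_idem:
  assumes "basis_idem a"
  shows "\<exists>A. frobenius_subalgebra X A \<and> subalg_idem X A = a"
proof -
  have sub: "subalgebra_idem X a"
    using assms by (simp add: basis_idem_def)
  obtain A i p where "i \<in> mor C A XO" "p \<in> mor C XO A" "p \<cdot> i = idm A" "i \<cdot> p = a"
    using idempotent_splits[OF basis_idemD(4,1)[OF assms]] by blast
  from ex_frobenius_subalgebra[OF frobenius sub this] this(4) show ?thesis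
    by (auto simp: subalg_idem_def)
qed

lemma idem_class_nonempty: "basis_idem a \<Longrightarrow> idem_class a \<noteq> {}"
  using ex_subalgebra_of_idem by (auto simp: idem_class_def)

lemma basis_subalg_classes_eq: "basis_subalg_classes X R \<B> = idem_class ` Collect basis_idem"
proof (intro equalityI subsetI)
  fix c assume "c \<in> basis_subalg_classes X R \<B>"
  then show "c \<in> idem_class ` Collect basis_idem"
    by (auto simp: basis_subalg_classes_def frobenius_basis_subalgebra_iff subalg_class_eq)
next
  fix c assume "c \<in> idem_class ` Collect basis_idem"
  then obtain a where a: "basis_idem a" "c = idem_class a" by blast
  then obtain A where "frobenius_subalgebra X A" "subalg_idem X A = a"
    using ex_subalgebra_of_idem by blast
  with a show "c \<in> basis_subalg_classes X R \<B>"
    by (auto simp: basis_subalg_classes_def frobenius_basis_subalgebra_iff subalg_class_eq[symmetric])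
qed

lemma subalg_class_in_basis_classes:
  assumes A: "frobenius_subalgebra X A" and "subalg_class X A \<in> basis_subalg_classes X R \<B>"
  shows "basis_idem (subalg_idem X A)"
proof -
  obtain a where "basis_idem a" "idem_class (subalg_idem X A) = idem_class a"
    using assms by (auto simp: basis_subalg_classes_eq subalg_class_eq)
  moreover have "A \<in> idem_class (subalg_idem X A)"
    using A by (simp add: idem_class_def)
  ultimately show ?thesis
    by (auto simp: idem_class_def)
qed

lemma subalg_le_iff:
  assumes "basis_idem a" "basis_idem b"
  shows "subalg_le X (idem_class a) (idem_class b) \<longleftrightarrow> idem_le a b"
  using idem_class_nonempty[OF assms(1)] idem_class_nonempty[OF assms(2)]
  by (auto simp: subalg_le_def idem_class_def idem_le_def)

definition basis_order :: "('o, 'm) frob_subalg set gorder" where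
  "basis_order = subalg_poset X\<lparr>carrier := basis_subalg_classes X R \<B>\<rparr>"

lemma basis_order_simps:
  "carrier basis_order = idem_class ` Collect basis_idem" "eq basis_order = (=)"
  "le basis_order = subalg_le X"
  by (simp_all add: basis_order_def subalg_poset_def basis_subalg_classes_eq)

lemma partial_order_basis_order: "partial_order basis_order"
  by unfold_locales
    (auto simp: basis_order_simps subalg_le_iff dest: idem_le_antisym intro: idem_le_refl idem_le_trans)

lemma greatest_lower_meet:
  assumes a: "basis_idem a" and b: "basis_idem b" and c: "basis_idem c" "idem_le c a" "idem_le c b"
    and gl: "\<And>x. \<lbrakk>basis_idem x; idem_le x a; idem_le x b\<rbrakk> \<Longrightarrow> idem_le x c"
  shows "greatest basis_order (idem_class c) (Lower basis_order {idem_class a, idem_class b})"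
  using assms
  by (intro greatest_LowerI) (auto simp: basis_order_simps subalg_le_iff Lower_def)

text \<open>
  The sum of two subalgebras is in general not a subalgebra, so the join is not the projection onto the
  sum but the least upper bound, found below the upper bound \<open>1\<close>.
\<close>

lemma ex_join:
  assumes a: "basis_idem a" and b: "basis_idem b"
  shows "\<exists>s. least basis_order s (Upper basis_order {idem_class a, idem_class b})"
proof -
  let ?F = "{u. basis_idem u \<and> idem_le a u \<and> idem_le b u}"
  have "\<exists>m\<in>?F. \<forall>x\<in>?F. idem_le m x"
  proof (rule ex_least_basis_idem)
    show "idm XO \<in> ?F"
      using basis_idem_id a b comp_id_left[OF basis_idemD(4)] comp_id_right[OF basis_idemD(4)]
      by (simp add: idem_le_def)
    show "\<exists>c\<in>?F. idem_le c u \<and> idem_le c v" if "u \<in> ?F" "v \<in> ?F" for u v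
      using ex_basis_idem_meet[of u v] that a b by blast
  qed simp
  then obtain m where m: "basis_idem m" "idem_le a m" "idem_le b m"
    and le: "\<And>x. \<lbrakk>basis_idem x; idem_le a x; idem_le b x\<rbrakk> \<Longrightarrow> idem_le m x"
    by blast
  have "least basis_order (idem_class m) (Upper basis_order {idem_class a, idem_class b})"
    using a b m le by (intro least_UpperI) (auto simp: basis_order_simps subalg_le_iff Upper_def)
  then show ?thesis ..
qed

lemma lattice_basis_order: "lattice basis_order"
proof -
  interpret partial_order basis_order
    by (rule partial_order_basis_order)
  show ?thesis
  proof unfold_locales
    fix x y assume "x \<in> carrier basis_order" "y \<in> carrier basis_order"
    then obtain a b where ab: "basis_idem a" "basis_idem b" "x = idem_class a" "y = idem_class b"
      by (auto simp: basis_order_simps)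
    then show "\<exists>s. least basis_order s (Upper basis_order {x, y})"
      using ex_join by blast
    show "\<exists>s. greatest basis_order s (Lower basis_order {x, y})"
      using ex_basis_idem_meet[OF ab(1,2)] greatest_lower_meet[OF ab(1,2)] unfolding ab(3,4) by blast
  qed
qed

lemma ex_bottom: "\<exists>c. least basis_order c (basis_subalg_classes X R \<B>)"
proof -
  have "\<exists>m\<in>Collect basis_idem. \<forall>a\<in>Collect basis_idem. idem_le m a"
  proof (rule ex_least_basis_idem)
    show "idm XO \<in> Collect basis_idem"
      using basis_idem_id by simp
    show "\<exists>c\<in>Collect basis_idem. idem_le c a \<and> idem_le c b" if "a \<in> Collect basis_idem" "b \<in> Collect basis_idem" for a b
      using ex_basis_idem_meet[of a b] that by blast
  qed simp
  then obtain m where "basis_idem m" "\<And>a. basis_idem a \<Longrightarrow> idem_le m a"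
    by blast
  then have "least basis_order (idem_class m) (basis_subalg_classes X R \<B>)"
    by (auto simp: least_def basis_order_simps basis_subalg_classes_eq subalg_le_iff)
  then show ?thesis ..
qed

lemma coherent_pair_subalgebras:
  assumes A: "frobenius_subalgebra X A" and B: "frobenius_subalgebra X B"
    and a: "basis_idem (subalg_idem X A)" and b: "basis_idem (subalg_idem X B)"
  shows "coherent_pair XO dual_X (incl A) (incl B)"
    and "\<exists>D. frobenius_subalgebra X D \<and> sub_intersection (incl D) (incl A) (incl B) \<and>
      subalg_class X A \<sqinter>\<^bsub>basis_order\<^esub> subalg_class X B = subalg_class X D"
proof -
  let ?a = "subalg_idem X A" and ?b = "subalg_idem X B"
  note SA = subalgebra_split[OF frobenius A] and SB = subalgebra_split[OF frobenius B]
  obtain c where c: "basis_idem c" "idem_le c ?a" "idem_le c ?b"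
    and gl: "\<And>x. \<lbrakk>basis_idem x; idem_le x ?a; idem_le x ?b\<rbrakk> \<Longrightarrow> idem_le x c"
    and univ: "\<And>Z y. \<lbrakk>y \<in> mor C Z XO; ?a \<cdot> y = y; ?b \<cdot> y = y\<rbrakk> \<Longrightarrow> c \<cdot> y = y"
    using ex_basis_idem_meet[OF a b] by blast
  obtain D where D: "frobenius_subalgebra X D" "subalg_idem X D = c"
    using ex_subalgebra_of_idem[OF c(1)] by blast
  note SD = subalgebra_split[OF frobenius D(1)]
  have cD: "c = incl D \<cdot> incl_dual X D"
    using D(2) by (simp add: subalg_idem_def)
  have c_fix: "c \<cdot> incl D = incl D"
    unfolding cD using comp_assoc[OF SD(1,2,1)] SD(3) comp_id_right[OF SD(1)] by simp
  have fixes_D: "x \<cdot> incl D = incl D" if "basis_idem x" "idem_le c x" for x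
    using comp_assoc[OF SD(1) basis_idemD(4)[OF c(1)] basis_idemD(4)[OF that(1)]] c_fix that(2) by (simp add: idem_le_def)
  have inter: "sub_intersection (incl D) (incl A) (incl B)"
    using fixes_D[OF a c(2)] fixes_D[OF b c(3)] univ
    by (intro sub_intersectionI[OF SA SB SD]) (simp_all add: subalg_idem_def[symmetric] D(2))
  have sd: "ambiently_selfdual XO dual_X (incl S)"
    if S: "frobenius_subalgebra X S" for S
    using subalg_idem_subalgebra[OF frobenius S]
    by (intro ambiently_selfdualI[OF frobenius subalgebra_split[OF frobenius S]])
      (simp add: subalgebra_idem_def subalg_idem_def)
  obtain d where d: "sym_proj d" "d \<cdot> ?a = ?a" "d \<cdot> ?b = ?b"
    and d_univ: "\<And>Z f. \<lbrakk>f \<in> mor C XO Z; f \<cdot> ?a = zero_mor XO Z; f \<cdot> ?b = zero_mor XO Z\<rbrakk>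
      \<Longrightarrow> f \<cdot> d = zero_mor XO Z"
    using ex_sym_proj_join[OF basis_idem_projection[OF a] basis_idem_projection[OF b]] by blast
  note d' = sym_projD[OF d(1)]
  obtain E k r where k: "k \<in> mor C E XO" and r: "r \<in> mor C XO E" and rk: "r \<cdot> k = idm E" and kr: "k \<cdot> r = d"
    using idempotent_splits[OF d'(4,1)] by blast
  have incl: "d \<cdot> incl S = incl S" if S: "frobenius_subalgebra X S" and "d \<cdot> subalg_idem X S = subalg_idem X S" for S
  proof -
    note SS = subalgebra_split[OF frobenius S]
    have "subalg_idem X S \<cdot> incl S = incl S"
      unfolding subalg_idem_def using comp_assoc[OF SS(1,2,1)] SS(3) comp_id_right[OF SS(1)] by simp
    then show ?thesis
      using comp_assoc[OF SS(1) comp_closed[OF SS(2,1)] d'(4)] that(2) by (simp add: subalg_idem_def)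
  qed
  have join: "sub_join XO k (incl A) (incl B)"
  proof (rule sub_joinI[OF SA(1) SB(1) k r rk])
    show "(k \<cdot> r) \<cdot> incl A = incl A" "(k \<cdot> r) \<cdot> incl B = incl B"
      using incl A B d by (simp_all add: kr)
    fix Z f assume f: "f \<in> mor C XO Z"
      and zero: "f \<cdot> incl A = zero_mor (alg_ob A) Z" "f \<cdot> incl B = zero_mor (alg_ob B) Z"
    have Z: "Z \<in> Ob C" and E: "E \<in> Ob C"
      using f k mor_obD by blast+
    have "f \<cdot> ?a = zero_mor XO Z" "f \<cdot> ?b = zero_mor XO Z"
      unfolding subalg_idem_def
      using comp_assoc[OF SA(2,1) f] comp_assoc[OF SB(2,1) f] zero comp_zero_left[OF SA(2) Z] comp_zero_left[OF SB(2) Z]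
      by simp_all
    then have "f \<cdot> d = zero_mor XO Z"
      using d_univ[OF f] by blast
    moreover have "d \<cdot> k = k"
      unfolding kr[symmetric] using comp_assoc[OF k r k] rk comp_id_right[OF k] by simp
    ultimately show "f \<cdot> k = zero_mor E Z"
      using comp_assoc[OF k d'(4) f] comp_zero_left[OF k Z] by simp
  qed
  have sd_k: "ambiently_selfdual XO dual_X k"
    using d'(2) by (intro ambiently_selfdualI[OF frobenius k r rk]) (simp add: kr)
  have subobj: "subobject XO (incl A)" "subobject XO (incl B)"
    using split_monoI[OF SA] split_monoI[OF SB] SA(1) SB(1) by (simp_all add: subobject_def mor_iff)
  show "coherent_pair XO dual_X (incl A) (incl B)"
    unfolding coherent_pair_def
  proof (intro conjI)
    show "\<exists>k. sub_intersection k (incl A) (incl B) \<and> ambiently_selfdual XO dual_X k"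
      using inter sd[OF D(1)] by (intro exI[of _ "incl D"] conjI)
    show "\<exists>k. sub_join XO k (incl A) (incl B) \<and> ambiently_selfdual XO dual_X k"
      using join sd_k by (intro exI[of _ k] conjI)
  qed (fact subobj sd[OF A] sd[OF B])+
  interpret L: lattice basis_order
    by (rule lattice_basis_order)
  have "subalg_class X A \<sqinter>\<^bsub>basis_order\<^esub> subalg_class X B = idem_class c"
    unfolding subalg_class_eq[OF A] subalg_class_eq[OF B]
  proof (rule L.meetI)
    show "l = idem_class c"
      if "greatest basis_order l (Lower basis_order {idem_class ?a, idem_class ?b})" for l
      using that greatest_lower_meet[OF a b c gl] by (rule L.greatest_unique)
  qed (simp_all add: basis_order_simps a b)
  then show "\<exists>D. frobenius_subalgebra X D \<and> sub_intersection (incl D) (incl A) (incl B) \<and>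
      subalg_class X A \<sqinter>\<^bsub>basis_order\<^esub> subalg_class X B = subalg_class X D"
    using D inter subalg_class_eq[OF D(1)] by (intro exI[of _ D]) simp
qed

theorem coherent_sublattice_basis_subalg_classes:
  "coherent_sublattice X (basis_subalg_classes X R \<B>)"
  unfolding coherent_sublattice_def basis_order_def[symmetric]
proof (intro conjI allI impI)
  show "basis_subalg_classes X R \<B> \<subseteq> carrier (subalg_poset X)"
    by (auto simp: basis_subalg_classes_def subalg_poset_def frobenius_basis_subalgebra_def subalg_class_def
      quotient_def)
  show "lattice basis_order"
    by (rule lattice_basis_order)
  show "\<exists>c. least basis_order c (basis_subalg_classes X R \<B>)"
    by (rule ex_bottom)
  fix A B assume "frobenius_subalgebra X A \<and> frobenius_subalgebra X B \<and>
    subalg_class X A \<in> basis_subalg_classes X R \<B> \<and> subalg_class X B \<in> basis_subalg_classes X R \<B>"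
  then show "coherent_pair XO dual_X (incl A) (incl B)"
    "\<exists>D. frobenius_subalgebra X D \<and> sub_intersection (incl D) (incl A) (incl B) \<and>
      subalg_class X A \<sqinter>\<^bsub>basis_order\<^esub> subalg_class X B = subalg_class X D"
    using coherent_pair_subalgebras subalg_class_in_basis_classes by blast+
qed

end

theorem proposition9p5:
  fixes C :: "('o, 'm) moncat"
    and X :: "('o, 'm) frob_alg"
    and R :: "'o set"
    and \<B> :: "'o \<Rightarrow> 'm set"
  assumes C: "rigid_abelian_monoidal_category C"
    and unit_simple: "linear_category.simple C (unit_ob C)"
    and schur: "\<And>S f. linear_category.simple C S \<Longrightarrow> f \<in> mor C S S
      \<Longrightarrow> \<exists>z. f = z \<odot>\<^bsub>Hom C S S\<^esub> id_mor C S"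
    and X: "linear_monoidal_category.frobenius_algebra C X"
    and X_finite_length: "linear_category.finite_length C (alg_ob X)"
    and X_semisimple: "linear_category.semisimple C (alg_ob X)"
    and \<B>: "linear_category.basis_of_object C (alg_ob X) R \<B>"
  shows "linear_monoidal_category.coherent_sublattice C X
    (linear_monoidal_category.basis_subalg_classes C X R \<B>)"
proof -
  interpret rigid_abelian_monoidal_category C
    by (rule C)
  have "simple_representatives R"
    using \<B> by (simp add: basis_of_object_def)
  from semisimple_decomposition[OF X_semisimple this]
  obtain n :: nat and T j e where "alg_ob X \<in> Ob C"
    and "\<forall>k<n. T k \<in> R \<and> j k \<in> mor C (T k) (alg_ob X) \<and> e k \<in> mor C (alg_ob X) (T k)"
    and "(\<Oplus>\<^bsub>Hom C (alg_ob X) (alg_ob X)\<^esub>k\<in>{..<n}. comp_mor C (j k) (e k)) = id_mor C (alg_ob X)"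
    by blast
  then interpret semisimple_frobenius_algebra C X R \<B> n T j e
    using schur X \<B> by unfold_locales auto
  show ?thesis
    by (rule coherent_sublattice_basis_subalg_classes)
qed

end
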